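(* Given $\varepsilon>0$, there is $\delta(\varepsilon)>0$ such that the following holds. Let $p$ be a large prime, let $\chi$ be a non-principal multiplicative character of $\mathbb{F}_p$, and let $f(x,y)=x^3+ax^2y+bxy^2+cy^3$ with $a,b,c\in\mathbb{F}_p$ be non-degenerate over $\mathbb{F}_p$. Let $I,J\subseteq[1,p-1]$ be intervals of size $|I|,|J|=p^{3/8+\varepsilon}$. Then \[ \left|\sum_{x\in I,\,y\in J}\chi(f(x,y))\right| < p^{-\delta(\varepsilon)}\,|I|\,|J|. \] This estimate is uniform in $f$ (i.e. $\delta$ does not depend on $a,b,c$).
   Context: An interval is a set of consecutive integers $\{n\in\mathbb{Z}:a\le n\le b\}$. The cubic form $f$ is called non-degenerate over $\mathbb{F}_p$ if its dehomogenization $f(x,1)=x^3+ax^2+bx+c$ has no root of multiplicity greater than $1$ (over an algebraic closure of $\mathbb{F}_p$). Multiplicative characters are extended by $\chi(0)=0$. *)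

theory Defs
  imports Complex_Main "HOL-Number_Theory.Residues" "HOL-Algebra.Algebraic_Closure"
begin

text \<open>The field of \<open>p\<close> elements is \<open>residue_ring (int p)\<close>, with carrier
  \<open>{0..int p - 1}\<close>, so that integers in \<open>{1..int p - 1}\<close> are themselves field elements.
  An explicit carrier (rather than a type) allows the prime to be quantified after the
  constants that must not depend on it.\<close>

definition mult_character :: "('a, 'm) ring_scheme \<Rightarrow> ('a \<Rightarrow> complex) \<Rightarrow> bool" where
  "mult_character F \<chi> \<longleftrightarrow>
     (\<forall>x \<in> carrier F - {\<zero>\<^bsub>F\<^esub>}. \<chi> x \<noteq> 0) \<and>
     (\<forall>x \<in> carrier F - {\<zero>\<^bsub>F\<^esub>}. \<forall>y \<in> carrier F - {\<zero>\<^bsub>F\<^esub>}. \<chi> (x \<otimes>\<^bsub>F\<^esub> y) = \<chi> x * \<chi> y) \<and>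
     \<chi> \<zero>\<^bsub>F\<^esub> = 0"

definition principal_character :: "('a, 'm) ring_scheme \<Rightarrow> ('a \<Rightarrow> complex) \<Rightarrow> bool" where
  "principal_character F \<chi> \<longleftrightarrow>
     mult_character F \<chi> \<and> (\<forall>x \<in> carrier F - {\<zero>\<^bsub>F\<^esub>}. \<chi> x = 1)"

definition cubic_form :: "('a, 'm) ring_scheme \<Rightarrow> 'a \<Rightarrow> 'a \<Rightarrow> 'a \<Rightarrow> 'a \<Rightarrow> 'a \<Rightarrow> 'a" where
  "cubic_form F a b c x y =
     x [^]\<^bsub>F\<^esub> (3::nat)
     \<oplus>\<^bsub>F\<^esub> a \<otimes>\<^bsub>F\<^esub> x [^]\<^bsub>F\<^esub> (2::nat) \<otimes>\<^bsub>F\<^esub> y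
     \<oplus>\<^bsub>F\<^esub> b \<otimes>\<^bsub>F\<^esub> x \<otimes>\<^bsub>F\<^esub> y [^]\<^bsub>F\<^esub> (2::nat)
     \<oplus>\<^bsub>F\<^esub> c \<otimes>\<^bsub>F\<^esub> y [^]\<^bsub>F\<^esub> (3::nat)"

text \<open>Polynomials in HOL-Algebra are coefficient lists, leading coefficient first.
  The map \<open>ring.indexed_const F\<close> is the embedding of \<open>F\<close> into its algebraic closure.\<close>

definition dehomogenized_cubic :: "('a, 'm) ring_scheme \<Rightarrow> 'a \<Rightarrow> 'a \<Rightarrow> 'a \<Rightarrow> 'a list" where
  "dehomogenized_cubic F a b c = [\<one>\<^bsub>F\<^esub>, a, b, c]"

definition nondegenerate_cubic :: "('a, 'm) ring_scheme \<Rightarrow> 'a \<Rightarrow> 'a \<Rightarrow> 'a \<Rightarrow> bool" where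
  "nondegenerate_cubic F a b c \<longleftrightarrow>
     (\<forall>x \<in> carrier (field.alg_closure F).
        \<not> ring.alg_mult (field.alg_closure F)
            (map (ring.indexed_const F) (dehomogenized_cubic F a b c)) x > 1)"

definition int_interval :: "int set \<Rightarrow> bool" where
  "int_interval I \<longleftrightarrow> (\<exists>m n. I = {m..n})"

text \<open>The size \<open>p powr (3/8 + \<epsilon>)\<close> prescribed for an interval is in general not an integer.
  It is read up to rounding, in either direction.\<close>

definition size_up_to_rounding :: "'a set \<Rightarrow> real \<Rightarrow> bool" where
  "size_up_to_rounding A s \<longleftrightarrow> finite A \<and> \<bar>real (card A) - s\<bar> < 1"

end

(* Burgess' method in the cubic algebra A = F_p[X]/(f(X,1)), in which f(x,y) is the norm of x - y X.
   Shifting (x,y) by multiples of short vectors (s,t) and dividing by s - t X reduces the sum to the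
   average over u in A of |sum_{t <= T} chi(N(u + t))|, weighted by the number of representations of u
   as a quotient (x - y X) / (s - t X).  By Hoelder's inequality two inputs suffice.  The second moment
   of the weights counts solutions of z s' = z' s; as products of two linear polynomials have degree
   less than 3, this is an identity in F_p[X], and unique factorisation leads to congruences
   x r = x' r' in short intervals.  The 2k-th moment of the character sums is bounded by Weil's theorem:
   complete sums over A are products of the sums over F_p, F_{p^2}, F_{p^3} attached to one and the
   same L-function over F_p.  Weil's bound itself follows from Stepanov's method over F_{p^(2m)},
   m -> infinity, whose constant may depend on p because L is a polynomial. *)

theory Submission
  imports Defs "HOL-Algebra.Algebraic_Closure_Type"
    "HOL-Computational_Algebra.Polynomial_FPS" "HOL-Computational_Algebra.Fundamental_Theorem_Algebra"
begin

hide_const (open) Divisibility.prime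

section \<open>The Frobenius map in an algebraic closure\<close>

text \<open>The exponent 3/8 comes from comparing the two inputs. Let N be the side of the box and
  let s, t run up to H. There are about N^2 H^2 quotients, their second moment exceeds this number
  only by a logarithm, and square root cancellation in an algebra of p^3 elements costs p^(3/2);
  Hoelder's inequality therefore saves a power of p once N^2 H^2 exceeds p^(3/2). Since the shifts,
  of length T H, must be short against N, H stays slightly below N, which leaves N > p^(3/8). The
  tuples of shifts without cancellation become negligible for a moment of order 2k with T^k >=
  p^(3/2), so k, and with it the saving, depends on epsilon alone. The cubic enters only through the
  action of Frobenius on its roots, and the moments are taken over the whole algebra; hence the
  uniformity in a, b, c.

  Stepanov's method is used in a restricted form, for polynomials with a simple zero in the prime
  field. To meet this condition the moment is split according to whether some shift occurs exactly
  once among the 2k shifts.\<close>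

locale closed_char_p =
  fixes p :: nat and K :: "'a::alg_closed_field itself"
  assumes CHAR_eq: "CHAR('a) = p" and prime_p: "prime p"
begin

lemma p_gt_1: "p > 1" and p_pos: "p > 0"
  using prime_gt_1_nat[OF prime_p] prime_gt_0_nat[OF prime_p] by blast+

lemma prime_CHAR: "prime CHAR('a)" using CHAR_eq prime_p by simp

lemma frob_add: "((x::'a) + y) ^ (p ^ n) = x ^ (p ^ n) + y ^ (p ^ n)"
  using freshmans_dream'[OF prime_CHAR, of "p ^ n" n x y] CHAR_eq by simp

lemma frob_sum: "(\<Sum>i\<in>A. f i :: 'a) ^ (p ^ n) = (\<Sum>i\<in>A. f i ^ (p ^ n))"
  using freshmans_dream_sum'[OF prime_CHAR, of "p ^ n" n f A] CHAR_eq by simp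

lemma frob_minus: "(- (x::'a)) ^ (p ^ n) = - (x ^ (p ^ n))"
proof -
  have "(x + (- x)) ^ (p ^ n) = x ^ (p ^ n) + (- x) ^ (p ^ n)" by (rule frob_add)
  moreover have "(x + (- x)) ^ (p ^ n) = 0" using p_pos by simp
  ultimately show ?thesis by (simp add: eq_neg_iff_add_eq_0 add.commute)
qed

lemma frob_diff: "((x::'a) - y) ^ (p ^ n) = x ^ (p ^ n) - y ^ (p ^ n)"
  using frob_add[of x "- y" n] by (simp add: frob_minus)

lemma frob_inj: "(x::'a) ^ (p ^ n) = y ^ (p ^ n) \<longleftrightarrow> x = y"
proof
  assume "x ^ (p ^ n) = y ^ (p ^ n)"
  hence "(x - y) ^ (p ^ n) = 0" by (simp add: frob_diff)
  thus "x = y" by simp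
qed simp

text \<open>An algebraic closure contains exactly one field of \<open>p ^ n\<close> elements for
  each positive \<open>n\<close>, so all extensions of the prime field can be subsets of a single
  type.\<close>

definition Fq :: "nat \<Rightarrow> 'a set" where "Fq n = {x. x ^ (p ^ n) = x}"

lemma Fq_intros [simp, intro]:
  "0 \<in> Fq n" "1 \<in> Fq n"
  "x \<in> Fq n \<Longrightarrow> y \<in> Fq n \<Longrightarrow> x + y \<in> Fq n"
  "x \<in> Fq n \<Longrightarrow> y \<in> Fq n \<Longrightarrow> x - y \<in> Fq n"
  "x \<in> Fq n \<Longrightarrow> y \<in> Fq n \<Longrightarrow> x * y \<in> Fq n"
  "x \<in> Fq n \<Longrightarrow> y \<in> Fq n \<Longrightarrow> x / y \<in> Fq n"
  "x \<in> Fq n \<Longrightarrow> - x \<in> Fq n"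
  "x \<in> Fq n \<Longrightarrow> inverse x \<in> Fq n"
  "x \<in> Fq n \<Longrightarrow> x ^ m \<in> Fq n"
  using p_pos by (auto simp: Fq_def frob_add frob_diff frob_minus power_mult_distrib power_divide
    power_inverse power_mult[symmetric] mult.commute[of m] power_0_left) (metis power_mult mult.commute)

lemma Fq_sum [intro]: "(\<And>i. i \<in> A \<Longrightarrow> f i \<in> Fq n) \<Longrightarrow> (\<Sum>i\<in>A. f i) \<in> Fq n"
  by (induction A rule: infinite_finite_induct) auto

lemma Fq_prod [intro]: "(\<And>i. i \<in> A \<Longrightarrow> f i \<in> Fq n) \<Longrightarrow> (\<Prod>i\<in>A. f i) \<in> Fq n"
  by (induction A rule: infinite_finite_induct) auto

lemma Fq_of_nat [simp, intro]: "of_nat m \<in> Fq n" by (induction m) auto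
lemma Fq_of_int [simp, intro]: "of_int m \<in> Fq n" by (cases m) auto

lemma Fq_iterate: "x \<in> Fq n \<Longrightarrow> x ^ (p ^ (n * k)) = x"
proof (induction k)
  case (Suc k)
  have "x ^ (p ^ (n * Suc k)) = (x ^ (p ^ n)) ^ (p ^ (n * k))"
    by (simp add: power_add power_mult[symmetric])
  thus ?case using Suc by (simp add: Fq_def)
qed simp

lemma Fq_mono_dvd: "n dvd m \<Longrightarrow> Fq n \<subseteq> Fq m"
  using Fq_iterate by (auto simp: Fq_def[of m] elim!: dvdE)

lemma Fq_1_subset: "Fq 1 \<subseteq> Fq n" by (rule Fq_mono_dvd) simp

text \<open>The polynomial \<open>X ^ N - X\<close> has derivative -1 in characteristic
  \<open>p\<close>, hence no repeated root, and it splits because the field is algebraically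
  closed.\<close>

lemma card_Fq: assumes "n > 0" shows "finite (Fq n)" "card (Fq n) = p ^ n"
proof -
  define N where "N = p ^ n"
  have N: "N > 1" unfolding N_def using one_less_power[OF p_gt_1 assms] .
  define q :: "'a poly" where "q = monom 1 N - monom 1 1"
  have degq: "degree q = N"
    unfolding q_def diff_conv_add_uminus using N by (subst degree_add_eq_left) (auto simp: degree_monom_eq)
  have lc: "lead_coeff q = 1" unfolding degq using N by (simp add: q_def)
  have q0: "q \<noteq> 0" using degq N by auto
  have rts: "poly q x = 0 \<longleftrightarrow> x \<in> Fq n" for x
    by (simp add: q_def Fq_def poly_monom N_def)
  obtain A where A: "size A = N" "q = (\<Prod>x\<in>#A. [:-x, 1:])"
    using alg_closed_imp_factorization[OF q0] degq lc by auto
  have ofN: "of_nat N = (0::'a)"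
    using CHAR_eq assms by (auto simp: of_nat_eq_0_iff_char_dvd N_def)
  have pd: "pderiv q = [:-1:]"
    by (simp add: q_def pderiv_diff pderiv_monom ofN) (simp add: one_pCons)
  have cnt: "count A x \<le> 1" for x
  proof (rule ccontr)
    assume "\<not> count A x \<le> 1"
    then obtain B where "A = add_mset x (add_mset x B)"
      by (metis One_nat_def count_greater_zero_iff count_single diff_is_0_eq' insert_DiffM
          leI less_Suc0 not_gr_zero count_add_mset diff_Suc_1 linorder_not_less nat_le_linear)
    hence "q = [:-x,1:] * ([:-x,1:] * (\<Prod>x\<in>#B. [:-x, 1:]))" using A by (simp add: mult.assoc)
    then obtain r where r: "q = [:-x,1:] * ([:-x,1:] * r)" by blast
    have "poly (pderiv q) x = 0" unfolding r pderiv_mult poly_add poly_mult by simp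
    thus False by (simp add: pd)
  qed
  have "set_mset A = Fq n"
  proof -
    have "poly q x = 0 \<longleftrightarrow> x \<in> set_mset A" for x
      unfolding A(2) by (induction A) (auto)
    thus ?thesis using rts by blast
  qed
  moreover have "card (set_mset A) = size A"
  proof -
    have "size A = (\<Sum>x\<in>set_mset A. count A x)" by (simp add: size_multiset_overloaded_eq)
    also have "\<dots> = (\<Sum>x\<in>set_mset A. 1)"
      using cnt by (intro sum.cong) (auto simp: le_antisym Suc_leI)
    finally show ?thesis by simp
  qed
  ultimately show "finite (Fq n)" "card (Fq n) = p ^ n"
    using A(1) N_def by (metis finite_set_mset, simp)
qed

lemma of_int_eq_0_iff: "(of_int a :: 'a) = 0 \<longleftrightarrow> int p dvd a"
  using of_int_eq_0_iff_char_dvd[where ?'a = 'a, of a] CHAR_eq by simp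

lemma of_nat_inj_on: "inj_on (of_nat :: nat \<Rightarrow> 'a) {..<p}"
proof (rule inj_onI)
  fix x y :: nat assume xy: "x \<in> {..<p}" "y \<in> {..<p}" "of_nat x = (of_nat y :: 'a)"
  hence "[x = y] (mod p)" by (simp add: of_nat_eq_iff_cong_CHAR CHAR_eq)
  thus "x = y" using xy by (simp add: cong_def)
qed

lemma Fq_1_eq: "Fq 1 = of_nat ` {..<p}"
proof -
  have "card (of_nat ` {..<p} :: 'a set) = p" using card_image[OF of_nat_inj_on] by simp
  thus ?thesis using card_Fq[of 1] by (intro card_subset_eq[symmetric]) auto
qed

lemma Fq_1_power: "x \<in> Fq 1 \<Longrightarrow> x \<noteq> 0 \<Longrightarrow> x ^ (p - 1) = 1"
proof -
  assume x: "x \<in> Fq 1" "x \<noteq> 0"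
  have "x * x ^ (p - 1) = x ^ p" using p_pos by (metis power_eq_if less_not_refl)
  also have "\<dots> = x * 1" using x by (simp add: Fq_def)
  finally show ?thesis using x by (subst (asm) mult_cancel_left) simp
qed

section \<open>Norms to the prime field, written as powers\<close>

definition esum :: "nat \<Rightarrow> nat" where "esum n = (\<Sum>l<n. p ^ l)"

lemma esum_eq: "p * esum n + 1 = esum n + p ^ n"
  unfolding esum_def by (induction n) (auto simp: algebra_simps)

lemma esum_mult: "(p - 1) * esum n = p ^ n - 1"
proof -
  have "p * esum n - esum n = p ^ n - 1" using esum_eq[of n] by linarith
  thus ?thesis by (simp add: diff_mult_distrib)
qed

text \<open>Transitivity of the norm in a tower of two extensions. In Stepanov's method it splits a
  norm into \<open>w * w ^ P\<close>, whose second factor is a constant modulo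
  \<open>(X - x) ^ P\<close>.\<close>

lemma esum_double: "esum (2 * n) = esum n * (1 + p ^ n)"
proof -
  have "esum (n + m) = esum n + p ^ n * esum m" for m
    by (induction m) (auto simp: esum_def algebra_simps power_add)
  from this[of n] show ?thesis unfolding mult_2 by (simp add: distrib_left mult.commute)
qed

lemma esum_pos: "n > 0 \<Longrightarrow> esum n > 0"
  unfolding esum_def using p_pos by (intro sum_pos) (auto simp: lessThan_empty_iff)

text \<open>Raising \<open>y ^ esum n\<close> to the power \<open>p\<close> multiplies it by
  \<open>y ^ (p ^ n) / y\<close>, which is 1 for nonzero \<open>y\<close>.\<close>

lemma norm_in_Fq1: assumes "y \<in> Fq n" shows "y ^ esum n \<in> Fq 1"
proof (cases "y = 0")
  case True thus ?thesis by auto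
next
  case False
  have "(y ^ esum n) ^ p * y = y ^ (p * esum n + 1)" by (simp add: power_mult[symmetric] mult.commute)
  also have "\<dots> = y ^ esum n * y" unfolding esum_eq power_add using assms by (simp add: Fq_def)
  finally show ?thesis using False by (simp add: Fq_def)
qed

section \<open>Polynomials over the prime field\<close>

definition frob_poly :: "'a poly \<Rightarrow> 'a poly" where "frob_poly = map_poly (\<lambda>x. x ^ p)"
definition Pol :: "'a poly set" where "Pol = {f. \<forall>i. coeff f i \<in> Fq 1}"

lemma coeff_frob_poly [simp]: "coeff (frob_poly f) i = coeff f i ^ p"
  unfolding frob_poly_def using p_pos by (simp add: coeff_map_poly)

text \<open>With the prime field described by a multiplicative map, closure of \<open>Pol\<close>
  under products and under exact division is immediate.\<close>

lemma Pol_iff: "f \<in> Pol \<longleftrightarrow> frob_poly f = f"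
  by (auto simp: Pol_def Fq_def poly_eq_iff)

lemma frob_poly_mult: "frob_poly (f * g) = frob_poly f * frob_poly g"
proof (rule poly_eqI)
  fix n
  have "(\<Sum>i\<le>n. coeff f i * coeff g (n - i)) ^ p = (\<Sum>i\<le>n. (coeff f i * coeff g (n - i)) ^ p)"
    using frob_sum[of _ _ 1] by simp
  thus "coeff (frob_poly (f * g)) n = coeff (frob_poly f * frob_poly g) n"
    by (simp add: coeff_mult power_mult_distrib)
qed

lemma frob_poly_linear [simp]: "frob_poly [:-x, 1:] = [:- (x ^ p), 1:]"
  using p_pos frob_minus[of x 1] by (intro poly_eqI) (auto simp: coeff_pCons split: nat.splits)

lemma frob_poly_1 [simp]: "frob_poly 1 = 1"
  using p_pos by (intro poly_eqI) (auto simp: power_0_left)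

lemma frob_poly_power: "frob_poly (f ^ n) = frob_poly f ^ n"
  by (induction n) (auto simp: frob_poly_mult)

lemma frob_poly_prod: "frob_poly (\<Prod>i\<in>A. f i) = (\<Prod>i\<in>A. frob_poly (f i))"
  by (induction A rule: infinite_finite_induct) (auto simp: frob_poly_mult)

lemma Pol_intros [simp, intro]:
  "0 \<in> Pol" "1 \<in> Pol" "c \<in> Fq 1 \<Longrightarrow> [:c:] \<in> Pol" "c \<in> Fq 1 \<Longrightarrow> [:c, 1:] \<in> Pol"
  "c \<in> Fq 1 \<Longrightarrow> monom c n \<in> Pol"
  "f \<in> Pol \<Longrightarrow> g \<in> Pol \<Longrightarrow> f + g \<in> Pol"
  "f \<in> Pol \<Longrightarrow> g \<in> Pol \<Longrightarrow> f - g \<in> Pol"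
  "c \<in> Fq 1 \<Longrightarrow> f \<in> Pol \<Longrightarrow> smult c f \<in> Pol"
  by (auto simp: Pol_def coeff_pCons split: nat.splits)

lemma Pol_mult [simp, intro]: "f \<in> Pol \<Longrightarrow> g \<in> Pol \<Longrightarrow> f * g \<in> Pol"
  by (simp add: Pol_iff frob_poly_mult)

lemma Pol_power [simp, intro]: "f \<in> Pol \<Longrightarrow> f ^ n \<in> Pol" by (induction n) auto

lemma Pol_prod [intro]: "(\<And>i. i \<in> A \<Longrightarrow> f i \<in> Pol) \<Longrightarrow> (\<Prod>i\<in>A. f i) \<in> Pol"
  by (induction A rule: infinite_finite_induct) auto

lemma Pol_cancel: assumes "f * g \<in> Pol" "f \<in> Pol" "f \<noteq> 0" shows "g \<in> Pol"
proof -
  have "f * frob_poly g = f * g" using assms by (simp add: Pol_iff frob_poly_mult)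
  thus ?thesis using assms(3) by (simp add: Pol_iff)
qed

lemma poly_frob: "f \<in> Pol \<Longrightarrow> poly f x ^ (p ^ n) = poly f (x ^ (p ^ n))"
proof -
  assume f: "f \<in> Pol"
  have c: "coeff f i ^ (p ^ n) = coeff f i" for i
    using f Fq_1_subset[of n] by (auto simp: Pol_def Fq_def)
  show ?thesis
    by (simp add: poly_altdef frob_sum power_mult_distrib c flip: power_mult) (simp add: mult.commute)
qed

lemma poly_in_Fq: "f \<in> Pol \<Longrightarrow> x \<in> Fq n \<Longrightarrow> poly f x \<in> Fq n"
  by (simp add: Fq_def poly_frob)

end

section \<open>Stepanov's method\<close>

context closed_char_p
begin

text \<open>The difference of the two sides is the \<open>p ^ n\<close>-th power of
  \<open>u - poly u x\<close>, which \<open>X - x\<close> divides.\<close>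

lemma cong_frob_power:
  fixes u :: "'a poly"
  shows "[u ^ (p ^ n) = [:poly u x ^ (p ^ n):]] (mod [:-x, 1:] ^ (p ^ n))"
proof -
  have "prime CHAR('a poly)" using prime_CHAR by simp
  from freshmans_dream'[OF this, of "p ^ n" n "u - [:poly u x:]" "[:poly u x:]"]
  have "u ^ (p ^ n) - [:poly u x:] ^ (p ^ n) = (u - [:poly u x:]) ^ (p ^ n)"
    using CHAR_eq by simp
  moreover have "[:-x, 1:] dvd u - [:poly u x:]" by (simp add: poly_eq_0_iff_dvd[symmetric])
  ultimately show ?thesis
    by (simp add: cong_iff_dvd_diff dvd_power_same poly_const_pow)
qed

text \<open>Reducing \<open>X ^ (b + P * l)\<close> to \<open>X ^ b * x ^ (P * l)\<close> modulo \<open>X ^ P - x ^ P\<close>, the coefficient of \<open>X ^ b\<close>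
  becomes a polynomial in \<open>x\<close>.\<close>

definition fold_coeffs :: "nat \<Rightarrow> nat \<Rightarrow> 'a poly \<Rightarrow> 'a poly" where
  "fold_coeffs P b q = (\<Sum>N | N \<le> degree q \<and> N mod P = b. monom (coeff q N) (N div P * P))"

lemma degree_fold_coeffs: "degree (fold_coeffs P b q) \<le> degree q"
  unfolding fold_coeffs_def
proof (rule degree_sum_le)
  fix N assume "N \<in> {N. N \<le> degree q \<and> N mod P = b}"
  thus "degree (monom (coeff q N) (N div P * P)) \<le> degree q"
    by (intro order.trans[OF degree_monom_le]) (auto intro: order.trans[OF div_times_less_eq_dividend])
qed auto

lemma fold_coeffs_Pol: "q \<in> Pol \<Longrightarrow> fold_coeffs P b q \<in> Pol"
  unfolding fold_coeffs_def Pol_def by (auto simp: coeff_sum)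

lemma fold_coeffs_cong:
  fixes q :: "'a poly"
  assumes P: "P = p ^ n"
  shows "[q = (\<Sum>b<P. smult (poly (fold_coeffs P b q) x) (monom 1 b))] (mod [:-x, 1:] ^ P)"
proof -
  have P0: "P > 0" using P p_pos by simp
  have "[(\<Sum>N\<le>degree q. monom (coeff q N) N) =
      (\<Sum>N\<le>degree q. smult (coeff q N * x ^ (N div P * P)) (monom 1 (N mod P)))] (mod [:-x, 1:] ^ P)"
  proof (rule cong_sum)
    fix N
    have "[monom (1::'a) (N div P) ^ P = [:(x ^ (N div P)) ^ P:]] (mod [:-x, 1:] ^ P)"
      using cong_frob_power[of "monom 1 (N div P)" n x] unfolding P by (simp only: poly_monom mult_1)
    hence "[monom (coeff q N) (N mod P) * monom (1::'a) (N div P) ^ P =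
       monom (coeff q N) (N mod P) * [:x ^ (N div P * P):]] (mod [:-x, 1:] ^ P)"
      unfolding power_mult by (rule cong_scalar_left)
    moreover have "monom (coeff q N) (N mod P) * monom (1::'a) (N div P) ^ P = monom (coeff q N) N"
      by (simp add: monom_power mult_monom)
    ultimately show "[monom (coeff q N) N = smult (coeff q N * x ^ (N div P * P)) (monom 1 (N mod P))]
       (mod [:-x, 1:] ^ P)"
      by (simp add: smult_monom mult.commute[of "coeff q N"])
  qed
  also have "(\<Sum>N\<le>degree q. monom (coeff q N) N) = q" by (rule poly_as_sum_of_monoms)
  also have "(\<Sum>N\<le>degree q. smult (coeff q N * x ^ (N div P * P)) (monom 1 (N mod P))) =
    (\<Sum>b<P. \<Sum>N | N \<in> {..degree q} \<and> N mod P = b. smult (coeff q N * x ^ (N div P * P)) (monom 1 (N mod P)))"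
    using P0 by (subst sum.group) auto
  also have "\<dots> = (\<Sum>b<P. smult (poly (fold_coeffs P b q) x) (monom 1 b))"
    by (intro sum.cong) (auto simp: fold_coeffs_def poly_sum poly_monom smult_sum intro!: sum.cong)
  finally show ?thesis .
qed

lemma smult_sum_right: "smult c (\<Sum>i\<in>A. f i) = (\<Sum>i\<in>A. smult c (f i))"
  by (induction A rule: infinite_finite_induct) (auto simp: smult_add_right)

lemma high_order_zeros_card:
  fixes R :: "'a poly"
  assumes "R \<noteq> 0" "\<And>x. x \<in> S \<Longrightarrow> [:-x, 1:] ^ P dvd R" "P > 0"
  shows "card S * P \<le> degree R"
proof -
  have ord: "P \<le> order x R" if "x \<in> S" for x
    using assms(2)[OF that] assms(1) by (simp add: order_divides)
  have sub: "S \<subseteq> {x. poly R x = 0}"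
  proof
    fix x assume "x \<in> S"
    hence "order x R \<noteq> 0" using ord[of x] assms(3) by linarith
    thus "x \<in> {x. poly R x = 0}" using assms(1) by (simp add: order_root)
  qed
  have "card S * P = (\<Sum>x\<in>S. P)" by simp
  also have "\<dots> \<le> (\<Sum>x\<in>S. order x R)" using ord by (intro sum_mono) auto
  also have "\<dots> \<le> (\<Sum>x | poly R x = 0. order x R)"
    using sub poly_roots_finite[OF assms(1)] by (intro sum_mono2) auto
  also have "\<dots> \<le> degree R" by (rule sum_order_le_degree[OF assms(1)])
  finally show ?thesis .
qed

text \<open>A mixed radix expansion whose two low digits together stay below \<open>Q\<close>. It
  shows that the building blocks of the auxiliary polynomial vanish at 0 to pairwise different
  orders.\<close>

lemma mixed_radix_inj:
  fixes e d :: nat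
  assumes "i < e" "i' < e" "j < d" "j' < d" "d * e < Q"
    and "i + e * j + Q * k = i' + e * j' + Q * k'"
  shows "i = i' \<and> j = j' \<and> k = k'"
proof -
  have lt: "i + e * j < Q" if "i < e" "j < d" for i j
  proof -
    have "i + e * j < e + e * j" using that by linarith
    also have "e + e * j = e * (j + 1)" by simp
    also have "\<dots> \<le> e * d" using that by (intro mult_le_mono) auto
    finally show ?thesis using assms(5) by (simp add: mult.commute)
  qed
  have "(i + e * j + Q * k) mod Q = (i' + e * j' + Q * k') mod Q" using assms(6) by simp
  hence 1: "i + e * j = i' + e * j'" using lt assms(1-4) by simp
  hence "k = k'" using assms(6) lt[OF assms(1,3)] by simp
  moreover from 1 have "(i + e * j) mod e = (i' + e * j') mod e" by simp
  hence "i = i'" using assms(1,2) by simp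
  ultimately show ?thesis using 1 assms(1) by simp
qed

text \<open>An auxiliary polynomial for Stepanov's method.  The coefficients \<open>\<alpha>\<close> range over the prime
  field, so that a solution of the linear system is obtained from the pigeonhole principle; the
  reduction modulo \<open>X ^ P - x ^ P = (X - x) ^ P\<close> replaces derivatives.\<close>

lemma stepanov_auxiliary:
  assumes H: "H \<in> Pol" "poly H 0 \<noteq> 0" and F: "F = [:0, 1:] * H"
    and mu: "\<mu> > 0" and c: "c \<in> Fq 1" "c \<noteq> 0" and P: "P = p ^ \<mu>"
    and Kk: "Kk = esum \<mu> + 4 * (degree F + 2)"
  shows "\<exists>R. R \<noteq> 0 \<and> degree R \<le> P * P * (degree F + Kk) \<and>
    (\<forall>x\<in>Fq (2 * \<mu>). poly F x ^ esum (2 * \<mu>) = c \<longrightarrow> [:-x, 1:] ^ P dvd R)"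
proof -
  define f e e' where "f = degree F" and "e = esum (2 * \<mu>)" and "e' = esum \<mu>"
  define w where "w = F ^ e'"
  have FPol: "F \<in> Pol" unfolding F using H by (intro Pol_mult Pol_intros(4)) auto
  have wPol: "w \<in> Pol" using FPol by (simp add: w_def)
  have e_eq: "e = e' * (1 + P)" by (simp add: e_def e'_def P esum_double)
  have e'P: "(p - 1) * e' = P - 1" unfolding e'_def P by (rule esum_mult)
  have eQ: "(p - 1) * e = P * P - 1" using esum_mult[of "2 * \<mu>"] by (simp add: e_def P mult_2 power_add)
  have P2: "P \<ge> 2" using mu p_gt_1 P
    by (metis Suc_1 Suc_leI less_le_trans one_less_power)
  have e0: "e > 0" "e' > 0" using esum_pos mu by (auto simp: e_def e'_def)
  have p2: "p \<ge> 2" using p_gt_1 by simp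
  \<comment> \<open>Since \<open>(p - 1) * e = P * P - 1\<close>, this index set provides
    \<open>(P * P - 1) * Kk\<close> free coefficients.\<close>
  define Idx where "Idx = {..<e} \<times> {..<p - 1} \<times> {..<Kk}"
  define T where "T = (\<lambda>(i, j, k). monom (1::'a) i * F ^ (e * j) * monom 1 (P * P * k))"
  \<comment> \<open>Put \<open>y = poly w x\<close>. Modulo \<open>(X - x) ^ P\<close> the factor
    \<open>F ^ (e * j)\<close> is \<open>w ^ j * y ^ (j * P)\<close>, and
    \<open>y ^ (j * P) = c ^ j / y ^ j\<close> because \<open>y ^ (1 + P) = c\<close>. Multiplying
    all terms by \<open>y ^ (p - 2)\<close> removes the denominators and leaves the power
    \<open>p - 2 - j\<close> of \<open>w\<close>.\<close>
  define W where "W = (\<lambda>b (i, j, k). smult (c ^ j) (fold_coeffs P b (monom 1 i * w ^ j) * w ^ (p - 2 - j) * monom (1::'a) k))"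
  define A where "A = e + f * P + Kk"

  have degW: "degree (W b t) < A" if "t \<in> Idx" for b t
  proof -
    obtain i j k where t: "t = (i, j, k)" by (cases t)
    have ijk: "i < e" "j < p - 1" "k < Kk" using that by (auto simp: Idx_def t)
    have "degree (W b t) \<le> degree (fold_coeffs P b (monom 1 i * w ^ j)) + degree (w ^ (p - 2 - j)) + degree (monom (1::'a) k)"
      unfolding W_def t by (auto intro!: order.trans[OF degree_smult_le] order.trans[OF degree_mult_le] add_mono)
    also have "\<dots> \<le> (i + degree w * j) + degree w * (p - 2 - j) + k"
      by (intro add_mono order.trans[OF degree_fold_coeffs] order.trans[OF degree_mult_le]
           degree_power_le degree_monom_le)
    also have "\<dots> = i + degree w * (p - 2) + k" using ijk by (simp add: distrib_left[symmetric])
    also have "degree w * (p - 2) \<le> f * e' * (p - 1)"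
      unfolding w_def f_def by (intro mult_mono order.trans[OF degree_power_le]) auto
    also have "f * e' * (p - 1) = f * (P - 1)" using e'P by (simp add: mult_ac)
    also have "f * (P - 1) \<le> f * P" by simp
    finally show ?thesis using ijk by (simp add: A_def)
  qed

  \<comment> \<open>\<open>P * A\<close> is the number of linear conditions: \<open>P\<close>
    residues \<open>b\<close> and \<open>A\<close> coefficients for each. In \<open>Kk\<close> the
    part \<open>esum \<mu>\<close> contributes \<open>(P - 1) * e\<close>, nearly the leading term
    \<open>P * e\<close> of the conditions; the part \<open>4 * (degree F + 2)\<close> pays for the
    rest.\<close>
  have size: "P * A < (P * P - 1) * Kk"
  proof -
    have Pe: "(P * P - 1) * e' = (P - 1) * e" 
      using e'P eQ e_eq by (metis (no_types, lifting) mult.assoc mult.commute)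
    have e_le: "e < P * P" "e' < P"
    proof -
      have "e \<le> (p - 1) * e" "e' \<le> (p - 1) * e'" using p2 by auto
      hence "e \<le> P * P - 1" "e' \<le> P - 1" unfolding eQ e'P .
      moreover have "P * P > 0" using P2 by simp
      ultimately show "e < P * P" "e' < P" using P2 by linarith+
    qed
    \<comment> \<open>Equality holds for \<open>P = 2\<close>, which uses the factor 4 in
      \<open>Kk\<close> in full.\<close>
    have h: "4 * (P * P - 1) \<ge> P * P + 4 * P"
    proof -
      obtain m where "P = m + 2" using P2 by (metis add.commute le_Suc_ex)
      thus ?thesis by (simp add: algebra_simps)
    qed
    have "P * A = P * e + f * (P * P) + P * e' + P * (4 * (f + 2))"
      by (simp add: A_def Kk f_def e'_def algebra_simps)
    also have "P * e + f * (P * P) + P * e' + P * (4 * (f + 2)) <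
       (P - 1) * e + (P * P) + f * (P * P) + P * P + P * (4 * (f + 2))"
    proof -
      have "P * e = (P - 1) * e + e" using P2 by (simp add: algebra_simps)
      moreover have "P * e' < P * P" using e_le P2 by simp
      ultimately show ?thesis using e_le by linarith
    qed
    also have "\<dots> = (P - 1) * e + (f + 2) * (P * P + 4 * P)" by (simp add: algebra_simps)
    also have "\<dots> \<le> (P - 1) * e + (f + 2) * (4 * (P * P - 1))" using h by (intro add_mono mult_le_mono) auto
    also have "\<dots> = (P * P - 1) * Kk"
    proof -
      have "Z * (a + 4 * g) = Z * a + g * (4 * Z)" for Z a g :: nat by (simp add: algebra_simps)
      thus ?thesis unfolding Kk using Pe by (simp only: f_def e'_def)
    qed
    finally show ?thesis .
  qed

  define \<Phi> where "\<Phi> = (\<lambda>\<alpha>. \<lambda>(b, a)\<in>{..<P} \<times> {..<A}. coeff (\<Sum>t\<in>Idx. smult (\<alpha> t) (W b t)) a)"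
  have WPol: "W b t \<in> Pol" for b t
    using c wPol by (cases t) (auto simp: W_def intro!: Pol_mult fold_coeffs_Pol Pol_intros(8))
  have finF: "finite (Fq (Suc 0))" and cardF: "card (Fq (Suc 0)) = p" using card_Fq[of 1] by auto
  have img: "\<Phi> ` (Idx \<rightarrow>\<^sub>E Fq 1) \<subseteq> ({..<P} \<times> {..<A} \<rightarrow>\<^sub>E Fq 1)"
  proof (intro image_subsetI PiE_I)
    fix \<alpha> ba assume \<alpha>: "\<alpha> \<in> Idx \<rightarrow>\<^sub>E Fq 1" and ba: "ba \<in> {..<P} \<times> {..<A}"
    show "\<Phi> \<alpha> ba \<in> Fq 1"
      using ba WPol \<alpha> unfolding \<Phi>_def
      by (auto simp: coeff_sum Pol_def PiE_iff intro!: Fq_sum)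
  qed (auto simp: \<Phi>_def)
  have "card (\<Phi> ` (Idx \<rightarrow>\<^sub>E Fq 1)) \<le> card ({..<P} \<times> {..<A} \<rightarrow>\<^sub>E Fq 1)"
    by (rule card_mono[OF _ img]) (auto intro!: finite_PiE finF)
  also have "\<dots> = p ^ (P * A)" by (subst card_PiE) (auto simp: cardF)
  also have "\<dots> < p ^ ((P * P - 1) * Kk)" using size p_gt_1 by (intro power_strict_increasing) auto
  also have "(P * P - 1) * Kk = card Idx" using eQ by (simp add: Idx_def mult_ac)
  also have "p ^ card Idx = card (Idx \<rightarrow>\<^sub>E Fq 1)" by (subst card_PiE) (auto simp: cardF Idx_def)
  finally have "\<not> inj_on \<Phi> (Idx \<rightarrow>\<^sub>E Fq 1)" by (rule pigeonhole)
  then obtain \<alpha> \<alpha>' where \<alpha>: "\<alpha> \<in> Idx \<rightarrow>\<^sub>E Fq 1" "\<alpha>' \<in> Idx \<rightarrow>\<^sub>E Fq 1" "\<alpha> \<noteq> \<alpha>'" "\<Phi> \<alpha> = \<Phi> \<alpha>'"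
    by (auto simp: inj_on_def)
  define \<beta> where "\<beta> t = \<alpha> t - \<alpha>' t" for t
  obtain t1 where t1: "t1 \<in> Idx" "\<beta> t1 \<noteq> 0"
    using \<alpha>(1-3) unfolding \<beta>_def by (metis PiE_ext right_minus_eq)
  \<comment> \<open>The coefficients vanish as polynomials in the point and not just at one point,
    so the same \<open>R\<close> works for all \<open>x\<close> simultaneously.\<close>
  have zero: "(\<Sum>t\<in>Idx. smult (\<beta> t) (W b t)) = 0" if b: "b < P" for b
  proof (rule poly_eqI)
    fix a
    show "coeff (\<Sum>t\<in>Idx. smult (\<beta> t) (W b t)) a = coeff 0 a"
    proof (cases "a < A")
      case True
      have "coeff (\<Sum>t\<in>Idx. smult (\<alpha> t) (W b t)) a = coeff (\<Sum>t\<in>Idx. smult (\<alpha>' t) (W b t)) a"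
        using fun_cong[OF \<alpha>(4), of "(b, a)"] b True by (simp add: \<Phi>_def)
      thus ?thesis by (simp add: \<beta>_def smult_diff_left sum_subtractf)
    next
      case False
      thus ?thesis using degW by (auto simp: coeff_sum intro!: sum.neutral coeff_eq_0)
         (meson coeff_eq_0 less_le_trans not_less)
    qed
  qed

  define R where "R = (\<Sum>t\<in>Idx. smult (\<beta> t) (T t))"
  define v where "v = (\<lambda>(i, j, k). i + e * j + P * P * k :: nat)"
  have T_v: "T t = monom 1 (v t) * H ^ (e * fst (snd t))" for t
  proof (cases t)
    case (fields i j k)
    have "F = monom 1 1 * H" by (simp add: F monom_altdef)
    hence "F ^ (e * j) = monom 1 (e * j) * H ^ (e * j)" by (simp add: power_mult_distrib monom_power)
    hence "T t = (monom 1 i * monom 1 (e * j) * monom 1 (P * P * k)) * H ^ (e * j)"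
      unfolding fields T_def prod.case by (simp only: mult_ac)
    thus ?thesis by (simp add: fields v_def mult_monom)
  qed
  have v_inj: "t = t'" if "t \<in> Idx" "t' \<in> Idx" "v t = v t'" for t t'
  proof -
    have "(p - 1) * e < P * P" using eQ P2 by simp
    moreover obtain i j k i' j' k' where "t = (i, j, k)" "t' = (i', j', k')"
      by (metis prod.exhaust)
    ultimately show ?thesis using that mixed_radix_inj[of i e i' j "p - 1" j' "P * P" k k']
      by (simp add: Idx_def v_def)
  qed
  \<comment> \<open>Because \<open>F\<close> has a simple zero at 0, \<open>T t\<close> vanishes
    there to order exactly \<open>v t\<close>. The orders are distinct, so the term of least order
    among those with nonzero coefficient is not cancelled.\<close>
  have "R \<noteq> 0"
  proof -
    define B where "B = {t \<in> Idx. \<beta> t \<noteq> 0}"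
    have finB: "finite B" and "B \<noteq> {}" using t1 by (auto simp: B_def Idx_def)
    then obtain t0 where t0: "t0 \<in> B" "\<And>t. t \<in> B \<Longrightarrow> v t0 \<le> v t"
      using arg_min_if_finite(1)[of B v] arg_min_least[of B _ v] by blast
    have "coeff R (v t0) = (\<Sum>t\<in>Idx. \<beta> t * coeff (T t) (v t0))" by (simp add: R_def coeff_sum)
    also have "\<dots> = (\<Sum>t\<in>Idx. if t = t0 then \<beta> t0 * poly H 0 ^ (e * fst (snd t0)) else 0)"
    proof (intro sum.cong refl)
      fix t assume t: "t \<in> Idx"
      show "\<beta> t * coeff (T t) (v t0) = (if t = t0 then \<beta> t0 * poly H 0 ^ (e * fst (snd t0)) else 0)"
      proof (cases "t = t0")
        case True
        have "coeff (T t0) (v t0) = coeff (H ^ (e * fst (snd t0))) 0"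
          unfolding T_v coeff_monom_mult by simp
        also have "\<dots> = poly H 0 ^ (e * fst (snd t0))" unfolding poly_0_coeff_0[symmetric] poly_power ..
        finally show ?thesis using True by simp
      next
        case False
        show ?thesis
        proof (cases "\<beta> t = 0")
          case nz: False
          hence "v t0 \<le> v t" "v t0 \<noteq> v t" using t0 t False v_inj[of t0 t] by (auto simp: B_def)
          hence "coeff (T t) (v t0) = 0" unfolding T_v coeff_monom_mult by simp
          thus ?thesis using False by simp
        qed (use False in auto)
      qed
    qed
    also have "\<dots> = \<beta> t0 * poly H 0 ^ (e * fst (snd t0))"
      using t0(1) by (simp add: B_def Idx_def)
    also have "\<dots> \<noteq> 0" using t0(1) H by (simp add: B_def)
    finally show ?thesis by auto
  qed
  moreover have "degree R \<le> P * P * (degree F + Kk)"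
    unfolding R_def
  proof (rule degree_sum_le)
    fix t assume tI: "t \<in> Idx"
    obtain i j k where t: "t = (i, j, k)" by (cases t)
    have ijk: "i < e" "j < p - 1" "k < Kk" using tI by (auto simp: Idx_def t)
    have "degree (smult (\<beta> t) (T t)) \<le> degree (monom (1::'a) i) + degree (F ^ (e * j)) + degree (monom (1::'a) (P * P * k))"
      unfolding T_def t by (auto intro!: order.trans[OF degree_smult_le] order.trans[OF degree_mult_le] add_mono)
    also have "\<dots> \<le> i + f * (e * j) + P * P * k"
      unfolding f_def by (intro add_mono degree_power_le degree_monom_le)
    also have "f * (e * j) \<le> f * (P * P)"
    proof (rule mult_le_mono2)
      have "e * j \<le> (p - 1) * e" using ijk by simp
      thus "e * j \<le> P * P" using eQ by linarith
    qed
    also have "i + f * (P * P) + P * P * k \<le> f * (P * P) + P * P * (k + 1)"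
    proof -
      have "e \<le> (p - 1) * e" using p2 by auto
      hence "i \<le> P * P" using ijk eQ by linarith
      thus ?thesis by simp
    qed
    also have "\<dots> \<le> f * (P * P) + P * P * Kk" using ijk by (intro add_mono mult_le_mono) auto
    finally show "degree (smult (\<beta> t) (T t)) \<le> P * P * (degree F + Kk)" by (simp add: f_def algebra_simps)
  qed (auto simp: Idx_def)
  moreover have "[:-x, 1:] ^ P dvd R" if x: "x \<in> Fq (2 * \<mu>)" "poly F x ^ esum (2 * \<mu>) = c" for x
  proof -
    define M where "M = [:-x, 1:] ^ P"
    define y where "y = poly w x"
    have xQ: "x ^ (P * P) = x" using x(1) by (simp add: Fq_def P mult_2 power_add)
    have yc: "y ^ (1 + P) = c"
      using x(2) unfolding y_def w_def poly_power power_mult[symmetric] e_eq[symmetric] e_def by simp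
    have y0: "y \<noteq> 0" using yc c by (auto simp: power_0_left)
    have T_cong: "[smult (y ^ (p - 2)) (T t) = (\<Sum>b<P. smult (poly (W b t) x) (monom 1 b))] (mod M)"
      if tI: "t \<in> Idx" for t
    proof -
      obtain i j k where t: "t = (i, j, k)" by (cases t)
      have ijk: "i < e" "j < p - 1" "k < Kk" using tI by (auto simp: Idx_def t)
      have 1: "[(w ^ j) ^ P = [:(y ^ j) ^ P:]] (mod M)"
        using cong_frob_power[of "w ^ j" \<mu> x] by (simp add: M_def P y_def)
      \<comment> \<open>Here \<open>x\<close> being in the field of \<open>P * P\<close> elements
        lowers the degree: \<open>X ^ (P * P * k)\<close> becomes the constant
        \<open>x ^ k\<close>.\<close>
      have "(x ^ (P * k)) ^ P = (x ^ (P * P)) ^ k" by (simp flip: power_mult add: mult_ac)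
      also have "\<dots> = x ^ k" by (simp add: xQ)
      finally have 2: "[monom 1 (P * P * k) = [:x ^ k:]] (mod M)"
        using cong_frob_power[of "monom 1 (P * k)" \<mu> x]
        by (simp add: M_def P[symmetric] poly_monom monom_power mult_ac)
      have "F ^ (e * j) = w ^ j * (w ^ j) ^ P"
      proof -
        have "e * j = e' * j + e' * j * P" by (simp add: e_eq algebra_simps)
        thus ?thesis by (simp only: w_def power_add power_mult)
      qed
      hence "T t = monom 1 i * (w ^ j * (w ^ j) ^ P) * monom 1 (P * P * k)" by (simp add: T_def t)
      also have "[monom 1 i * (w ^ j * (w ^ j) ^ P) * monom 1 (P * P * k) = monom 1 i * (w ^ j * [:(y ^ j) ^ P:]) * [:x ^ k:]] (mod M)"
        by (intro cong_mult cong_refl 1 2)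
      finally have "[[:y ^ (p - 2):] * T t = [:y ^ (p - 2):] * (monom 1 i * (w ^ j * [:(y ^ j) ^ P:]) * [:x ^ k:])] (mod M)"
        by (intro cong_scalar_left)
      also have "[:y ^ (p - 2):] * (monom 1 i * (w ^ j * [:(y ^ j) ^ P:]) * [:x ^ k:]) =
         smult (y ^ (p - 2) * (y ^ j) ^ P * x ^ k) (monom 1 i * w ^ j)"
        by (simp add: mult_ac)
      also have "y ^ (p - 2) * (y ^ j) ^ P = c ^ j * y ^ (p - 2 - j)"
      proof -
        have "y ^ (p - 2) = y ^ j * y ^ (p - 2 - j)" using ijk by (simp flip: power_add)
        moreover have "y ^ j * (y ^ j) ^ P = c ^ j" 
        proof -
          have "c ^ j = (y * y ^ P) ^ j" by (simp flip: yc)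
          also have "\<dots> = y ^ j * y ^ (P * j)" by (simp add: power_mult_distrib power_mult)
          finally show ?thesis by (simp only: power_mult mult.commute[of P])
        qed
        ultimately show ?thesis by (simp add: mult_ac)
      qed
      also have "[smult (c ^ j * y ^ (p - 2 - j) * x ^ k) (monom 1 i * w ^ j) =
         smult (c ^ j * y ^ (p - 2 - j) * x ^ k) (\<Sum>b<P. smult (poly (fold_coeffs P b (monom 1 i * w ^ j)) x) (monom 1 b))] (mod M)"
        using cong_scalar_left[OF fold_coeffs_cong[OF P, of "monom 1 i * w ^ j" x], of "[:c ^ j * y ^ (p - 2 - j) * x ^ k:]"]
        by (simp add: M_def)
      also have "smult (c ^ j * y ^ (p - 2 - j) * x ^ k) (\<Sum>b<P. smult (poly (fold_coeffs P b (monom 1 i * w ^ j)) x) (monom 1 b)) =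
         (\<Sum>b<P. smult (poly (W b t) x) (monom 1 b))"
        unfolding smult_sum_right by (intro sum.cong) (simp_all add: W_def t poly_monom y_def mult_ac)
      finally show ?thesis by simp
    qed
    have "smult (y ^ (p - 2)) R = (\<Sum>t\<in>Idx. smult (\<beta> t) (smult (y ^ (p - 2)) (T t)))"
      by (simp add: R_def smult_sum_right mult.commute)
    also have "[\<dots> = (\<Sum>t\<in>Idx. smult (\<beta> t) (\<Sum>b<P. smult (poly (W b t) x) (monom 1 b)))] (mod M)"
    proof (rule cong_sum)
      fix t assume "t \<in> Idx"
      from cong_scalar_left[OF T_cong[OF this], of "[:\<beta> t:]"]
      show "[smult (\<beta> t) (smult (y ^ (p - 2)) (T t)) = smult (\<beta> t) (\<Sum>b<P. smult (poly (W b t) x) (monom 1 b))] (mod M)"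
        by (simp add: mult.commute)
    qed
    also have "(\<Sum>t\<in>Idx. smult (\<beta> t) (\<Sum>b<P. smult (poly (W b t) x) (monom 1 b))) =
        (\<Sum>b<P. \<Sum>t\<in>Idx. smult (\<beta> t * poly (W b t) x) (monom 1 b))"
      unfolding smult_sum_right smult_smult by (rule sum.swap)
    also have "\<dots> = (\<Sum>b<P. smult (poly (\<Sum>t\<in>Idx. smult (\<beta> t) (W b t)) x) (monom 1 b))"
      by (intro sum.cong) (simp_all add: poly_sum smult_sum)
    also have "\<dots> = 0" using zero by simp
    finally have "M dvd smult (y ^ (p - 2)) R" by (simp add: cong_0_iff)
    thus ?thesis using y0 by (simp add: M_def dvd_smult_iff)
  qed
  ultimately show ?thesis by blast
qed

text \<open>Comparing the degree of the auxiliary polynomial with its zeros of order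
  \<open>P = p ^ \<mu>\<close> bounds their number by
  \<open>P * (esum \<mu> + 5 * degree F + 8)\<close>. Multiplication by \<open>p - 1\<close> turns
  \<open>esum \<mu>\<close> into \<open>P - 1\<close>, so that the main term becomes the full
  cardinality \<open>P * P\<close>.\<close>

lemma stepanov_bound:
  assumes H: "H \<in> Pol" "poly H 0 \<noteq> 0" and F: "F = [:0, 1:] * H"
    and mu: "\<mu> > 0" and c: "c \<in> Fq 1" "c \<noteq> 0"
  shows "(p - 1) * card {x \<in> Fq (2 * \<mu>). poly F x ^ esum (2 * \<mu>) = c}
    \<le> p ^ (2 * \<mu>) + p * (5 * degree F + 8) * p ^ \<mu>"
proof -
  define P where "P = p ^ \<mu>"
  define S where "S = {x \<in> Fq (2 * \<mu>). poly F x ^ esum (2 * \<mu>) = c}"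
  have P0: "P > 0" using p_pos by (simp add: P_def)
  obtain R where R: "R \<noteq> 0" "degree R \<le> P * P * (degree F + (esum \<mu> + 4 * (degree F + 2)))"
    "\<And>x. x \<in> S \<Longrightarrow> [:-x, 1:] ^ P dvd R"
    using stepanov_auxiliary[OF H F mu c P_def refl] unfolding S_def by blast
  have "card S * P \<le> P * P * (degree F + (esum \<mu> + 4 * (degree F + 2)))"
    using high_order_zeros_card[of R S P, OF R(1,3) P0] R(2) by linarith
  hence "card S \<le> P * (degree F + (esum \<mu> + 4 * (degree F + 2)))" using P0 by (simp add: mult.commute mult.left_commute)
  hence "(p - 1) * card S \<le> (p - 1) * (P * (degree F + (esum \<mu> + 4 * (degree F + 2))))"
    by (rule mult_le_mono2)
  also have "\<dots> = P * ((p - 1) * esum \<mu>) + (p - 1) * (5 * degree F + 8) * P" by (simp add: algebra_simps)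
  also have "(p - 1) * esum \<mu> = P - 1" unfolding P_def by (rule esum_mult)
  also have "P * (P - 1) + (p - 1) * (5 * degree F + 8) * P \<le> P * P + p * (5 * degree F + 8) * P"
    by (intro add_mono mult_le_mono) auto
  finally show ?thesis by (simp add: S_def P_def mult_2 power_add)
qed

end

section \<open>L-functions of multiplicative characters\<close>

context closed_char_p
begin

lemma sum_order_eq_degree:
  fixes G :: "'a poly"
  assumes "G \<noteq> 0" "finite V" "\<And>x. poly G x = 0 \<Longrightarrow> x \<in> V"
  shows "(\<Sum>x\<in>V. order x G) = degree G"
  using assms(1,3)
proof (induction "degree G" arbitrary: G)
  case 0
  have "order x G = 0" for x
    using 0 by (metis degree_eq_zeroE order_0I pCons_eq_0_iff poly_const_conv)
  thus ?case using 0 by simp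
next
  case (Suc n)
  obtain x where x: "poly G x = 0" using alg_closed_imp_poly_has_root[of G] Suc(2) by auto
  then obtain q where q: "G = [:-x, 1:] * q" by (metis dvdE poly_eq_0_iff_dvd)
  have q0: "q \<noteq> 0" using Suc(3) q by auto
  have deg: "degree G = Suc (degree q)" unfolding q using q0 by (subst degree_mult_eq) auto
  have IH: "(\<Sum>x\<in>V. order x q) = degree q"
    by (rule Suc(1)) (use deg Suc(2,4) q q0 in auto)
  have "order y G = (if y = x then 1 else 0) + order y q" for y
  proof -
    have "order y [:-x, 1:] = (if y = x then 1 else 0)"
      using order_power_n_n[of x 1] by (auto intro: order_0I)
    moreover have "[:-x, 1:] * q \<noteq> 0" using Suc(3) unfolding q .
    moreover from this have "order y ([:-x, 1:] * q) = order y [:-x, 1:] + order y q" by (rule order_mult)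
    ultimately show ?thesis unfolding q by simp
  qed
  hence "(\<Sum>y\<in>V. order y G) = (\<Sum>y\<in>V. if y = x then 1 else 0) + (\<Sum>y\<in>V. order y q)"
    by (simp add: sum.distrib)
  also have "(\<Sum>y\<in>V. if y = x then 1 else 0 :: nat) = 1" using x Suc(4) assms(2) by simp
  finally show ?case using IH deg by simp
qed

lemma prod_linear_power_dvd:
  fixes G :: "'a poly"
  assumes "finite S" "G \<noteq> 0" "\<And>x. x \<in> S \<Longrightarrow> [:-x, 1:] ^ k dvd G"
  shows "(\<Prod>x\<in>S. [:-x, 1:]) ^ k dvd G"
  using assms
proof (induction S rule: finite_induct)
  case (insert x S)
  then obtain q where q: "G = (\<Prod>x\<in>S. [:-x, 1:]) ^ k * q" by (auto elim: dvdE)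
  have nz: "q \<noteq> 0" "(\<Prod>x\<in>S. [:-x, 1:]) ^ k * q \<noteq> 0" using insert(4) q by auto
  have "poly ((\<Prod>x\<in>S. [:-x, 1:]) ^ k) x \<noteq> 0" using insert(1,2) by (auto simp: poly_prod)
  hence "order x ((\<Prod>x\<in>S. [:-x, 1:]) ^ k) = 0" by (rule order_0I)
  hence "order x G = order x q" unfolding q by (subst order_mult[OF nz(2)]) simp
  moreover have "[:-x, 1:] ^ k dvd G" using insert(5) by auto
  ultimately have "[:-x, 1:] ^ k dvd q" using insert(4) nz by (simp add: order_divides)
  thus ?case unfolding prod.insert[OF insert(1,2)] power_mult_distrib
    by (subst q, subst mult.commute) (intro mult_dvd_mono dvd_refl)
qed auto

section \<open>Conjugates, minimal polynomials and monic polynomials over the prime field\<close>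

definition fdeg :: "'a \<Rightarrow> nat" where "fdeg x = (LEAST d. d > 0 \<and> x \<in> Fq d)"
definition minpol :: "'a \<Rightarrow> 'a poly" where "minpol x = (\<Prod>l<fdeg x. [:- (x ^ (p ^ l)), 1:])"

lemma fdeg:
  assumes "x \<in> Fq n" "n > 0"
  shows "fdeg x > 0" "x \<in> Fq (fdeg x)"
  using LeastI[of "\<lambda>d. d > 0 \<and> x \<in> Fq d" n] assms unfolding fdeg_def by auto

lemma fdeg_least: "d > 0 \<Longrightarrow> x \<in> Fq d \<Longrightarrow> fdeg x \<le> d"
  unfolding fdeg_def by (rule Least_le) auto

text \<open>The exponents of the Frobenius iterates fixing \<open>x\<close> are closed under taking
  remainders modulo the least positive one.\<close>

lemma in_Fq_iff_fdeg:
  assumes "x \<in> Fq n" "n > 0"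
  shows "x \<in> Fq j \<longleftrightarrow> fdeg x dvd j"
proof
  assume "fdeg x dvd j"
  thus "x \<in> Fq j" using fdeg[OF assms] Fq_mono_dvd by auto
next
  assume j: "x \<in> Fq j"
  define q r where "q = j div fdeg x" and "r = j mod fdeg x"
  have "j = fdeg x * q + r" by (simp add: q_def r_def)
  hence "x ^ (p ^ j) = (x ^ (p ^ (fdeg x * q))) ^ (p ^ r)"
    by (simp add: power_add power_mult)
  hence "x ^ (p ^ r) = x" using Fq_iterate[OF fdeg(2)[OF assms], of q] j by (simp add: Fq_def)
  hence "x \<in> Fq r" by (simp add: Fq_def)
  moreover have "r < fdeg x" unfolding r_def using fdeg(1)[OF assms] by simp
  ultimately have "r = 0" using fdeg_least[of r x] by (cases "r = 0") auto
  thus "fdeg x dvd j" by (simp add: r_def dvd_eq_mod_eq_0)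
qed

lemma conj_inj:
  assumes "x \<in> Fq n" "n > 0"
  shows "inj_on (\<lambda>l. x ^ (p ^ l)) {..<fdeg x}"
proof -
  have *: False if "l < m" "m < fdeg x" "x ^ (p ^ l) = x ^ (p ^ m)" for l m
  proof -
    have "x ^ (p ^ m) = (x ^ (p ^ (m - l))) ^ (p ^ l)"
      using that(1) by (simp flip: power_mult power_add)
    hence "x ^ (p ^ (m - l)) = x" using that(3) by (metis frob_inj)
    hence "x \<in> Fq (m - l)" by (simp add: Fq_def)
    thus False using fdeg_least[of "m - l" x] that by auto
  qed
  show ?thesis 
  proof (rule inj_onI)
    fix l m assume lm: "l \<in> {..<fdeg x}" "m \<in> {..<fdeg x}" "x ^ (p ^ l) = x ^ (p ^ m)"
    show "l = m"
      using *[of l m] *[of m l] lm by (cases l m rule: linorder_cases) auto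
  qed
qed

lemma minpol_monic: "lead_coeff (minpol x) = 1" "degree (minpol x) = fdeg x"
proof -
  have "lead_coeff (\<Prod>l\<in>A. [:- (x ^ (p ^ l)), 1:]) = 1 \<and> degree (\<Prod>l\<in>A. [:- (x ^ (p ^ l)), 1:]) = card A"
    if "finite A" for A :: "nat set"
    using that
  proof (induction A rule: finite_induct)
    case (insert l A)
    let ?P = "\<Prod>l\<in>A. [:- (x ^ (p ^ l)), 1:]"
    have "?P \<noteq> 0" using insert by auto
    hence "degree ([:- (x ^ (p ^ l)), 1:] * ?P) = Suc (card A)"
      using insert by (subst degree_mult_eq) auto
    moreover have "lead_coeff ?P = 1" using insert by blast
    moreover have "lead_coeff [:- (x ^ (p ^ l)), 1:] = 1" by simp
    ultimately have "degree ([:- (x ^ (p ^ l)), 1:] * ?P) = Suc (card A) \<and>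
        lead_coeff ([:- (x ^ (p ^ l)), 1:] * ?P) = 1"
      unfolding lead_coeff_mult by (simp only: mult_1 simp_thms)
    thus ?case unfolding prod.insert[OF insert(1,2)] card_insert_disjoint[OF insert(1,2)] by blast
  qed auto
  from this[of "{..<fdeg x}"] show "lead_coeff (minpol x) = 1" "degree (minpol x) = fdeg x"
    by (auto simp: minpol_def)
qed

text \<open>Frobenius permutes the linear factors cyclically, the last conjugate returning to
  \<open>x\<close>.\<close>

lemma minpol_Pol:
  assumes "x \<in> Fq n" "n > 0"
  shows "minpol x \<in> Pol"
proof -
  define g where "g l = [:- (x ^ (p ^ l)), 1:]" for l
  obtain d where d: "fdeg x = Suc d" using fdeg(1)[OF assms] by (cases "fdeg x") auto
  have "x ^ (p ^ fdeg x) = x" using fdeg(2)[OF assms] by (simp add: Fq_def)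
  hence g: "g (Suc d) = g 0" by (simp add: g_def flip: d)
  have "frob_poly (minpol x) = (\<Prod>l<fdeg x. g (Suc l))"
    unfolding minpol_def frob_poly_prod g_def frob_poly_linear
    by (simp flip: power_mult add: mult.commute)
  also have "\<dots> = (\<Prod>l<d. g (Suc l)) * g 0" using g by (simp add: d)
  also have "\<dots> = (\<Prod>l<Suc d. g l)" by (subst prod.lessThan_Suc_shift) (simp add: mult.commute)
  also have "\<dots> = minpol x" by (simp add: minpol_def g_def d)
  finally show ?thesis by (simp add: Pol_iff)
qed

lemma frob_power_dvd:
  assumes "G \<in> Pol" "[:-x, 1:] ^ k dvd G"
  shows "[:- (x ^ (p ^ l)), 1:] ^ k dvd G"
proof (induction l)
  case (Suc l)
  then obtain q where "G = [:- (x ^ (p ^ l)), 1:] ^ k * q" by (auto elim: dvdE)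
  hence "frob_poly G = [:- ((x ^ (p ^ l)) ^ p), 1:] ^ k * frob_poly q"
    by (simp only: frob_poly_mult frob_poly_power frob_poly_linear)
  moreover have "(x ^ (p ^ l)) ^ p = x ^ (p ^ Suc l)" by (simp flip: power_mult add: mult.commute)
  moreover have "frob_poly G = G" using assms(1) by (simp add: Pol_iff)
  ultimately show ?case by (metis dvd_triv_left)
qed (use assms in auto)

text \<open>Frobenius fixes \<open>G\<close>, so conjugate roots have the same multiplicity, and the
  distinct linear factors are coprime. Thus multiplicities of roots are visible as divisibility
  inside the polynomial ring over the prime field.\<close>

lemma minpol_power_dvd_iff:
  assumes "x \<in> Fq n" "n > 0" "G \<in> Pol" "G \<noteq> 0"
  shows "minpol x ^ k dvd G \<longleftrightarrow> [:-x, 1:] ^ k dvd G"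
proof
  have "minpol x = [:- (x ^ (p ^ 0)), 1:] * (\<Prod>l\<in>{..<fdeg x} - {0}. [:- (x ^ (p ^ l)), 1:])"
    unfolding minpol_def using fdeg(1)[OF assms(1,2)] by (intro prod.remove) auto
  hence "[:-x, 1:] dvd minpol x" by (metis dvd_triv_left power_0 power_one_right)
  thus "[:-x, 1:] ^ k dvd G" if "minpol x ^ k dvd G"
    using that by (meson dvd_power_same dvd_trans)
next
  assume "[:-x, 1:] ^ k dvd G"
  hence "(\<Prod>y\<in>(\<lambda>l. x ^ (p ^ l)) ` {..<fdeg x}. [:-y, 1:]) ^ k dvd G"
    using assms(3,4) frob_power_dvd by (intro prod_linear_power_dvd) auto
  thus "minpol x ^ k dvd G"
    unfolding minpol_def by (subst (asm) prod.reindex[OF conj_inj[OF assms(1,2)]]) (simp add: o_def)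
qed

definition Mon :: "nat \<Rightarrow> 'a poly set" where
  "Mon n = {G \<in> Pol. degree G = n \<and> lead_coeff G = 1}"

lemma finite_Mon: "finite (Mon n)"
proof (rule finite_imageD)
  have "(\<lambda>G. restrict (coeff G) {..n}) ` Mon n \<subseteq> ({..n} \<rightarrow>\<^sub>E Fq 1)"
    by (intro image_subsetI PiE_I) (auto simp: Mon_def Pol_def)
  thus "finite ((\<lambda>G. restrict (coeff G) {..n}) ` Mon n)"
    using card_Fq[of 1] by (rule_tac finite_subset) (auto intro!: finite_PiE)
  show "inj_on (\<lambda>G. restrict (coeff G) {..n}) (Mon n)"
  proof (rule inj_onI, rule poly_eqI)
    fix G G' i assume G: "G \<in> Mon n" "G' \<in> Mon n" "restrict (coeff G) {..n} = restrict (coeff G') {..n}"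
    show "coeff G i = coeff G' i"
    proof (cases "i \<le> n")
      case True thus ?thesis using fun_cong[OF G(3), of i] by simp
    next
      case False thus ?thesis using G by (simp add: Mon_def coeff_eq_0)
    qed
  qed
qed

text \<open>All Frobenius iterates of \<open>x\<close> are roots of \<open>G\<close>, so two of them
  agree and \<open>x\<close> lies in a finite field. Its minimal polynomial then divides
  \<open>G\<close>, which bounds the degree of that field.\<close>

lemma root_in_Fq:
  assumes G: "G \<in> Mon n" and x: "poly G x = 0"
  shows "\<exists>j\<in>{1..n}. x \<in> Fq j"
proof -
  have G': "G \<in> Pol" "G \<noteq> 0" "degree G = n" using G by (auto simp: Mon_def)
  have rt: "poly G (x ^ (p ^ l)) = 0" for l using poly_frob[OF G'(1), of x l] x p_pos by (auto simp: power_0_left)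
  have "\<not> inj (\<lambda>l. x ^ (p ^ l))"
  proof
    assume "inj (\<lambda>l. x ^ (p ^ l))"
    hence "infinite (range (\<lambda>l. x ^ (p ^ l)))" by (rule range_inj_infinite)
    moreover have "range (\<lambda>l. x ^ (p ^ l)) \<subseteq> {y. poly G y = 0}" using rt by auto
    ultimately show False using poly_roots_finite[OF G'(2)] finite_subset by blast
  qed
  then obtain l m where lm: "l < m" "x ^ (p ^ l) = x ^ (p ^ m)"
    unfolding inj_def using nat_neq_iff by metis
  have "x ^ (p ^ m) = (x ^ (p ^ (m - l))) ^ (p ^ l)"
    using lm(1) by (simp flip: power_mult power_add)
  hence "x ^ (p ^ (m - l)) = x" using lm(2) by (metis frob_inj)
  hence xm: "x \<in> Fq (m - l)" "m - l > 0" using lm by (auto simp: Fq_def)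
  have "minpol x ^ 1 dvd G"
    by (subst minpol_power_dvd_iff[OF xm G'(1,2)]) (use x in \<open>simp add: poly_eq_0_iff_dvd\<close>)
  hence "fdeg x \<le> n"
    using dvd_imp_degree_le[of "minpol x" G] G' by (simp add: minpol_monic)
  thus ?thesis using fdeg[OF xm] by (intro bexI[of _ "fdeg x"]) auto
qed

text \<open>For \<open>d = fdeg x\<close> the norm of \<open>t - x\<close> from \<open>Fq d\<close>
  is the product over the conjugates of \<open>x\<close>. From an extension of relative degree
  \<open>k\<close> above \<open>Fq d\<close> the norm is the \<open>k\<close>-th power of
  this.\<close>

lemma norm_minpol:
  assumes "x \<in> Fq n" "n > 0" "t \<in> Fq 1"
  shows "(t - x) ^ esum (fdeg x * k) = poly (minpol x) t ^ k"
proof -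
  have t: "t ^ (p ^ l) = t" for l using assms(3) Fq_1_subset[of l] by (auto simp: Fq_def)
  have 1: "(t - x) ^ esum (fdeg x) = poly (minpol x) t"
    by (simp add: esum_def power_sum minpol_def poly_prod frob_diff t)
  have 2: "(t - x) ^ (p ^ (fdeg x * k)) = t - x" for k
    using Fq_iterate[OF fdeg(2)[OF assms(1,2)]] by (simp add: frob_diff t)
  have "esum (m + l) = esum m + p ^ m * esum l" for m l
    by (induction l) (auto simp: esum_def algebra_simps power_add)
  hence "(t - x) ^ esum (fdeg x * Suc k) = (t - x) ^ esum (fdeg x * k) * ((t - x) ^ (p ^ (fdeg x * k))) ^ esum (fdeg x)" for k
    by (simp only: mult_Suc_right add.commute[of "fdeg x"] power_add power_mult)
  hence step: "(t - x) ^ esum (fdeg x * Suc k) = (t - x) ^ esum (fdeg x * k) * poly (minpol x) t" for k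
    unfolding 2 1 .
  show ?thesis
  proof (induction k)
    case (Suc k)
    show ?case unfolding step Suc power_Suc by (rule mult.commute)
  qed (simp add: esum_def)
qed

end

locale prime_field_character = closed_char_p p K for p and K :: "'a::alg_closed_field itself" +
  fixes \<chi> :: "'a \<Rightarrow> complex"
  assumes chi_0 [simp]: "\<chi> 0 = 0"
    and chi_nonzero: "x \<in> Fq 1 \<Longrightarrow> x \<noteq> 0 \<Longrightarrow> \<chi> x \<noteq> 0"
    and chi_mult: "x \<in> Fq 1 \<Longrightarrow> y \<in> Fq 1 \<Longrightarrow> \<chi> (x * y) = \<chi> x * \<chi> y"
    and chi_nontrivial: "\<exists>b\<in>Fq 1. b \<noteq> 0 \<and> \<chi> b \<noteq> 1"
begin

lemma chi_1 [simp]: "\<chi> 1 = 1"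
  using chi_mult[of 1 1] chi_nonzero[of 1] by auto

lemma chi_power: "x \<in> Fq 1 \<Longrightarrow> \<chi> (x ^ k) = \<chi> x ^ k"
  by (induction k) (auto simp: chi_mult)

lemma chi_prod: "(\<And>i. i \<in> A \<Longrightarrow> f i \<in> Fq 1) \<Longrightarrow> \<chi> (\<Prod>i\<in>A. f i) = (\<Prod>i\<in>A. \<chi> (f i))"
  by (induction A rule: infinite_finite_induct) (auto simp: chi_mult Fq_prod)

lemma norm_chi: "x \<in> Fq 1 \<Longrightarrow> x \<noteq> 0 \<Longrightarrow> cmod (\<chi> x) = 1"
proof -
  assume x: "x \<in> Fq 1" "x \<noteq> 0"
  have "\<chi> x ^ (p - 1) = 1" using chi_power[OF x(1), of "p - 1"] Fq_1_power[OF x] by simp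
  thus ?thesis using power_eq_1_iff[of "\<chi> x" "p - 1"] p_gt_1 by auto
qed

lemma norm_chi_le: "x \<in> Fq 1 \<Longrightarrow> cmod (\<chi> x) \<le> 1"
  using norm_chi[of x] by (cases "x = 0") auto

lemma sum_chi: "(\<Sum>x\<in>Fq 1 - {0}. \<chi> x) = 0"
proof -
  obtain b where b: "b \<in> Fq 1" "b \<noteq> 0" "\<chi> b \<noteq> 1" using chi_nontrivial by blast
  have "(\<Sum>x\<in>Fq 1 - {0}. \<chi> x) = (\<Sum>x\<in>Fq 1 - {0}. \<chi> (b * x))"
    by (rule sum.reindex_bij_witness[of _ "\<lambda>x. b * x" "\<lambda>x. x / b"]) (use b in auto)
  also have "\<dots> = \<chi> b * (\<Sum>x\<in>Fq 1 - {0}. \<chi> x)"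
    unfolding sum_distrib_left using b by (intro sum.cong) (auto intro: chi_mult)
  finally show ?thesis using b(3) by simp
qed

end

text \<open>The exponent of the factor at \<open>a\<close> is one: this total ramification is what makes the auxiliary
  polynomial of Stepanov's method nonzero.\<close>

locale weil_sum = prime_field_character p K \<chi> for p and K :: "'a::alg_closed_field itself" and \<chi> +
  fixes a :: 'a and D :: "'a set" and ex :: "'a \<Rightarrow> nat"
  assumes a_Fq: "a \<in> Fq 1" and finite_D: "finite D" and D_Fq: "D \<subseteq> Fq 1" and a_D: "a \<notin> D"
begin

text \<open>The argument of the character sum after the substitution \<open>x = a - y\<close>, which
  moves the simple zero from \<open>a\<close> to 0, as \<open>stepanov_bound\<close>
  requires.\<close>

definition wpoly :: "'a poly" where "wpoly = [:0, 1:] * (\<Prod>t\<in>D. [:t - a, 1:] ^ ex t)"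

text \<open>On the field of \<open>p ^ n\<close> elements, \<open>\<lambda>y. y ^ esum n\<close> is the norm to the prime field.\<close>

definition charsum :: "nat \<Rightarrow> complex" where
  "charsum n = (\<Sum>x\<in>Fq n. \<chi> (((a - x) * (\<Prod>t\<in>D. (t - x) ^ ex t)) ^ esum n))"

text \<open>The coefficient function of the L-function. Evaluating the minimal polynomial of
  \<open>x\<close> at \<open>a\<close> and at the points of \<open>D\<close> gives the norm of
  \<open>(a - x) * (\<Prod>t\<in>D. (t - x) ^ ex t)\<close>; written in this way the function is
  completely multiplicative in \<open>G\<close>.\<close>

definition lam :: "'a poly \<Rightarrow> complex" where
  "lam G = \<chi> (poly G a * (\<Prod>t\<in>D. poly G t ^ ex t))"

text \<open>One-sided bounds for the numbers \<open>N c\<close> of points of norm \<open>c\<close>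
  suffice. As \<chi> sums to 0, each \<open>N c\<close> may be replaced by its distance
  \<open>\<delta> c\<close> from the upper bound. These distances are nonnegative, and since the
  \<open>N c\<close> add up to \<open>Q\<close>, the distances have the small total
  \<open>(p - 1) * (B * P + N 0)\<close>.\<close>

lemma charsum_bound: "\<exists>C. \<forall>\<mu>>0. cmod (charsum (2 * \<mu>)) \<le> C * real p ^ \<mu>"
proof -
  define H where "H = (\<Prod>t\<in>D. [:t - a, 1:] ^ ex t)"
  define f where "f = degree wpoly"
  define B where "B = p * (5 * f + 8)"
  have F_eq: "wpoly = [:0, 1:] * H" by (simp add: wpoly_def H_def)
  have HPol: "H \<in> Pol" unfolding H_def using D_Fq a_Fq
    by (intro Pol_prod Pol_power Pol_intros(4)) auto
  have H0: "poly H 0 \<noteq> 0" using a_D finite_D by (auto simp: H_def poly_prod)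
  have F0: "wpoly \<noteq> 0" using H0 by (auto simp: F_eq)
  have FPol: "wpoly \<in> Pol" unfolding F_eq using HPol by (intro Pol_mult Pol_intros(4)) auto
  have "cmod (charsum (2 * \<mu>)) \<le> (real B + real f) * real p ^ \<mu>" if mu: "\<mu> > 0" for \<mu>
  proof -
    define Q where "Q = p ^ (2 * \<mu>)"
    define P where "P = p ^ \<mu>"
    define e where "e = esum (2 * \<mu>)"
    define N where "N c = card {y \<in> Fq (2 * \<mu>). poly wpoly y ^ e = c}" for c
    have e0: "e > 0" unfolding e_def using mu by (intro esum_pos) auto
    have finQ: "finite (Fq (2 * \<mu>))" and cardQ: "card (Fq (2 * \<mu>)) = Q"
      using card_Fq[of "2 * \<mu>"] mu by (auto simp: Q_def)
    have fin1: "finite (Fq 1)" and card1: "card (Fq 1) = p" using card_Fq[of 1] by auto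
    have card1': "card (Fq 1 - {0}) = p - 1" using card1 fin1 by (subst card_Diff_singleton) auto
    have inF: "poly wpoly y ^ e \<in> Fq 1" if "y \<in> Fq (2 * \<mu>)" for y
      unfolding e_def using poly_in_Fq[OF FPol that] by (rule norm_in_Fq1)
    have "charsum (2 * \<mu>) = (\<Sum>y\<in>Fq (2 * \<mu>). \<chi> (poly wpoly y ^ e))"
      unfolding charsum_def e_def
    proof (rule sum.reindex_bij_witness[of _ "\<lambda>y. a - y" "\<lambda>x. a - x"])
      fix x assume "x \<in> Fq (2 * \<mu>)"
      thus "a - x \<in> Fq (2 * \<mu>)" using a_Fq Fq_1_subset[of "2 * \<mu>"] by blast
      show "\<chi> (poly wpoly (a - x) ^ esum (2 * \<mu>)) =
         \<chi> (((a - x) * (\<Prod>t\<in>D. (t - x) ^ ex t)) ^ esum (2 * \<mu>))"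
        by (simp add: wpoly_def poly_prod algebra_simps)
    next
      fix x assume "x \<in> Fq (2 * \<mu>)"
      thus "a - x \<in> Fq (2 * \<mu>)" using a_Fq Fq_1_subset[of "2 * \<mu>"] by blast
    qed auto
    also have "\<dots> = (\<Sum>c\<in>Fq 1. \<Sum>y\<in>{y \<in> Fq (2 * \<mu>). poly wpoly y ^ e = c}. \<chi> (poly wpoly y ^ e))"
      by (rule sum.group[symmetric]) (use finQ fin1 inF in auto)
    also have "\<dots> = (\<Sum>c\<in>Fq 1. of_nat (N c) * \<chi> c)"
      by (intro sum.cong) (auto simp: N_def)
    also have "\<dots> = (\<Sum>c\<in>Fq 1 - {0}. of_nat (N c) * \<chi> c)"
      using fin1 by (intro sum.mono_neutral_right) auto
    finally have S: "charsum (2 * \<mu>) = (\<Sum>c\<in>Fq 1 - {0}. of_nat (N c) * \<chi> c)" .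
    have Nle: "(p - 1) * N c \<le> Q + B * P" if "c \<in> Fq 1 - {0}" for c
      using stepanov_bound[OF HPol H0 F_eq mu, of c] that
      unfolding N_def Q_def B_def P_def e_def f_def by auto
    have Q_eq: "Q = (\<Sum>c\<in>Fq 1. N c)"
      unfolding cardQ[symmetric] card_eq_sum N_def
      by (rule sum.group[symmetric]) (use finQ fin1 inF in auto)
    have N0: "N 0 \<le> f"
    proof -
      have "N 0 \<le> card {y. poly wpoly y = 0}"
        unfolding N_def using poly_roots_finite[OF F0] e0 by (intro card_mono) auto
      also have "\<dots> \<le> f" unfolding f_def by (rule card_poly_roots_bound[OF F0])
      finally show ?thesis .
    qed
    have Q_eq': "Q = N 0 + (\<Sum>c\<in>Fq 1 - {0}. N c)"
      unfolding Q_eq using fin1 by (intro sum.remove) auto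
    define \<delta> where "\<delta> c = real Q + real B * real P - real (p - 1) * real (N c)" for c
    have \<delta>0: "\<delta> c \<ge> 0" if "c \<in> Fq 1 - {0}" for c
    proof -
      have "real ((p - 1) * N c) \<le> real (Q + B * P)" using Nle[OF that] by (rule of_nat_mono)
      thus ?thesis unfolding \<delta>_def of_nat_mult of_nat_add by linarith
    qed
    have "of_nat (p - 1) * charsum (2 * \<mu>) =
        (\<Sum>c\<in>Fq 1 - {0}. of_nat (p - 1) * of_nat (N c) * \<chi> c)"
      unfolding S sum_distrib_left by (simp add: mult.assoc)
    also have "\<dots> = (\<Sum>c\<in>Fq 1 - {0}. of_nat (p - 1) * of_nat (N c) * \<chi> c)
        - (of_nat Q + of_nat B * of_nat P) * (\<Sum>c\<in>Fq 1 - {0}. \<chi> c)"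
      by (simp only: sum_chi) simp
    also have "\<dots> = (\<Sum>c\<in>Fq 1 - {0}. - (of_real (\<delta> c) * \<chi> c))"
      unfolding sum_distrib_left sum_subtractf[symmetric]
      by (intro sum.cong refl) (simp add: \<delta>_def algebra_simps)
    finally have "real (p - 1) * cmod (charsum (2 * \<mu>)) = cmod (\<Sum>c\<in>Fq 1 - {0}. - (of_real (\<delta> c) * \<chi> c))"
      by (metis norm_mult norm_of_nat)
    also have "\<dots> \<le> (\<Sum>c\<in>Fq 1 - {0}. \<delta> c)"
      using \<delta>0 norm_chi by (intro sum_norm_le) (auto simp: norm_mult)
    also have "\<dots> = real (p - 1) * (real Q + real B * real P) - real (p - 1) * (\<Sum>c\<in>Fq 1 - {0}. real (N c))"
      unfolding \<delta>_def sum_subtractf sum_distrib_left[symmetric] by (simp only: sum_constant card1')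
    also have "(\<Sum>c\<in>Fq 1 - {0}. real (N c)) = real Q - real (N 0)"
      using Q_eq' by (simp flip: of_nat_sum)
    finally have "real (p - 1) * cmod (charsum (2 * \<mu>)) \<le> real (p - 1) * (real B * real P + real (N 0))"
      by (simp add: algebra_simps)
    hence "cmod (charsum (2 * \<mu>)) \<le> real B * real P + real (N 0)"
      using p_gt_1 by (subst (asm) mult_le_cancel_left_pos) auto
    also have "\<dots> \<le> real B * real P + real f * real P"
      using N0 p_pos by (intro add_mono order.refl order.trans[OF of_nat_mono[OF N0]])
        (simp add: P_def Suc_leI mult_le_cancel_left1)
    finally show ?thesis by (simp add: P_def algebra_simps)
  qed
  thus ?thesis by blast
qed

section \<open>Coefficients of the L-function\<close>

definition lcoef :: "nat \<Rightarrow> complex" where "lcoef n = (\<Sum>G\<in>Mon n. lam G)"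

lemma lam_arg_Fq: "G \<in> Pol \<Longrightarrow> poly G a * (\<Prod>t\<in>D. poly G t ^ ex t) \<in> Fq 1"
  using a_Fq D_Fq by (intro Fq_intros(5) Fq_prod Fq_intros(9) poly_in_Fq) auto

lemma lam_mult: "G \<in> Pol \<Longrightarrow> G' \<in> Pol \<Longrightarrow> lam (G * G') = lam G * lam G'"
  unfolding lam_def using chi_mult[OF lam_arg_Fq lam_arg_Fq, of G G']
  by (simp add: power_mult_distrib prod.distrib mult_ac)

lemma lam_1 [simp]: "lam 1 = 1" by (simp add: lam_def)

lemma lam_power: "G \<in> Pol \<Longrightarrow> lam (G ^ k) = lam G ^ k"
  by (induction k) (auto simp: lam_mult)

lemma lcoef_0: "lcoef 0 = 1"
proof -
  have "Mon 0 = {1}" by (auto simp: Mon_def elim!: degree_eq_zeroE)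
  thus ?thesis by (simp add: lcoef_def)
qed

text \<open>Let \<open>l\<close> be the Lagrange polynomial that is 1 at \<open>a\<close> and 0 on
  \<open>D\<close>; its degree is at most \<open>card D\<close>. Adding a suitable multiple of
  \<open>l\<close> permutes \<open>Mon n\<close>, multiplies the value at \<open>a\<close> by
  \<open>b\<close> and keeps the values on \<open>D\<close>. Hence the sum is multiplied by
  \<open>\<chi> b\<close>, which differs from 1.\<close>

lemma lcoef_eq_0: assumes "n > card D" shows "lcoef n = 0"
proof -
  obtain b where b: "b \<in> Fq 1" "b \<noteq> 0" "\<chi> b \<noteq> 1" using chi_nontrivial by blast
  define l where "l = (\<Prod>t\<in>D. smult (1 / (a - t)) [:-t, 1:])"
  have l1: "poly l a = 1"
    using a_D by (auto simp: l_def poly_prod divide_simps intro!: prod.neutral)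
  have l0: "poly l t = 0" if "t \<in> D" for t
    using that finite_D by (auto simp: l_def poly_prod)
  have lPol: "l \<in> Pol" unfolding l_def using D_Fq a_Fq
    by (intro Pol_prod Pol_intros(8) Pol_intros(4)) auto
  have ldeg: "degree l < n"
  proof -
    have "degree l \<le> (\<Sum>t\<in>D. degree (smult (1 / (a - t)) [:-t, 1:]))"
      unfolding l_def by (rule degree_prod_sum_le[OF finite_D, unfolded o_def])
    also have "\<dots> \<le> (\<Sum>t\<in>D. 1)" by (intro sum_mono order.trans[OF degree_smult_le]) auto
    finally show ?thesis using assms by simp
  qed
  define \<phi> where "\<phi> G = G + smult ((b - 1) * poly G a) l" for G
  have \<phi>a: "poly (\<phi> G) a = b * poly G a" for G by (simp add: \<phi>_def l1 algebra_simps)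
  have \<phi>t: "poly (\<phi> G) t = poly G t" if "t \<in> D" for G t using that by (simp add: \<phi>_def l0)
  have inj: "inj_on \<phi> (Mon n)"
  proof (rule inj_onI)
    fix G G' assume "\<phi> G = \<phi> G'"
    moreover from this have "b * poly G a = b * poly G' a" using \<phi>a by metis
    hence "poly G a = poly G' a" using b by simp
    ultimately show "G = G'" by (simp add: \<phi>_def)
  qed
  have sub: "\<phi> ` Mon n \<subseteq> Mon n"
  proof (rule image_subsetI)
    fix G assume G: "G \<in> Mon n"
    have "degree (smult ((b - 1) * poly G a) l) < degree G"
      using ldeg G by (intro le_less_trans[OF degree_smult_le]) (auto simp: Mon_def)
    hence deg: "degree (\<phi> G) = n"
      using G unfolding \<phi>_def Mon_def by (subst degree_add_eq_left) auto
    moreover have "coeff l n = 0" using ldeg by (rule coeff_eq_0)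
    hence "lead_coeff (\<phi> G) = 1" unfolding deg using G by (auto simp: \<phi>_def Mon_def)
    moreover have "\<phi> G \<in> Pol"
      using G lPol b a_Fq unfolding \<phi>_def Mon_def by (auto intro!: Pol_intros(6,8) Fq_intros(5) poly_in_Fq)
    ultimately show "\<phi> G \<in> Mon n" by (simp add: Mon_def)
  qed
  have "\<phi> ` Mon n = Mon n" by (rule endo_inj_surj[OF finite_Mon sub inj])
  hence "lcoef n = (\<Sum>G\<in>Mon n. lam (\<phi> G))"
    unfolding lcoef_def by (metis (no_types, lifting) inj sum.reindex_cong)
  also have "\<dots> = (\<Sum>G\<in>Mon n. \<chi> b * lam G)"
  proof (intro sum.cong refl)
    fix G assume "G \<in> Mon n"
    hence "G \<in> Pol" by (simp add: Mon_def)
    moreover have "lam (\<phi> G) = \<chi> (b * (poly G a * (\<Prod>t\<in>D. poly G t ^ ex t)))"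
      unfolding lam_def \<phi>a using \<phi>t by (simp add: mult.assoc cong: prod.cong)
    ultimately show "lam (\<phi> G) = \<chi> b * lam G"
      unfolding lam_def using chi_mult[OF b(1) lam_arg_Fq] by simp
  qed
  also have "\<dots> = \<chi> b * lcoef n" by (simp add: lcoef_def sum_distrib_left)
  finally show ?thesis using b(3) by simp
qed

lemma chi_norm_minpol:
  assumes "x \<in> Fq n" "n > 0"
  shows "\<chi> (((a - x) * (\<Prod>t\<in>D. (t - x) ^ ex t)) ^ esum (fdeg x * k)) = lam (minpol x) ^ k"
proof -
  have *: "(u * (\<Prod>t\<in>D. v t ^ ex t)) ^ N = u ^ N * (\<Prod>t\<in>D. (v t ^ N) ^ ex t)" for u :: 'a and v N
  proof -
    have "(v t ^ ex t) ^ N = (v t ^ N) ^ ex t" for t by (simp add: mult.commute flip: power_mult)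
    thus ?thesis by (simp add: power_mult_distrib prod_power_distrib)
  qed
  have "((a - x) * (\<Prod>t\<in>D. (t - x) ^ ex t)) ^ esum (fdeg x * k) =
    (a - x) ^ esum (fdeg x * k) * (\<Prod>t\<in>D. ((t - x) ^ esum (fdeg x * k)) ^ ex t)"
    by (rule *)
  also have "\<dots> = poly (minpol x) a ^ k * (\<Prod>t\<in>D. (poly (minpol x) t ^ k) ^ ex t)"
    using norm_minpol[OF assms] a_Fq D_Fq by (intro arg_cong2[of _ _ _ _ "(*)"] prod.cong) auto
  also have "\<dots> = (poly (minpol x) a * (\<Prod>t\<in>D. poly (minpol x) t ^ ex t)) ^ k"
    by (rule *[symmetric])
  finally show ?thesis
    unfolding lam_def using chi_power[OF lam_arg_Fq[OF minpol_Pol[OF assms]]] by simp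
qed

lemma sum_multiples:
  assumes "x \<in> Fq m" "m > 0"
  shows "(\<Sum>G | G \<in> Mon n \<and> minpol x ^ k dvd G. lam G) =
    (if fdeg x * k \<le> n then lam (minpol x) ^ k * lcoef (n - fdeg x * k) else 0)"
proof (cases "fdeg x * k \<le> n")
  case True
  have mP: "minpol x ^ k \<in> Pol" using minpol_Pol[OF assms] by auto
  have m0: "minpol x \<noteq> 0" using minpol_monic(1)[of x] by auto
  have deg: "degree (minpol x ^ k) = fdeg x * k" using m0 by (simp add: degree_power_eq minpol_monic mult.commute)
  have lc: "lead_coeff (minpol x ^ k) = 1" by (simp only: lead_coeff_power minpol_monic(1) power_one)
  have "{G. G \<in> Mon n \<and> minpol x ^ k dvd G} = (\<lambda>G. minpol x ^ k * G) ` Mon (n - fdeg x * k)"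
  proof (intro equalityI subsetI)
    fix G assume "G \<in> {G. G \<in> Mon n \<and> minpol x ^ k dvd G}"
    hence "minpol x ^ k dvd G" and G: "G \<in> Mon n" by auto
    then obtain q where q: "G = minpol x ^ k * q" by (elim dvdE)
    have "minpol x ^ k * q \<in> Pol" using G unfolding q Mon_def by blast
    hence "q \<in> Pol" using mP m0 by (auto dest: Pol_cancel)
    moreover have "G \<noteq> 0" using G by (auto simp: Mon_def)
    hence "q \<noteq> 0" using q by auto
    hence "degree G = fdeg x * k + degree q" unfolding q using m0 deg by (subst degree_mult_eq) auto
    moreover have "lead_coeff (minpol x ^ k * q) = 1" using G unfolding q Mon_def by blast
    hence "lead_coeff q = 1" unfolding lead_coeff_mult lc by simp
    ultimately have "q \<in> Mon (n - fdeg x * k)" using G by (auto simp: Mon_def)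
    thus "G \<in> (\<lambda>G. minpol x ^ k * G) ` Mon (n - fdeg x * k)" using q by blast
  next
    fix G assume "G \<in> (\<lambda>G. minpol x ^ k * G) ` Mon (n - fdeg x * k)"
    then obtain q where q: "G = minpol x ^ k * q" "q \<in> Mon (n - fdeg x * k)" by blast
    have "q \<noteq> 0" using q by (auto simp: Mon_def)
    hence "degree G = fdeg x * k + degree q" unfolding q(1) using m0 deg by (subst degree_mult_eq) auto
    hence "degree G = n" using q(2) True by (simp add: Mon_def)
    moreover have "lead_coeff q = 1" using q(2) unfolding Mon_def by blast
    hence "lead_coeff G = 1" unfolding q(1) lead_coeff_mult lc by (simp only: mult_1)
    ultimately show "G \<in> {G. G \<in> Mon n \<and> minpol x ^ k dvd G}" using q mP by (auto simp: Mon_def)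
  qed
  hence "(\<Sum>G | G \<in> Mon n \<and> minpol x ^ k dvd G. lam G) = (\<Sum>G\<in>Mon (n - fdeg x * k). lam (minpol x ^ k * G))"
    using m0 by (simp add: sum.reindex inj_on_def)
  also have "\<dots> = (\<Sum>G\<in>Mon (n - fdeg x * k). lam (minpol x) ^ k * lam G)"
    using mP minpol_Pol[OF assms] by (intro sum.cong) (auto simp: lam_mult lam_power Mon_def)
  finally show ?thesis using True by (simp add: lcoef_def sum_distrib_left)
next
  case False
  have "\<not> minpol x ^ k dvd G" if "G \<in> Mon n" for G
  proof
    assume "minpol x ^ k dvd G"
    moreover have "G \<noteq> 0" "degree G = n" using that by (auto simp: Mon_def)
    moreover have "minpol x \<noteq> 0" using minpol_monic(1)[of x] by auto
    hence "degree (minpol x ^ k) = fdeg x * k" by (simp add: degree_power_eq minpol_monic mult.commute)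
    ultimately show False using False dvd_imp_degree_le by metis
  qed
  hence *: "{G. G \<in> Mon n \<and> minpol x ^ k dvd G} = {}" by auto
  show ?thesis unfolding * using False by simp
qed

text \<open>The logarithmic derivative of the Euler product, obtained by counting pairs of a monic
  polynomial and one of its roots, with multiplicity.\<close>

lemma lcoef_recurrence: "of_nat n * lcoef n = (\<Sum>j=1..n. charsum j * lcoef (n - j))"
proof -
  define U where "U = (\<Union>j\<in>{1..n}. Fq j)"
  have finU: "finite U" unfolding U_def using card_Fq by auto
  have U: "\<exists>j>0. x \<in> Fq j" if "x \<in> U" for x using that by (auto simp: U_def Suc_le_eq)
  have "of_nat n * lcoef n = (\<Sum>G\<in>Mon n. of_nat n * lam G)" by (simp add: lcoef_def sum_distrib_left)
  also have "\<dots> = (\<Sum>G\<in>Mon n. \<Sum>x\<in>U. \<Sum>k=1..n. if minpol x ^ k dvd G then lam G else 0)"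
  proof (intro sum.cong refl)
    fix G assume G: "G \<in> Mon n"
    have G': "G \<in> Pol" "G \<noteq> 0" "degree G = n" using G by (auto simp: Mon_def)
    have rU: "poly G x = 0 \<Longrightarrow> x \<in> U" for x using root_in_Fq[OF G, of x] unfolding U_def by blast
    have "n = (\<Sum>x\<in>U. order x G)" using sum_order_eq_degree[OF G'(2) finU rU] G'(3) by simp
    also have "\<dots> = (\<Sum>x\<in>U. \<Sum>k=1..n. if minpol x ^ k dvd G then 1 else 0)"
    proof (intro sum.cong refl)
      fix x assume "x \<in> U"
      then obtain j where j: "j > 0" "x \<in> Fq j" using U by blast
      have "order x G \<le> n" using order_degree[OF G'(2), of x] G'(3) by simp
      hence "order x G = card {k\<in>{1..n}. k \<le> order x G}"
        by (subst arg_cong[of _ "{1..order x G}" card]) auto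
      also have "{k\<in>{1..n}. k \<le> order x G} = {k\<in>{1..n}. minpol x ^ k dvd G}"
        using minpol_power_dvd_iff[OF j(2,1) G'(1,2)] G'(2) by (simp add: order_divides)
      also have "card \<dots> = (\<Sum>k=1..n. if minpol x ^ k dvd G then 1 else 0)"
        by (simp add: sum.If_cases Int_def)
      finally show "order x G = (\<Sum>k=1..n. if minpol x ^ k dvd G then 1 else 0)" .
    qed
    finally have "(of_nat n :: complex) = of_nat (\<Sum>x\<in>U. \<Sum>k=1..n. if minpol x ^ k dvd G then 1 else 0)"
      by (rule arg_cong)
    also have "\<dots> = (\<Sum>x\<in>U. \<Sum>k=1..n. if minpol x ^ k dvd G then 1 else 0)"
      unfolding of_nat_sum by (intro sum.cong) auto
    finally show "of_nat n * lam G = (\<Sum>x\<in>U. \<Sum>k=1..n. if minpol x ^ k dvd G then lam G else 0)"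
      by (simp add: sum_distrib_right if_distrib[of "\<lambda>u. u * lam G"] cong: if_cong)
  qed
  also have "\<dots> = (\<Sum>x\<in>U. \<Sum>k=1..n. \<Sum>G\<in>Mon n. if minpol x ^ k dvd G then lam G else 0)"
    by (subst sum.swap, intro sum.cong refl, rule sum.swap)
  also have "\<dots> = (\<Sum>x\<in>U. \<Sum>k=1..n. if fdeg x * k \<le> n then lam (minpol x) ^ k * lcoef (n - fdeg x * k) else 0)"
  proof (intro sum.cong refl)
    fix x k assume "x \<in> U"
    then obtain j where j: "j > 0" "x \<in> Fq j" using U by blast
    show "(\<Sum>G\<in>Mon n. if minpol x ^ k dvd G then lam G else 0) =
       (if fdeg x * k \<le> n then lam (minpol x) ^ k * lcoef (n - fdeg x * k) else 0)"
      using sum_multiples[OF j(2,1), of n k] finite_Mon by (simp add: sum.If_cases Int_def)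
  qed
  \<comment> \<open>Substitution \<open>j = fdeg x * k\<close>: these \<open>j\<close> are exactly
    the degrees of the finite fields that contain \<open>x\<close>.\<close>
  also have "\<dots> = (\<Sum>x\<in>U. \<Sum>j=1..n. if x \<in> Fq j then \<chi> (((a - x) * (\<Prod>t\<in>D. (t - x) ^ ex t)) ^ esum j) * lcoef (n - j) else 0)"
  proof (rule sum.cong[OF refl])
    fix x assume "x \<in> U"
    then obtain j where j: "j > 0" "x \<in> Fq j" using U by blast
    have d0: "fdeg x > 0" using fdeg[OF j(2,1)] by simp
    let ?f = "\<lambda>j. \<chi> (((a - x) * (\<Prod>t\<in>D. (t - x) ^ ex t)) ^ esum j) * lcoef (n - j)"
    have "(\<Sum>j=1..n. if x \<in> Fq j then ?f j else 0) = (\<Sum>j | j \<in> {1..n} \<and> fdeg x dvd j. ?f j)"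
      using in_Fq_iff_fdeg[OF j(2,1)] by (simp add: sum.If_cases Int_def)
    also have "\<dots> = (\<Sum>k | k \<in> {1..n} \<and> fdeg x * k \<le> n. ?f (fdeg x * k))"
    proof (rule sum.reindex_bij_witness[of _ "\<lambda>k. fdeg x * k" "\<lambda>j. j div fdeg x"])
      fix j assume j: "j \<in> {j. j \<in> {1..n} \<and> fdeg x dvd j}"
      then obtain k where k: "j = fdeg x * k" by (auto elim: dvdE)
      have "k \<le> fdeg x * k" "k > 0" using d0 j k by auto
      moreover have "fdeg x * k \<le> n" using j k by auto
      with \<open>k \<le> fdeg x * k\<close> have "k \<le> n" by (rule order.trans)
      ultimately show "j div fdeg x \<in> {k. k \<in> {1..n} \<and> fdeg x * k \<le> n}" "fdeg x * (j div fdeg x) = j"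
        "?f (fdeg x * (j div fdeg x)) = ?f j"
        using j d0 unfolding k by auto
    next
      fix k assume k: "k \<in> {k. k \<in> {1..n} \<and> fdeg x * k \<le> n}"
      thus "fdeg x * k div fdeg x = k" "fdeg x * k \<in> {j. j \<in> {1..n} \<and> fdeg x dvd j}"
        using d0 by (auto simp: Suc_le_eq)
    qed
    also have "\<dots> = (\<Sum>k=1..n. if fdeg x * k \<le> n then lam (minpol x) ^ k * lcoef (n - fdeg x * k) else 0)"
      by (simp add: sum.If_cases Int_def chi_norm_minpol[OF j(2,1)])
    finally show "(\<Sum>k=1..n. if fdeg x * k \<le> n then lam (minpol x) ^ k * lcoef (n - fdeg x * k) else 0) =
      (\<Sum>j=1..n. if x \<in> Fq j then ?f j else 0)" ..
  qed
  also have "\<dots> = (\<Sum>j=1..n. \<Sum>x\<in>U. if x \<in> Fq j then \<chi> (((a - x) * (\<Prod>t\<in>D. (t - x) ^ ex t)) ^ esum j) * lcoef (n - j) else 0)"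
    by (rule sum.swap)
  also have "\<dots> = (\<Sum>j=1..n. charsum j * lcoef (n - j))"
  proof (intro sum.cong refl)
    fix j assume j: "j \<in> {1..n}"
    have "U \<inter> {x. x \<in> Fq j} = Fq j" using j by (auto simp: U_def)
    thus "(\<Sum>x\<in>U. if x \<in> Fq j then \<chi> (((a - x) * (\<Prod>t\<in>D. (t - x) ^ ex t)) ^ esum j) * lcoef (n - j) else 0) =
      charsum j * lcoef (n - j)"
      using finU by (simp add: sum.If_cases charsum_def sum_distrib_right)
  qed
  finally show ?thesis .
qed

end

section \<open>Weil's bound\<close>

text \<open>Divide by a \<open>w i1\<close> of largest modulus \<rho> and sum over the first
  \<open>N\<close> exponents. If \<open>\<rho> > R\<close>, the hypothesis gives a bound independent
  of \<open>N\<close> by a geometric series of ratio \<open>R / \<rho>\<close>. But quotients equal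
  to 1 contribute at least \<open>N\<close>, and the others, lying in the unit disc, have bounded
  geometric sums.\<close>

lemma power_sums_root_bound:
  fixes w :: "nat \<Rightarrow> complex"
  assumes bd: "\<And>n. n > 0 \<Longrightarrow> cmod (\<Sum>i<m. w i ^ n) \<le> C * R ^ n" and R: "R > 0" and k: "k < m"
  shows "cmod (w k) \<le> R"
proof (rule ccontr)
  assume "\<not> cmod (w k) \<le> R"
  define \<rho> where "\<rho> = Max ((\<lambda>i. cmod (w i)) ` {..<m})"
  have fin: "finite ((\<lambda>i. cmod (w i)) ` {..<m})" "(\<lambda>i. cmod (w i)) ` {..<m} \<noteq> {}" using k by auto
  have le: "cmod (w i) \<le> \<rho>" if "i < m" for i unfolding \<rho>_def using fin that by (intro Max_ge) auto
  obtain i1 where i1: "i1 < m" "cmod (w i1) = \<rho>" using Max_in[OF fin] unfolding \<rho>_def by auto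
  have \<rho>: "\<rho> > R" using le[OF k] \<open>\<not> cmod (w k) \<le> R\<close> by linarith
  have w0: "w i1 \<noteq> 0" using i1 \<rho> R by auto
  define z where "z i = w i / w i1" for i
  have z1: "cmod (z i) \<le> 1" if "i < m" for i
    using le[OF that] i1 \<rho> R by (simp add: z_def norm_divide divide_simps)
  define b where "b i = (if z i = 1 then 0 else 2 / cmod (1 - z i))" for i
  have geo: "cmod ((\<Sum>n<N. z i ^ Suc n) - (if z i = 1 then of_nat N else 0)) \<le> b i" if "i < m" for i N
  proof (cases "z i = 1")
    case False
    have "(\<Sum>n<N. z i ^ Suc n) = z i * ((1 - z i ^ N) / (1 - z i))"
      using False by (simp add: sum_distrib_left[symmetric] sum_gp_strict)
    hence "cmod (\<Sum>n<N. z i ^ Suc n) = cmod (z i) * (cmod (1 - z i ^ N) / cmod (1 - z i))"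
      by (simp only: norm_mult norm_divide)
    also have "\<dots> \<le> 1 * (2 / cmod (1 - z i))"
    proof (intro mult_mono divide_right_mono)
      have "cmod (1 - z i ^ N) \<le> 1 + cmod (z i) ^ N"
        using norm_triangle_ineq4[of 1 "z i ^ N"] by (simp add: norm_power)
      also have "cmod (z i) ^ N \<le> 1" using z1[OF that] by (intro power_le_one) auto
      finally show "cmod (1 - z i ^ N) \<le> 2" by simp
    qed (use z1[OF that] in auto)
    finally show ?thesis using False by (simp add: b_def)
  qed (auto simp: b_def)
  define r where "r = R / \<rho>"
  have r: "0 < r" "r < 1" using R \<rho> by (auto simp: r_def)
  have C0: "C \<ge> 0"
  proof -
    have "0 \<le> C * R ^ 1" using bd[of 1] by (meson norm_ge_zero order_trans zero_less_one)
    thus ?thesis using R by (simp add: zero_le_mult_iff)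
  qed
  have upper: "cmod (\<Sum>i<m. \<Sum>n<N. z i ^ Suc n) \<le> C / (1 - r)" for N
  proof -
    have "(\<Sum>i<m. \<Sum>n<N. z i ^ Suc n) = (\<Sum>n<N. (\<Sum>i<m. w i ^ Suc n) / w i1 ^ Suc n)"
      by (subst sum.swap) (simp only: z_def power_divide sum_divide_distrib)
    also have "cmod \<dots> \<le> (\<Sum>n<N. C * r ^ Suc n)"
    proof (rule sum_norm_le)
      fix n
      have "cmod ((\<Sum>i<m. w i ^ Suc n) / w i1 ^ Suc n) = cmod (\<Sum>i<m. w i ^ Suc n) / \<rho> ^ Suc n"
        by (simp only: norm_divide norm_power i1)
      also have "\<dots> \<le> C * R ^ Suc n / \<rho> ^ Suc n"
        using bd[of "Suc n"] R \<rho> by (intro divide_right_mono zero_le_power) auto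
      finally show "cmod ((\<Sum>i<m. w i ^ Suc n) / w i1 ^ Suc n) \<le> C * r ^ Suc n"
        by (simp only: r_def power_divide times_divide_eq_right)
    qed
    also have "\<dots> = C * r * (\<Sum>n<N. r ^ n)" by (simp add: sum_distrib_left mult_ac)
    also have "(\<Sum>n<N. r ^ n) = (1 - r ^ N) / (1 - r)" using r by (simp add: sum_gp_strict)
    also have "C * r * ((1 - r ^ N) / (1 - r)) \<le> C * (1 / (1 - r))"
    proof (intro mult_mono divide_right_mono divide_nonneg_nonneg)
      have "r ^ N \<le> 1" using r by (intro power_le_one) auto
      thus "0 \<le> 1 - r ^ N" by simp
    qed (use r C0 in \<open>auto simp: mult_left_le\<close>)
    finally show ?thesis by simp
  qed
  define B where "B = C / (1 - r) + (\<Sum>i<m. b i)"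
  have "real N \<le> B" for N
  proof -
    have "real N \<le> (\<Sum>i<m. if z i = 1 then real N else 0)"
    proof -
      have "(if z i1 = 1 then real N else 0) \<le> (\<Sum>i<m. if z i = 1 then real N else 0)"
        by (rule member_le_sum) (use i1 in auto)
      thus ?thesis using w0 by (simp add: z_def)
    qed
    also have "\<dots> = cmod (of_real (\<Sum>i<m. if z i = 1 then real N else 0))"
      by (simp only: norm_of_real) (simp add: sum_nonneg)
    also have "of_real (\<Sum>i<m. if z i = 1 then real N else 0) = 
       (\<Sum>i<m. \<Sum>n<N. z i ^ Suc n) - (\<Sum>i<m. (\<Sum>n<N. z i ^ Suc n) - (if z i = 1 then of_nat N else 0))"
    proof -
      have "of_real (\<Sum>i<m. if z i = 1 then real N else 0) = (\<Sum>i<m. if z i = 1 then of_nat N else (0::complex))"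
        unfolding of_real_sum by (intro sum.cong) auto
      thus ?thesis by (simp add: sum_subtractf)
    qed
    also have "cmod \<dots> \<le> C / (1 - r) + (\<Sum>i<m. b i)"
      by (rule order.trans[OF norm_triangle_ineq4], rule add_mono[OF upper sum_norm_le]) (rule geo, simp)
    finally show ?thesis by (simp add: B_def)
  qed
  thus False using reals_Archimedean2[of B] by (meson not_le)
qed

text \<open>The series \<open>G i\<close> is the expansion of
  \<open>w i * X / (1 - w i * X)\<close>, that is, of \<open>- X F' / F\<close> for the factor
  \<open>F i\<close>.\<close>

lemma fps_log_deriv_prod:
  fixes w :: "nat \<Rightarrow> complex"
  defines "G \<equiv> \<lambda>i. Abs_fps (\<lambda>n. if n = 0 then 0 else w i ^ n)"
  defines "F \<equiv> \<lambda>i. 1 - fps_const (w i) * fps_X"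
  shows "fps_X * fps_deriv (\<Prod>i<m. F i) = - (\<Sum>i<m. G i) * (\<Prod>i<m. F i)"
proof -
  have GF: "G i * F i = fps_const (w i) * fps_X" for i
  proof (rule fps_ext)
    fix n
    have "G i * F i = G i - fps_const (w i) * (fps_X * G i)" by (simp add: F_def algebra_simps)
    thus "fps_nth (G i * F i) n = fps_nth (fps_const (w i) * fps_X) n"
      by (cases n) (auto simp: G_def fps_X_nth)
  qed
  show ?thesis
  proof (induction m)
    case (Suc m)
    let ?P = "\<Prod>i<m. F i"
    have "fps_X * fps_deriv (\<Prod>i<Suc m. F i) = (fps_X * fps_deriv ?P) * F m + ?P * (fps_X * fps_deriv (F m))"
      by (simp add: algebra_simps)
    also have "fps_deriv (F m) = - fps_const (w m)" by (simp add: F_def)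
    also have "fps_X * - fps_const (w m) = - (G m * F m)" unfolding GF by (simp add: mult.commute)
    also have "fps_X * fps_deriv ?P = - (\<Sum>i<m. G i) * ?P" by (rule Suc)
    finally show ?case by (simp add: algebra_simps)
  qed simp
qed

text \<open>Roots equal to 0 become factors 1 after reflection. So the number of factors can be
  prescribed even if the reflected polynomial has smaller degree.\<close>

lemma reflect_linear_factorization:
  fixes q :: "complex poly"
  assumes "lead_coeff q = 1"
  shows "\<exists>w. reflect_poly q = (\<Prod>i<degree q. [:1, - w i:])"
proof -
  have "q \<noteq> 0" using assms by auto
  from alg_closed_imp_factorization[OF this]
  obtain A where A: "size A = degree q" "q = (\<Prod>x\<in>#A. [:-x, 1:])" using assms by auto
  obtain xs where xs: "mset xs = A" using ex_mset by blast
  have "reflect_poly (\<Prod>x\<leftarrow>ys. [:-x, 1:]) = (\<Prod>i<length ys. [:1, - (ys ! i) :: complex:])" for ys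
  proof (induction ys)
    case (Cons y ys)
    have "reflect_poly [:-y, 1:] = [:1, -y:]" 
      by (intro poly_eqI) (auto simp: coeff_reflect_poly coeff_pCons split: nat.splits)
    moreover have "(\<Prod>i<Suc (length ys). [:1, - ((y # ys) ! i):]) = [:1, -y:] * (\<Prod>i<length ys. [:1, - (ys ! i):])"
      by (subst prod.lessThan_Suc_shift) (simp del: mult_pCons_left)
    ultimately show ?case using Cons by (simp only: list.map prod_list.Cons list.size add_Suc_right add_0_right reflect_poly_mult)
  qed simp
  moreover have "q = (\<Prod>x\<leftarrow>xs. [:-x, 1:])" unfolding A(2) xs[symmetric] by (metis mset_map prod_mset_prod_list)
  moreover have "length xs = degree q" using A(1) xs by auto
  ultimately show ?thesis by metis
qed

context weil_sum
begin

lemma charsum_power_sums: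
  "\<exists>w. \<forall>n>0. charsum n = - (\<Sum>i<card D. w i ^ n)"
proof -
  define m where "m = card D"
  \<comment> \<open>The L-polynomial reversed and padded to degree \<open>card D\<close>; it is
    monic because \<open>lcoef 0 = 1\<close>.\<close>
  define q where "q = (\<Sum>i\<le>m. monom (lcoef i) (m - i))"
  have coeff_q: "coeff q j = (if j \<le> m then lcoef (m - j) else 0)" for j
  proof -
    have "coeff q j = (\<Sum>i\<le>m. if i = m - j \<and> j \<le> m then lcoef i else 0)"
      unfolding q_def coeff_sum coeff_monom by (intro sum.cong) auto
    also have "\<dots> = (if j \<le> m then lcoef (m - j) else 0)" by (cases "j \<le> m") (auto simp: sum.delta)
    finally show ?thesis .
  qed
  have deg: "degree q = m"
    by (intro antisym degree_le le_degree) (auto simp: coeff_q lcoef_0)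
  have "lead_coeff q = 1" by (simp add: deg coeff_q lcoef_0)
  then obtain w where w: "reflect_poly q = (\<Prod>i<m. [:1, - w i:])"
    using reflect_linear_factorization deg by metis
  define L where "L = Abs_fps lcoef"
  have "L = fps_of_poly (reflect_poly q)"
    by (rule fps_ext) (auto simp: L_def coeff_reflect_poly deg coeff_q m_def lcoef_eq_0)
  also have "\<dots> = (\<Prod>i<m. 1 - fps_const (w i) * fps_X)"
    unfolding w fps_of_poly_prod by (intro prod.cong) (auto simp: fps_of_poly_pCons fps_of_poly_linear)
  finally have L: "L = (\<Prod>i<m. 1 - fps_const (w i) * fps_X)" .
  define S where "S = Abs_fps (\<lambda>n. if n = 0 then 0 else charsum n)"
  define T where "T = - (\<Sum>i<m. Abs_fps (\<lambda>n. if n = 0 then 0 else w i ^ n))"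
  have "fps_X * fps_deriv L = S * L"
  proof (rule fps_ext)
    fix n
    have "fps_nth (S * L) n = (\<Sum>j=0..n. if j = 0 then 0 else charsum j * lcoef (n - j))"
      by (auto simp: fps_mult_nth S_def L_def intro!: sum.cong)
    also have "\<dots> = (\<Sum>j=1..n. charsum j * lcoef (n - j))"
      by (rule sum.mono_neutral_cong_right) auto
    also have "\<dots> = fps_nth (fps_X * fps_deriv L) n"
      by (subst lcoef_recurrence[symmetric]) (cases n; simp add: L_def)
    finally show "fps_nth (fps_X * fps_deriv L) n = fps_nth (S * L) n" ..
  qed
  moreover have "fps_X * fps_deriv L = T * L"
    unfolding L T_def by (rule fps_log_deriv_prod)
  moreover have "L \<noteq> 0" by (metis L_def fps_nth_Abs_fps fps_zero_nth lcoef_0 zero_neq_one)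
  \<comment> \<open>Both \<open>S\<close> and \<open>T\<close> are \<open>X\<close> times the
    logarithmic derivative of \<open>L\<close>: the first by the recurrence, the second by the
    factorisation.\<close>
  ultimately have ST: "S = T" by simp
  have "charsum n = - (\<Sum>i<m. w i ^ n)" if "n > 0" for n
  proof -
    have "charsum n = fps_nth S n" using that by (simp add: S_def)
    also have "\<dots> = - (\<Sum>i<m. w i ^ n)" unfolding ST T_def using that by (simp add: fps_sum_nth)
    finally show ?thesis .
  qed
  thus ?thesis unfolding m_def by blast
qed

theorem weil_bound:
  assumes "n > 0"
  shows "cmod (charsum n) \<le> real (card D) * sqrt (real p) ^ n"
proof -
  obtain w where w: "\<And>n. n > 0 \<Longrightarrow> charsum n = - (\<Sum>i<card D. w i ^ n)"
    using charsum_power_sums by blast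
  obtain C where C: "\<And>\<mu>. \<mu> > 0 \<Longrightarrow> cmod (charsum (2 * \<mu>)) \<le> C * real p ^ \<mu>"
    using charsum_bound by blast
  have le: "cmod (w k) \<le> sqrt (real p)" if k: "k < card D" for k
  proof -
    \<comment> \<open>Stepanov's method controls only extensions of even degree, so the criterion is
      applied to the squares of the inverse roots, with \<open>p\<close> in place of its square
      root.\<close>
    have "cmod (w k ^ 2) \<le> real p"
    proof (rule power_sums_root_bound[where m = "card D" and w = "\<lambda>i. w i ^ 2" and C = C])
      fix n :: nat assume n: "n > 0"
      show "cmod (\<Sum>i<card D. (w i ^ 2) ^ n) \<le> C * real p ^ n"
        using C[OF n] w[of "2 * n"] n by (simp add: power_mult)
    qed (use p_pos k in auto)
    thus ?thesis by (simp add: norm_power real_le_rsqrt)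
  qed
  have "cmod (charsum n) \<le> (\<Sum>i<card D. sqrt (real p) ^ n)"
    unfolding w[OF assms] norm_minus_cancel
    using le by (intro sum_norm_le) (auto simp: norm_power intro: power_mono)
  thus ?thesis by simp
qed

end

section \<open>Moments of character sums over cubic algebras\<close>

definition occ :: "nat \<Rightarrow> (nat \<Rightarrow> 'b) \<Rightarrow> (nat \<Rightarrow> 'b) \<Rightarrow> 'b \<Rightarrow> nat" where
  "occ k f g v = card {i\<in>{..<k}. f i = v} + card {i\<in>{..<k}. g i = v}"

text \<open>If every value that occurs does so at least twice among the \<open>2 * k\<close>
  entries, there are at most \<open>k\<close> values. List them by some \<open>h\<close>, with
  \<open>T ^ k\<close> choices; then \<open>f\<close> and \<open>g\<close> map into the range of
  \<open>h\<close>, with \<open>k ^ k\<close> choices each.\<close>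

lemma card_repeated_pairs:
  fixes T k :: nat
  assumes k: "k > 0"
  defines "PT \<equiv> {..<k} \<rightarrow>\<^sub>E {1..T}"
  shows "card {(f, g) \<in> PT \<times> PT. \<forall>v. occ k f g v \<noteq> 1}
    \<le> T ^ k * (k ^ k * k ^ k)"
proof -
  define Q where "Q h = ({..<k} \<rightarrow>\<^sub>E h ` {..<k}) \<times> ({..<k} \<rightarrow>\<^sub>E h ` {..<k})" for h :: "nat \<Rightarrow> nat"
  have finPT: "finite PT" unfolding PT_def by (intro finite_PiE) auto
  have "{(f, g) \<in> PT \<times> PT. \<forall>v. occ k f g v \<noteq> 1} \<subseteq> (\<Union>h\<in>PT. Q h)"
  proof clarify
    fix f g assume fg: "f \<in> PT" "g \<in> PT" and
      n1: "\<forall>v. occ k f g v \<noteq> 1"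
    define V where "V = f ` {..<k} \<union> g ` {..<k}"
    have finV: "finite V" by (simp add: V_def)
    have V0: "V \<noteq> {}" using k by (auto simp: V_def)
    have VT: "V \<subseteq> {1..T}" using fg unfolding V_def PT_def by (auto simp: PiE_iff)
    have two: "2 \<le> occ k f g v" if "v \<in> V" for v
    proof -
      have "{i\<in>{..<k}. f i = v} \<noteq> {} \<or> {i\<in>{..<k}. g i = v} \<noteq> {}" using that by (auto simp: V_def)
      hence "occ k f g v \<noteq> 0" by (auto simp: occ_def)
      thus ?thesis using n1[rule_format, of v] by linarith
    qed
    have count: "(\<Sum>v\<in>V. card {i\<in>{..<k}. u i = v}) = k" if "u ` {..<k} \<subseteq> V" for u
    proof -
      have "(\<Sum>v\<in>V. card {i\<in>{..<k}. u i = v}) = (\<Sum>v\<in>V. \<Sum>i\<in>{i\<in>{..<k}. u i = v}. 1)" by simp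
      also have "\<dots> = (\<Sum>i<k. 1)" by (rule sum.group) (use finV that in auto)
      finally show ?thesis by simp
    qed
    have "2 * card V = (\<Sum>v\<in>V. 2)" by simp
    also have "\<dots> \<le> (\<Sum>v\<in>V. occ k f g v)"
      by (intro sum_mono two)
    also have "\<dots> = k + k" unfolding occ_def sum.distrib by (subst count; (subst count)?) (auto simp: V_def)
    finally have cV: "card V \<le> k" by simp
    obtain b where b: "bij_betw b {..<card V} V"
      using ex_bij_betw_nat_finite[OF finV] by (auto simp: atLeast0LessThan)
    \<comment> \<open>The value \<open>b 0\<close> is repeated when there are fewer than
      \<open>k\<close> values, so that \<open>h\<close> is a full \<open>k\<close>-tuple.\<close>
    define h where "h = (\<lambda>i\<in>{..<k}. if i < card V then b i else b 0)"
    have c0: "card V > 0" using V0 finV by (simp add: card_gt_0_iff)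
    have "h ` {..<k} = V"
    proof (intro equalityI subsetI)
      fix v assume "v \<in> h ` {..<k}"
      thus "v \<in> V" using b c0 unfolding h_def bij_betw_def by (auto split: if_splits)
    next
      fix v assume "v \<in> V"
      then obtain i where "i < card V" "v = b i" using b unfolding bij_betw_def by auto
      thus "v \<in> h ` {..<k}" using cV by (intro image_eqI[of _ _ i]) (auto simp: h_def)
    qed
    moreover from this have "h \<in> PT" using VT unfolding PT_def
      by (intro PiE_I) (blast, simp add: h_def)
    moreover have "f \<in> {..<k} \<rightarrow>\<^sub>E V" "g \<in> {..<k} \<rightarrow>\<^sub>E V" using fg by (auto simp: PT_def V_def PiE_iff)
    ultimately have "(f, g) \<in> Q h" "h \<in> PT" by (auto simp: Q_def)
    thus "(f, g) \<in> (\<Union>h\<in>PT. Q h)" by blast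
  qed
  hence "card {(f, g) \<in> PT \<times> PT. \<forall>v. occ k f g v \<noteq> 1} \<le> card (\<Union>h\<in>PT. Q h)"
    by (rule card_mono[rotated]) (auto simp: finPT Q_def intro!: finite_PiE)
  also have "\<dots> \<le> (\<Sum>h\<in>PT. card (Q h))" by (rule card_UN_le[OF finPT])
  also have "\<dots> \<le> (\<Sum>h\<in>PT. k ^ k * k ^ k)"
  proof (intro sum_mono)
    fix h :: "nat \<Rightarrow> nat"
    have "card (h ` {..<k}) \<le> k" using card_image_le[of "{..<k}" h] by simp
    thus "card (Q h) \<le> k ^ k * k ^ k"
      unfolding Q_def card_cartesian_product by (simp add: card_PiE mult_mono power_mono)
  qed
  also have "\<dots> = T ^ k * (k ^ k * k ^ k)" by (simp add: PT_def card_PiE)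
  finally show ?thesis .
qed

context closed_char_p
begin

lemma esum_small: "esum 1 = 1" "esum 2 = 1 + p" "esum 3 = 1 + p + p * p"
  by (simp_all add: esum_def eval_nat_numeral)

text \<open>Let \<open>\<theta>\<^sub>1, \<theta>\<^sub>2, \<theta>\<^sub>3\<close> be the roots of a separable cubic \<open>f\<close> over the prime field.  Evaluation at the
  roots identifies the algebra \<open>F\<^sub>p[X]/(f)\<close> with one of the following sets of triples, according to the
  action of Frobenius on the roots.\<close>

definition tri_split :: "('a \<times> 'a \<times> 'a) set" where "tri_split = Fq 1 \<times> Fq 1 \<times> Fq 1"
definition tri_mixed :: "('a \<times> 'a \<times> 'a) set" where
  "tri_mixed = (\<lambda>(v, u). (v, v ^ p, u)) ` (Fq 2 \<times> Fq 1)"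
definition tri_cubic :: "('a \<times> 'a \<times> 'a) set" where
  "tri_cubic = (\<lambda>v. (v, v ^ p, (v ^ p) ^ p)) ` Fq 3"

definition tri_types :: "('a \<times> 'a \<times> 'a) set set" where "tri_types = {tri_split, tri_mixed, tri_cubic}"

lemma tri_inj:
  fixes U :: "('a \<times> 'a) set" and V :: "'a set"
  shows "inj_on (\<lambda>(v, u). (v, v ^ p, u)) U" "inj_on (\<lambda>v. (v, v ^ p, (v ^ p) ^ p)) V"
  by (auto simp: inj_on_def)

lemma tri_card:
  "finite tri_split" "card tri_split = p ^ 3"
  "finite tri_mixed" "card tri_mixed = p ^ 3"
  "finite tri_cubic" "card tri_cubic = p ^ 3"
  unfolding tri_split_def tri_mixed_def tri_cubic_def card_image[OF tri_inj(1)] card_image[OF tri_inj(2)]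
  using card_Fq[of 1] card_Fq[of 2] card_Fq[of 3]
  by (auto simp: card_cartesian_product eval_nat_numeral)

lemma tri_types_card: "A \<in> tri_types \<Longrightarrow> finite A" "A \<in> tri_types \<Longrightarrow> card A = p ^ 3"
  using tri_card by (auto simp: tri_types_def)

text \<open>This product is the norm of a shifted element of the cubic algebra: Frobenius fixes
  \<open>t\<close> and permutes the three factors.\<close>

lemma tri_prod_Fq:
  assumes "A \<in> tri_types" "(v1, v2, v3) \<in> A" "t \<in> Fq 1"
  shows "(v1 + t) * (v2 + t) * (v3 + t) \<in> Fq 1"
proof -
  have tp: "t ^ p = t" using assms(3) by (simp add: Fq_def)
  have fa: "(x + t) ^ p = x ^ p + t" for x using frob_add[of x t 1] tp by simp
  have q: "y ^ (p * p) = (y ^ p) ^ p" for y :: 'a by (simp add: power_mult)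
  have "((v1 + t) * (v2 + t) * (v3 + t)) ^ p = (v1 ^ p + t) * (v2 ^ p + t) * (v3 ^ p + t)"
    by (simp add: power_mult_distrib fa)
  also have "\<dots> = (v1 + t) * (v2 + t) * (v3 + t)"
    using assms(1,2) by (auto simp: tri_types_def tri_split_def tri_mixed_def tri_cubic_def Fq_def
      eval_nat_numeral q power_mult mult_ac)
  finally show ?thesis by (simp add: Fq_def)
qed

end

context prime_field_character
begin

lemma p_gt_2: "p > 2"
proof -
  obtain b where b: "b \<in> Fq 1" "b \<noteq> 0" "\<chi> b \<noteq> 1" using chi_nontrivial by blast
  have "b \<noteq> 1" using b(3) chi_1 by metis
  hence "card {0, 1, b} = 3" using b by auto
  moreover have "card {0, 1, b} \<le> card (Fq 1)" using b card_Fq[of 1] by (intro card_mono) auto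
  ultimately show ?thesis using card_Fq[of 1] by simp
qed

text \<open>Values on nonzero elements have modulus 1, and \<open>z ^ (p - 2)\<close> is the inverse
  of \<open>z\<close>; both sides vanish at 0 because \<open>p > 2\<close>. Thus conjugated factors
  become polynomial factors with exponent \<open>p - 2\<close>.\<close>

lemma cnj_chi: assumes "z \<in> Fq 1" shows "cnj (\<chi> z) = \<chi> (z ^ (p - 2))"
proof (cases "z = 0")
  case True
  thus ?thesis using p_gt_2 by (simp add: power_0_left)
next
  case False
  have "z ^ (p - 2) * z = z ^ (p - 1)" 
  proof -
    have "p - 1 = Suc (p - 2)" using p_gt_2 by simp
    thus ?thesis by (simp add: mult.commute)
  qed
  hence "\<chi> (z ^ (p - 2)) * \<chi> z = 1"
    using Fq_1_power[OF assms False] chi_mult[of "z ^ (p - 2)" z] assms Fq_intros(9)[OF assms] by simp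
  moreover have "cnj (\<chi> z) * \<chi> z = 1"
    using norm_chi[OF assms False] complex_norm_square[of "\<chi> z"] by (simp add: mult.commute)
  ultimately show ?thesis using chi_nonzero[OF assms False] by (metis mult_right_cancel)
qed

section \<open>Correlations of shifted characters over one field\<close>

definition nchi :: "nat \<Rightarrow> 'a \<Rightarrow> complex" where "nchi n y = \<chi> (y ^ esum n)"

definition msum :: "nat \<Rightarrow> nat \<Rightarrow> (nat \<Rightarrow> 'a) \<Rightarrow> (nat \<Rightarrow> 'a) \<Rightarrow> complex" where
  "msum n k f g = (\<Sum>y\<in>Fq n. (\<Prod>i<k. nchi n (y + f i)) * (\<Prod>i<k. cnj (nchi n (y + g i))))"

lemma msum_swap: "msum n k g f = cnj (msum n k f g)"
  by (simp add: msum_def mult.commute)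

text \<open>A shift \<open>f i0\<close> that equals no other shift yields a simple zero, as demanded
  by \<open>weil_sum\<close>. The remaining shifts, at most \<open>2 * k\<close> of them, form
  \<open>D\<close>, with those from \<open>g\<close> weighted by \<open>p - 2\<close>.\<close>

lemma msum_bound_aux:
  assumes f: "\<And>i. i < k \<Longrightarrow> f i \<in> Fq 1" and g: "\<And>i. i < k \<Longrightarrow> g i \<in> Fq 1"
    and i0: "i0 < k" "\<And>i. i < k \<Longrightarrow> i \<noteq> i0 \<Longrightarrow> f i \<noteq> f i0" "\<And>i. i < k \<Longrightarrow> g i \<noteq> f i0" and n: "n > 0"
  shows "cmod (msum n k f g) \<le> real (2 * k) * sqrt (real p) ^ n"
proof -
  define I where "I = {..<k} - {i0}"
  define D where "D = f ` I \<union> g ` {..<k}"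
  define ex where "ex d = card {i\<in>I. f i = d} + (p - 2) * card {i\<in>{..<k}. g i = d}" for d
  have finI: "finite I" by (simp add: I_def)
  have finD: "finite D" by (simp add: D_def I_def)
  interpret W: weil_sum p K \<chi> "f i0" D ex
  proof unfold_locales
    show "f i0 \<in> Fq 1" by (rule f[OF i0(1)])
    show "D \<subseteq> Fq 1" using f g by (auto simp: D_def I_def)
    have "f i \<noteq> f i0" if "i \<in> I" for i using that i0(2) by (auto simp: I_def)
    moreover have "g i \<noteq> f i0" if "i \<in> {..<k}" for i using that i0(3) by auto
    ultimately show "f i0 \<notin> D" unfolding D_def by (metis UnE imageE)
  qed (rule finD)
  have prod_eq: "(f i0 + y) * (\<Prod>t\<in>D. (t + y) ^ ex t) = (\<Prod>i<k. y + f i) * (\<Prod>i<k. (y + g i) ^ (p - 2))" for y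
  proof -
    have "(\<Prod>t\<in>D. (t + y) ^ card {i\<in>I. f i = t}) = (\<Prod>t\<in>D. \<Prod>i\<in>{i\<in>I. f i = t}. y + f i)"
      by (intro prod.cong) (auto simp: add.commute)
    also have "\<dots> = (\<Prod>i\<in>I. y + f i)" by (rule prod.group) (use finI finD in \<open>auto simp: D_def\<close>)
    finally have 1: "(\<Prod>t\<in>D. (t + y) ^ card {i\<in>I. f i = t}) = (\<Prod>i\<in>I. y + f i)" .
    have "(\<Prod>t\<in>D. (t + y) ^ ((p - 2) * card {i\<in>{..<k}. g i = t})) = (\<Prod>t\<in>D. \<Prod>i\<in>{i\<in>{..<k}. g i = t}. (y + g i) ^ (p - 2))"
      by (intro prod.cong) (auto simp: add.commute power_mult)
    also have "\<dots> = (\<Prod>i<k. (y + g i) ^ (p - 2))" by (rule prod.group) (use finD in \<open>auto simp: D_def\<close>)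
    finally have 2: "(\<Prod>t\<in>D. (t + y) ^ ((p - 2) * card {i\<in>{..<k}. g i = t})) = (\<Prod>i<k. (y + g i) ^ (p - 2))" .
    have "(\<Prod>i<k. y + f i) = (y + f i0) * (\<Prod>i\<in>I. y + f i)"
      unfolding I_def using i0 by (intro prod.remove) auto
    thus ?thesis unfolding ex_def power_add prod.distrib 1 2 by (simp add: add.commute mult.assoc)
  qed
  have "msum n k f g = W.charsum n"
    unfolding msum_def W.charsum_def
  \<comment> \<open>The sign changes because \<open>charsum\<close> has factors \<open>t - x\<close>
    where \<open>msum\<close> has \<open>y + t\<close>.\<close>
  proof (rule sum.reindex_bij_witness[of _ uminus uminus])
    fix y assume y: "y \<in> Fq n"
    have e: "(y + f i) ^ esum n \<in> Fq 1" "(y + g i) ^ esum n \<in> Fq 1" if "i < k" for i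
    proof -
      have 1: "y + f i \<in> Fq n" and 2: "y + g i \<in> Fq n"
        using y f[OF that] g[OF that] Fq_1_subset[of n] by blast+
      show "(y + f i) ^ esum n \<in> Fq 1" "(y + g i) ^ esum n \<in> Fq 1"
        by (rule norm_in_Fq1[OF 1], rule norm_in_Fq1[OF 2])
    qed
    have "((f i0 - - y) * (\<Prod>t\<in>D. (t - - y) ^ ex t)) ^ esum n =
       (\<Prod>i<k. (y + f i) ^ esum n) * (\<Prod>i<k. ((y + g i) ^ esum n) ^ (p - 2))"
    proof -
      have "((y + g i) ^ (p - 2)) ^ esum n = ((y + g i) ^ esum n) ^ (p - 2)" for i
        by (simp add: mult.commute flip: power_mult)
      thus ?thesis by (simp add: prod_eq power_mult_distrib prod_power_distrib)
    qed
    hence "\<chi> (((f i0 - - y) * (\<Prod>t\<in>D. (t - - y) ^ ex t)) ^ esum n) =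
       \<chi> ((\<Prod>i<k. (y + f i) ^ esum n) * (\<Prod>i<k. ((y + g i) ^ esum n) ^ (p - 2)))"
      by (rule arg_cong)
    also have "\<dots> = \<chi> (\<Prod>i<k. (y + f i) ^ esum n) * \<chi> (\<Prod>i<k. ((y + g i) ^ esum n) ^ (p - 2))"
    proof (rule chi_mult)
      show "(\<Prod>i<k. (y + f i) ^ esum n) \<in> Fq 1" by (rule Fq_prod) (rule e(1), simp)
      show "(\<Prod>i<k. ((y + g i) ^ esum n) ^ (p - 2)) \<in> Fq 1" by (rule Fq_prod) (rule Fq_intros(9), rule e(2), simp)
    qed
    also have "\<chi> (\<Prod>i<k. (y + f i) ^ esum n) = (\<Prod>i<k. nchi n (y + f i))"
      unfolding nchi_def by (rule chi_prod) (rule e(1), simp)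
    also have "\<chi> (\<Prod>i<k. ((y + g i) ^ esum n) ^ (p - 2)) = (\<Prod>i<k. \<chi> (((y + g i) ^ esum n) ^ (p - 2)))"
      by (rule chi_prod) (rule Fq_intros(9), rule e(2), simp)
    also have "\<dots> = (\<Prod>i<k. cnj (nchi n (y + g i)))"
      unfolding nchi_def by (intro prod.cong refl cnj_chi[symmetric] e(2)) simp
    finally show "\<chi> (((f i0 - - y) * (\<Prod>t\<in>D. (t - - y) ^ ex t)) ^ esum n) =
       (\<Prod>i<k. nchi n (y + f i)) * (\<Prod>i<k. cnj (nchi n (y + g i)))" .
  qed auto
  hence "cmod (msum n k f g) \<le> real (card D) * sqrt (real p) ^ n"
    using W.weil_bound[OF n] by simp
  also have "card D \<le> card (f ` I) + card (g ` {..<k})" unfolding D_def by (rule card_Un_le)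
  also have "\<dots> \<le> card I + card {..<k}" by (intro add_mono card_image_le) (auto simp: finI)
  also have "\<dots> \<le> 2 * k" unfolding I_def using i0 by simp
  finally show ?thesis by (simp add: mult_right_mono)
qed

text \<open>Exchanging \<open>f\<close> and \<open>g\<close> conjugates the sum, so the isolated
  shift may be assumed to belong to \<open>f\<close>.\<close>

lemma msum_good:
  assumes f: "\<And>i. i < k \<Longrightarrow> f i \<in> Fq 1" and g: "\<And>i. i < k \<Longrightarrow> g i \<in> Fq 1"
    and occ: "occ k f g v = 1" and n: "n > 0"
  shows "cmod (msum n k f g) \<le> real (2 * k) * sqrt (real p) ^ n"
proof -
  have *: "\<exists>i0<k. (\<forall>i<k. i \<noteq> i0 \<longrightarrow> f i \<noteq> f i0) \<and> (\<forall>i<k. g i \<noteq> f i0)"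
    if 1: "card {i\<in>{..<k}. f i = v} = 1" and 2: "card {i\<in>{..<k}. g i = v} = 0" for f g :: "nat \<Rightarrow> 'a"
  proof -
    from 1 obtain i0 where i0: "{i\<in>{..<k}. f i = v} = {i0}" by (rule card_1_singletonE)
    have a: "i < k \<and> f i = v \<longleftrightarrow> i = i0" for i using i0 unfolding set_eq_iff by simp
    have b: "\<not> (i < k \<and> g i = v)" for i using 2 by auto
    have "i0 < k" "f i0 = v" using a[of i0] by blast+
    moreover have "\<forall>i<k. i \<noteq> i0 \<longrightarrow> f i \<noteq> v" "\<forall>i<k. g i \<noteq> v" using a b by blast+
    ultimately show ?thesis by (intro exI[of _ i0]) simp
  qed
  consider "card {i\<in>{..<k}. f i = v} = 1" "card {i\<in>{..<k}. g i = v} = 0"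
    | "card {i\<in>{..<k}. g i = v} = 1" "card {i\<in>{..<k}. f i = v} = 0"
    using occ unfolding occ_def by linarith
  thus ?thesis
  proof cases
    case 1
    from *[OF this] obtain i0 where "i0 < k" "\<forall>i<k. i \<noteq> i0 \<longrightarrow> f i \<noteq> f i0" "\<forall>i<k. g i \<noteq> f i0" by blast
    thus ?thesis using f g n by (intro msum_bound_aux[of k f g i0]) auto
  next
    case 2
    from *[OF this] obtain i0 where "i0 < k" "\<forall>i<k. i \<noteq> i0 \<longrightarrow> g i \<noteq> g i0" "\<forall>i<k. f i \<noteq> g i0" by blast
    hence "cmod (msum n k g f) \<le> real (2 * k) * sqrt (real p) ^ n"
      using f g n by (intro msum_bound_aux[of k g f i0]) auto
    thus ?thesis unfolding msum_swap[of n k f g] by simp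
  qed
qed

section \<open>Complete sums over the cubic algebra\<close>

definition tchi :: "'a \<times> 'a \<times> 'a \<Rightarrow> 'a \<Rightarrow> complex" where
  "tchi v t = (case v of (v1, v2, v3) \<Rightarrow> \<chi> ((v1 + t) * (v2 + t) * (v3 + t)))"

definition tsum :: "('a \<times> 'a \<times> 'a) set \<Rightarrow> nat \<Rightarrow> (nat \<Rightarrow> 'a) \<Rightarrow> (nat \<Rightarrow> 'a) \<Rightarrow> complex" where
  "tsum A k f g = (\<Sum>v\<in>A. (\<Prod>i<k. tchi v (f i)) * (\<Prod>i<k. cnj (tchi v (g i))))"

lemma nchi_1: "nchi 1 y = \<chi> y" by (simp add: nchi_def esum_small del: One_nat_def)

lemma tsum_split:
  assumes f: "\<And>i. i < k \<Longrightarrow> f i \<in> Fq 1" and g: "\<And>i. i < k \<Longrightarrow> g i \<in> Fq 1"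
  shows "tsum tri_split k f g = msum 1 k f g * (msum 1 k f g * msum 1 k f g)"
proof -
  have t: "tchi (v1, v2, v3) t = nchi 1 (v1 + t) * (nchi 1 (v2 + t) * nchi 1 (v3 + t))"
    if "v1 \<in> Fq 1" "v2 \<in> Fq 1" "v3 \<in> Fq 1" "t \<in> Fq 1" for v1 v2 v3 t
    unfolding nchi_1 tchi_def prod.case using that by (simp only: chi_mult Fq_intros mult.assoc)
  have "tsum tri_split k f g = (\<Sum>v1\<in>Fq 1. \<Sum>v2\<in>Fq 1. \<Sum>v3\<in>Fq 1. 
      ((\<Prod>i<k. nchi 1 (v1 + f i)) * (\<Prod>i<k. cnj (nchi 1 (v1 + g i)))) *
      (((\<Prod>i<k. nchi 1 (v2 + f i)) * (\<Prod>i<k. cnj (nchi 1 (v2 + g i)))) *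
      ((\<Prod>i<k. nchi 1 (v3 + f i)) * (\<Prod>i<k. cnj (nchi 1 (v3 + g i))))))"
    unfolding tsum_def tri_split_def sum.cartesian_product
  proof (intro sum.cong refl, clarify)
    fix v1 v2 v3 assume v: "v1 \<in> Fq 1" "v2 \<in> Fq 1" "v3 \<in> Fq 1"
    have 1: "(\<Prod>i<k. tchi (v1, v2, v3) (f i)) = (\<Prod>i<k. nchi 1 (v1 + f i) * (nchi 1 (v2 + f i) * nchi 1 (v3 + f i)))"
      using t[OF v] f by (intro prod.cong) auto
    have 2: "(\<Prod>i<k. cnj (tchi (v1, v2, v3) (g i))) = (\<Prod>i<k. cnj (nchi 1 (v1 + g i)) * (cnj (nchi 1 (v2 + g i)) * cnj (nchi 1 (v3 + g i))))"
      using t[OF v] g by (intro prod.cong) auto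
    show "(\<Prod>i<k. tchi (v1, v2, v3) (f i)) * (\<Prod>i<k. cnj (tchi (v1, v2, v3) (g i))) =
      ((\<Prod>i<k. nchi 1 (v1 + f i)) * (\<Prod>i<k. cnj (nchi 1 (v1 + g i)))) *
      (((\<Prod>i<k. nchi 1 (v2 + f i)) * (\<Prod>i<k. cnj (nchi 1 (v2 + g i)))) *
      ((\<Prod>i<k. nchi 1 (v3 + f i)) * (\<Prod>i<k. cnj (nchi 1 (v3 + g i)))))"
      unfolding 1 2 prod.distrib by (simp only: mult_ac)
  qed
  also have "\<dots> = msum 1 k f g * (msum 1 k f g * msum 1 k f g)"
    unfolding msum_def sum_product by (simp only: sum_distrib_left sum_distrib_right mult.assoc)
  finally show ?thesis .
qed

text \<open>For \<open>v\<close> in the quadratic field, \<open>(v + t) * (v ^ p + t)\<close> is the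
  norm of \<open>v + t\<close>, so the two variables separate.\<close>

lemma tsum_mixed:
  assumes f: "\<And>i. i < k \<Longrightarrow> f i \<in> Fq 1" and g: "\<And>i. i < k \<Longrightarrow> g i \<in> Fq 1"
  shows "tsum tri_mixed k f g = msum 2 k f g * msum 1 k f g"
proof -
  have t: "tchi (v, v ^ p, u) t = nchi 2 (v + t) * nchi 1 (u + t)"
    if "v \<in> Fq 2" "u \<in> Fq 1" "t \<in> Fq 1" for v u t
  proof -
    have "t ^ p = t" using that(3) by (simp add: Fq_def)
    hence "(v + t) * (v ^ p + t) = (v + t) ^ esum 2" using frob_add[of v t 1] by (simp add: esum_small power_add)
    moreover have "(v + t) ^ esum 2 \<in> Fq 1" using that Fq_1_subset[of 2] by (intro norm_in_Fq1) blast
    moreover have "u + t \<in> Fq 1" using that by blast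
    ultimately show ?thesis unfolding nchi_1 nchi_def[of 2] tchi_def prod.case by (simp only: chi_mult)
  qed
  have "tsum tri_mixed k f g = (\<Sum>v\<in>Fq 2. \<Sum>u\<in>Fq 1. 
      ((\<Prod>i<k. nchi 2 (v + f i)) * (\<Prod>i<k. cnj (nchi 2 (v + g i)))) *
      ((\<Prod>i<k. nchi 1 (u + f i)) * (\<Prod>i<k. cnj (nchi 1 (u + g i)))))"
    unfolding tsum_def tri_mixed_def sum.cartesian_product sum.reindex[OF tri_inj(1)] o_def
  proof (intro sum.cong refl, clarify)
    fix v u assume v: "v \<in> Fq 2" "u \<in> Fq 1"
    have 1: "(\<Prod>i<k. tchi (v, v ^ p, u) (f i)) = (\<Prod>i<k. nchi 2 (v + f i) * nchi 1 (u + f i))"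
      using t[OF v] f by (intro prod.cong) auto
    have 2: "(\<Prod>i<k. cnj (tchi (v, v ^ p, u) (g i))) = (\<Prod>i<k. cnj (nchi 2 (v + g i)) * cnj (nchi 1 (u + g i)))"
      using t[OF v] g by (intro prod.cong) auto
    show "(\<Prod>i<k. tchi (v, v ^ p, u) (f i)) * (\<Prod>i<k. cnj (tchi (v, v ^ p, u) (g i))) =
      ((\<Prod>i<k. nchi 2 (v + f i)) * (\<Prod>i<k. cnj (nchi 2 (v + g i)))) *
      ((\<Prod>i<k. nchi 1 (u + f i)) * (\<Prod>i<k. cnj (nchi 1 (u + g i))))"
      unfolding 1 2 prod.distrib by (simp only: mult_ac)
  qed
  also have "\<dots> = msum 2 k f g * msum 1 k f g"
    unfolding msum_def sum_product ..
  finally show ?thesis .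
qed

lemma tsum_cubic:
  assumes f: "\<And>i. i < k \<Longrightarrow> f i \<in> Fq 1" and g: "\<And>i. i < k \<Longrightarrow> g i \<in> Fq 1"
  shows "tsum tri_cubic k f g = msum 3 k f g"
proof -
  have t: "tchi (v, v ^ p, (v ^ p) ^ p) t = nchi 3 (v + t)" if "t \<in> Fq 1" for v t
  proof -
    have "t ^ p = t" using that by (simp add: Fq_def)
    hence "v ^ p + t = (v + t) ^ p" "(v ^ p) ^ p + t = ((v + t) ^ p) ^ p"
      using frob_add[of v t 1] frob_add[of "v ^ p" t 1] by simp_all
    hence "(v + t) * (v ^ p + t) * ((v ^ p) ^ p + t) = (v + t) ^ esum 3"
      by (simp only: esum_small power_add power_one_right power_mult)
    thus ?thesis by (simp add: tchi_def nchi_def)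
  qed
  show ?thesis
    unfolding tsum_def tri_cubic_def sum.reindex[OF tri_inj(2)] o_def msum_def
    using t f g by (intro sum.cong arg_cong2[of _ _ _ _ "(*)"] prod.cong) auto
qed

text \<open>The degrees of the fields in the factorisation add up to 3 for each Frobenius type,
  which makes the power of \<open>sqrt (real p)\<close> the same. The cube of \<open>2 * k\<close>
  covers the case of three factors.\<close>

lemma tsum_good:
  assumes A: "A \<in> tri_types" and k: "k > 0"
    and f: "\<And>i. i < k \<Longrightarrow> f i \<in> Fq 1" and g: "\<And>i. i < k \<Longrightarrow> g i \<in> Fq 1" and occ: "occ k f g v = 1"
  shows "cmod (tsum A k f g) \<le> real (2 * k) ^ 3 * sqrt (real p) ^ 3"
proof -
  define m where "m = real (2 * k)"
  define s where "s = sqrt (real p)"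
  have m: "m \<ge> 1" and s: "s \<ge> 0" using k by (auto simp: m_def s_def)
  note b = msum_good[OF f g occ, folded m_def s_def]
  have b1: "cmod (msum 1 k f g) \<le> m * s" and b2: "cmod (msum 2 k f g) \<le> m * s\<^sup>2" and b3: "cmod (msum 3 k f g) \<le> m * s ^ 3"
    using b[of 1] b[of 2] b[of 3] by auto
  consider "A = tri_split" | "A = tri_mixed" | "A = tri_cubic" using A by (auto simp: tri_types_def)
  hence "cmod (tsum A k f g) \<le> m ^ 3 * s ^ 3"
  proof cases
    case 1
    have "cmod (tsum A k f g) = cmod (msum 1 k f g) * (cmod (msum 1 k f g) * cmod (msum 1 k f g))"
      using tsum_split[of k f g, OF f g] by (simp add: 1 norm_mult)
    also have "\<dots> \<le> (m * s) * ((m * s) * (m * s))" using b1 m s by (intro mult_mono) auto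
    finally show ?thesis by (simp add: power3_eq_cube mult_ac)
  next
    case 2
    have "cmod (tsum A k f g) = cmod (msum 2 k f g) * cmod (msum 1 k f g)"
      using tsum_mixed[of k f g, OF f g] by (simp add: 2 norm_mult)
    also have "\<dots> \<le> (m * s\<^sup>2) * (m * s)" using b1 b2 m s by (intro mult_mono) auto
    also have "\<dots> = m ^ 2 * s ^ 3" by (simp add: power3_eq_cube power2_eq_square mult_ac)
    also have "\<dots> \<le> m ^ 3 * s ^ 3" using m s by (intro mult_right_mono power_increasing) auto
    finally show ?thesis .
  next
    case 3
    have "cmod (tsum A k f g) \<le> m * s ^ 3" using tsum_cubic[of k f g, OF f g] b3 by (simp add: 3)
    also have "\<dots> \<le> m ^ 3 * s ^ 3" using m s power_increasing[of 1 3 m] by (intro mult_right_mono) auto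
    finally show ?thesis .
  qed
  thus ?thesis by (simp add: m_def s_def)
qed

lemma tchi_le: "A \<in> tri_types \<Longrightarrow> v \<in> A \<Longrightarrow> t \<in> Fq 1 \<Longrightarrow> cmod (tchi v t) \<le> 1"
  by (cases v) (auto simp: tchi_def intro!: norm_chi_le[unfolded One_nat_def] tri_prod_Fq[unfolded One_nat_def])

lemma tsum_trivial:
  assumes A: "A \<in> tri_types"
    and f: "\<And>i. i < k \<Longrightarrow> f i \<in> Fq 1" and g: "\<And>i. i < k \<Longrightarrow> g i \<in> Fq 1"
  shows "cmod (tsum A k f g) \<le> real p ^ 3"
proof -
  have "cmod (tsum A k f g) \<le> (\<Sum>v\<in>A. 1)" unfolding tsum_def
  proof (rule sum_norm_le)
    fix v assume v: "v \<in> A"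
    have 1: "cmod (\<Prod>i<k. tchi v (f i)) \<le> 1"
      unfolding prod_norm[symmetric] using tchi_le[OF A v] f by (intro prod_le_1) auto
    have 2: "cmod (\<Prod>i<k. cnj (tchi v (g i))) \<le> 1"
      unfolding prod_norm[symmetric] using tchi_le[OF A v] g by (intro prod_le_1) auto
    show "cmod ((\<Prod>i<k. tchi v (f i)) * (\<Prod>i<k. cnj (tchi v (g i)))) \<le> 1"
      using mult_mono[OF 1 2] by (simp add: norm_mult)
  qed
  thus ?thesis using tri_types_card[OF A] by simp
qed

text \<open>The trivial bound is used for the tuples in which no shift occurs exactly once, and Weil's bound
  for the others.\<close>

theorem moment_bound:
  assumes A: "A \<in> tri_types" and k: "k > 0" and T: "T < p"
  shows "(\<Sum>v\<in>A. cmod (\<Sum>t=1..T. tchi v (of_nat t)) ^ (2 * k))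
    \<le> real T ^ k * real k ^ (2 * k) * real p ^ 3 + real T ^ (2 * k) * (real (2 * k) ^ 3 * sqrt (real p) ^ 3)"
proof -
  define PT where "PT = {..<k} \<rightarrow>\<^sub>E {1..T}"
  have finPT: "finite PT" unfolding PT_def by (intro finite_PiE) auto
  define \<iota> where "\<iota> f = (\<lambda>i. of_nat (f i) :: 'a)" for f :: "nat \<Rightarrow> nat"
  have \<iota>: "\<iota> f i \<in> Fq 1" for f i unfolding \<iota>_def by (rule Fq_of_nat)
  define bad where "bad = {(f, g) \<in> PT \<times> PT. \<forall>v. occ k f g v \<noteq> 1}"
  have pow: "(\<Sum>t=1..T. tchi v (of_nat t)) ^ k = (\<Sum>f\<in>PT. \<Prod>i<k. tchi v (\<iota> f i))" for v
    unfolding PT_def \<iota>_def using prod_sum_PiE[of "{..<k}" "\<lambda>_. {1..T}" "\<lambda>_ t. tchi v (of_nat t)"]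
    by simp
  have "of_real (\<Sum>v\<in>A. cmod (\<Sum>t=1..T. tchi v (of_nat t)) ^ (2 * k)) =
      (\<Sum>v\<in>A. (\<Sum>t=1..T. tchi v (of_nat t)) ^ k * cnj ((\<Sum>t=1..T. tchi v (of_nat t)) ^ k))"
    unfolding of_real_sum
  proof (intro sum.cong refl)
    fix v
    have "complex_of_real (cmod z ^ (2 * k)) = z ^ k * cnj (z ^ k)" for z

    proof -
      have "complex_of_real (cmod z ^ (2 * k)) = of_real ((cmod z)\<^sup>2) ^ k" by (simp add: power_mult)
      thus ?thesis unfolding complex_norm_square by (simp add: power_mult_distrib)
    qed
    thus "complex_of_real (cmod (\<Sum>t = 1..T. tchi v (of_nat t)) ^ (2 * k)) =
        (\<Sum>t = 1..T. tchi v (of_nat t)) ^ k * cnj ((\<Sum>t = 1..T. tchi v (of_nat t)) ^ k)" .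
  qed
  also have "\<dots> = (\<Sum>v\<in>A. \<Sum>f\<in>PT. \<Sum>g\<in>PT. (\<Prod>i<k. tchi v (\<iota> f i)) * (\<Prod>i<k. cnj (tchi v (\<iota> g i))))"
    unfolding pow cnj_sum cnj_prod sum_product ..
  also have "\<dots> = (\<Sum>f\<in>PT. \<Sum>g\<in>PT. tsum A k (\<iota> f) (\<iota> g))"
    unfolding tsum_def by (subst sum.swap, intro sum.cong refl, rule sum.swap)
  also have "\<dots> = (\<Sum>(f, g)\<in>PT \<times> PT. tsum A k (\<iota> f) (\<iota> g))" by (rule sum.cartesian_product)
  finally have eq: "of_real (\<Sum>v\<in>A. cmod (\<Sum>t=1..T. tchi v (of_nat t)) ^ (2 * k)) =
    (\<Sum>(f, g)\<in>PT \<times> PT. tsum A k (\<iota> f) (\<iota> g))" .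
  have "(\<Sum>v\<in>A. cmod (\<Sum>t=1..T. tchi v (of_nat t)) ^ (2 * k)) =
      cmod (of_real (\<Sum>v\<in>A. cmod (\<Sum>t=1..T. tchi v (of_nat t)) ^ (2 * k)))"
    unfolding norm_of_real by (rule abs_of_nonneg[symmetric]) (intro sum_nonneg zero_le_power norm_ge_zero)
  also have "\<dots> \<le> (\<Sum>fg\<in>PT \<times> PT. (if fg \<in> bad then real p ^ 3 else 0) + real (2 * k) ^ 3 * sqrt (real p) ^ 3)"
    unfolding eq
  proof (rule sum_norm_le)
    fix fg assume "fg \<in> PT \<times> PT"
    then obtain f g where fg: "fg = (f, g)" "f \<in> PT" "g \<in> PT" by auto
    show "cmod (case fg of (f, g) \<Rightarrow> tsum A k (\<iota> f) (\<iota> g)) \<le>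
       (if fg \<in> bad then real p ^ 3 else 0) + real (2 * k) ^ 3 * sqrt (real p) ^ 3"
    proof (cases "fg \<in> bad")
      case True
      have "cmod (tsum A k (\<iota> f) (\<iota> g)) \<le> real p ^ 3" by (intro tsum_trivial A \<iota>)
      thus ?thesis using True fg by (simp add: add_increasing2)
    next
      case False
      then obtain v where v: "occ k f g v = 1"
        using fg by (auto simp: bad_def)
      have "{i\<in>{..<k}. f i = v} \<noteq> {} \<or> {i\<in>{..<k}. g i = v} \<noteq> {}" using v unfolding occ_def by (metis One_nat_def Zero_not_Suc add_0 card.empty)
      hence vT: "v \<in> {1..T}" using fg(2,3) unfolding PT_def by (auto simp: PiE_iff)
      \<comment> \<open>Because \<open>T < p\<close>, the shifts stay distinct in the field, so a
        shift occurring once among the integers also occurs once there.\<close>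
      have iff: "\<iota> u i = of_nat v \<longleftrightarrow> u i = v" if "u \<in> PT" "i < k" for u i
      proof -
        have "u i \<in> {1..T}" using that unfolding PT_def by (auto simp: PiE_iff)
        thus ?thesis using vT T of_nat_inj_on unfolding \<iota>_def inj_on_def by auto
      qed
      have "{i\<in>{..<k}. \<iota> f i = of_nat v} = {i\<in>{..<k}. f i = v}" "{i\<in>{..<k}. \<iota> g i = of_nat v} = {i\<in>{..<k}. g i = v}"
        using iff fg(2,3) by auto
      hence "occ k (\<iota> f) (\<iota> g) (of_nat v) = 1" using v by (simp add: occ_def)
      hence "cmod (tsum A k (\<iota> f) (\<iota> g)) \<le> real (2 * k) ^ 3 * sqrt (real p) ^ 3"
        by (rule tsum_good[OF A k \<iota> \<iota>])
      thus ?thesis using False fg by simp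
    qed
  qed
  also have "\<dots> = real (card bad) * real p ^ 3 + real (card (PT \<times> PT)) * (real (2 * k) ^ 3 * sqrt (real p) ^ 3)"
  proof -
    have "(PT \<times> PT) \<inter> {fg. fg \<in> bad} = bad" by (auto simp: bad_def)
    thus ?thesis using finPT by (simp add: sum.distrib sum.If_cases)
  qed
  also have "\<dots> \<le> real T ^ k * real k ^ (2 * k) * real p ^ 3 + real T ^ (2 * k) * (real (2 * k) ^ 3 * sqrt (real p) ^ 3)"
  proof (intro add_mono mult_right_mono)
    have "real (card bad) \<le> real (T ^ k * (k ^ k * k ^ k))"
      using card_repeated_pairs[OF k, of T] unfolding bad_def PT_def by (intro of_nat_mono) simp
    thus "real (card bad) \<le> real T ^ k * real k ^ (2 * k)" by (simp add: mult_2 power_add)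
    show "real (card (PT \<times> PT)) \<le> real T ^ (2 * k)" by (simp add: PT_def card_PiE mult_2 power_add card_cartesian_product)
  qed auto
  finally show ?thesis .
qed

end

section \<open>Multiplicative energy of intervals\<close>

lemma small_multiple_eq_0: "\<bar>z\<bar> < p \<Longrightarrow> p dvd z \<Longrightarrow> z = 0" for z p :: int
  using dvd_imp_le_int[of z p] by (cases "z = 0") auto

lemma card_residue_class_interval:
  fixes U :: "int set"
  assumes "U \<subseteq> {m..<m + int N}" "q > 0" "\<And>x y. x \<in> U \<Longrightarrow> y \<in> U \<Longrightarrow> q dvd x - y"
  shows "real (card U) \<le> 1 + real N / real_of_int q"
proof (cases "U = {}")
  case False
  have fin: "finite U" using assms(1) by (rule finite_subset) simp
  define x0 where "x0 = Min U"
  have x0: "x0 \<in> U" "\<And>x. x \<in> U \<Longrightarrow> x0 \<le> x" using fin False by (auto simp: x0_def)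
  have "inj_on (\<lambda>x. (x - x0) div q) U"
  proof (rule inj_onI)
    fix x y assume xy: "x \<in> U" "y \<in> U" "(x - x0) div q = (y - x0) div q"
    have "x - x0 = (x - x0) div q * q" "y - x0 = (y - x0) div q * q"
      using assms(3)[OF xy(1) x0(1)] assms(3)[OF xy(2) x0(1)] by simp_all
    thus "x = y" using xy(3) by simp
  qed
  moreover have "(\<lambda>x. (x - x0) div q) ` U \<subseteq> {0..int N div q}"
  proof (rule image_subsetI)
    fix x assume x: "x \<in> U"
    have "x \<in> {m..<m + int N}" "x0 \<in> {m..<m + int N}" using x x0(1) assms(1) by blast+
    hence "0 \<le> x - x0" "x - x0 \<le> int N" using x0(2)[OF x] by auto
    thus "(x - x0) div q \<in> {0..int N div q}" using assms(2) by (auto simp: zdiv_mono1 pos_imp_zdiv_nonneg_iff)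
  qed
  ultimately have "card U \<le> card {0..int N div q}" by (intro card_inj_on_le) auto
  also have "\<dots> = nat (int N div q + 1)" by simp
  finally have "int (card U) \<le> int N div q + 1"
    using assms(2) pos_imp_zdiv_nonneg_iff[of q "int N"] by linarith
  hence "real (card U) \<le> real_of_int (int N div q + 1)" by (metis of_int_le_iff of_int_of_nat_eq)
  also have "\<dots> \<le> real N / real_of_int q + 1"
    using real_of_int_div4[of "int N" q] by simp
  finally show ?thesis by simp
qed (use assms in auto)

text \<open>The reciprocal of the larger of \<open>r\<close> and \<open>m\<close> after both are
  divided by their gcd.\<close>

definition gcd_ratio :: "int \<Rightarrow> int \<Rightarrow> real" where
  "gcd_ratio r m = real_of_int (gcd r m) / real_of_int (max r m)"

lemma gcd_ratio: "r > 0 \<Longrightarrow> m > 0 \<Longrightarrow> 0 \<le> gcd_ratio r m \<and> gcd_ratio r m \<le> 1"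
  using gcd_le1_int[of r m] by (auto simp: gcd_ratio_def divide_simps max_def)

text \<open>For two solutions the condition \<open>2 * int N * int H \<le> p\<close> turns the
  congruence between their differences into the equation \<open>(x - x') * m = (y - y') * r\<close>
  of integers. Hence \<open>x - x'\<close> is divisible by \<open>r'\<close> and
  \<open>y - y'\<close> by \<open>m'\<close>, the reduced \<open>r\<close> and \<open>m\<close>.
  Either coordinate determines the solution, and the one with the larger step is counted.\<close>

lemma card_proportional_pairs:
  fixes I J :: "int set" and p r m :: int
  assumes I: "I \<subseteq> {m1..<m1 + int N}" and J: "J \<subseteq> {m2..<m2 + int N}"
    and r: "0 < r" "r \<le> int H" and m: "0 < m" "m \<le> int H" and p: "2 * int N * int H \<le> p"
  shows "real (card {(x, y) \<in> I \<times> J. p dvd x * m - y * r}) \<le> 1 + real N * gcd_ratio r m"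
proof -
  define E where "E = {(x, y) \<in> I \<times> J. p dvd x * m - y * r}"
  have eq: "(x - x') * m = (y - y') * r" if "(x, y) \<in> E" "(x', y') \<in> E" for x y x' y'
  proof -
    have mem: "x \<in> I" "x' \<in> I" "y \<in> J" "y' \<in> J" using that by (auto simp: E_def)
    have N: "N > 0" using mem I by (cases N) auto
    have "x \<in> {m1..<m1 + int N}" "x' \<in> {m1..<m1 + int N}" "y \<in> {m2..<m2 + int N}" "y' \<in> {m2..<m2 + int N}"
      using mem I J by blast+
    hence dx: "\<bar>x - x'\<bar> \<le> int N - 1" "\<bar>y - y'\<bar> \<le> int N - 1" by auto
    have "\<bar>(x - x') * m\<bar> \<le> (int N - 1) * int H" "\<bar>(y - y') * r\<bar> \<le> (int N - 1) * int H"
      unfolding abs_mult using dx r m by (intro mult_mono; simp)+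
    hence "\<bar>(x - x') * m - (y - y') * r\<bar> \<le> 2 * ((int N - 1) * int H)" by linarith
    also have "\<dots> < 2 * int N * int H" using r by (simp add: algebra_simps)
    finally have "\<bar>(x - x') * m - (y - y') * r\<bar> < p" using p by linarith
    moreover have "p dvd (x * m - y * r) - (x' * m - y' * r)" using that by (auto simp: E_def)
    hence "p dvd (x - x') * m - (y - y') * r" by (simp add: algebra_simps)
    ultimately have "(x - x') * m - (y - y') * r = 0" by (rule small_multiple_eq_0)
    thus ?thesis by simp
  qed
  define g where "g = gcd r m"
  have g: "g > 0" using r by (simp add: g_def)
  define r' m' where "r' = r div g" and "m' = m div g"
  have rm: "r = r' * g" "m = m' * g" by (simp_all add: g_def r'_def m'_def)
  have coprime: "coprime r' m'" unfolding r'_def m'_def g_def using r by (intro div_gcd_coprime) auto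
  have pos: "r' > 0" "m' > 0" using r m g rm by (auto simp: zero_less_mult_iff)
  have cop: "r' dvd a" "m' dvd b" if "a * m = b * r" for a b
  proof -
    have "(a * m') * g = (b * r') * g" using that rm by (simp add: mult.assoc)
    hence *: "a * m' = b * r'" using g by simp
    hence "r' dvd a * m'" "m' dvd b * r'" by (metis dvd_triv_right)+
    thus "r' dvd a" "m' dvd b" using coprime by (auto simp: coprime_dvd_mult_left_iff coprime_commute)
  qed
  have finE: "finite E"
    by (rule finite_subset[of _ "{m1..<m1 + int N} \<times> {m2..<m2 + int N}"]) (use I J in \<open>auto simp: E_def\<close>)
  show ?thesis
  proof (cases "m \<le> r")
    case True
    have inj: "inj_on fst E"
      by (rule inj_onI) (use eq r in \<open>fastforce\<close>)
    have "real (card (fst ` E)) \<le> 1 + real N / real_of_int r'"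
    proof (rule card_residue_class_interval[OF _ pos(1)])
      show "fst ` E \<subseteq> {m1..<m1 + int N}" using I by (auto simp: E_def)
      fix u v assume "u \<in> fst ` E" "v \<in> fst ` E"
      then obtain y y' where "(u, y) \<in> E" "(v, y') \<in> E" by auto
      from cop(1)[OF eq[OF this]] show "r' dvd u - v" .
    qed
    also have "real N / real_of_int r' = real N * gcd_ratio r m"
      using True g pos unfolding gcd_ratio_def g_def[symmetric] by (simp add: rm(1) max_def)
    finally show ?thesis unfolding card_image[OF inj] E_def[symmetric] .
  next
    case False
    have inj: "inj_on snd E"
      by (rule inj_onI) (use eq m in \<open>fastforce\<close>)
    have "real (card (snd ` E)) \<le> 1 + real N / real_of_int m'"
    proof (rule card_residue_class_interval[OF _ pos(2)])
      show "snd ` E \<subseteq> {m2..<m2 + int N}" using J by (auto simp: E_def)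
      fix u v assume "u \<in> snd ` E" "v \<in> snd ` E"
      then obtain y y' where "(y, u) \<in> E" "(y', v) \<in> E" by auto
      from cop(2)[OF eq[OF this]] show "m' dvd u - v" .
    qed
    also have "real N / real_of_int m' = real N * gcd_ratio r m"
      using False g pos unfolding gcd_ratio_def g_def[symmetric] by (simp add: rm(2) max_def)
    finally show ?thesis unfolding card_image[OF inj] E_def[symmetric] .
  qed
qed

text \<open>A number \<open>m\<close> is the maximum of \<open>2 * m - 1\<close> pairs, which
  contribute less than 2 together.\<close>

lemma sum_inverse_max: "(\<Sum>a\<in>{1..U}. \<Sum>b\<in>{1..U}. 1 / real (max a b)) \<le> 2 * real U"
proof (induction U)
  case (Suc U)
  have s: "{1..Suc U} = insert (Suc U) {1..U}" by auto
  have "(\<Sum>a\<in>{1..Suc U}. \<Sum>b\<in>{1..Suc U}. 1 / real (max a b)) =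
     (\<Sum>b\<in>{1..U}. 1 / real (max (Suc U) b)) + 1 / real (Suc U) + (\<Sum>a\<in>{1..U}. 1 / real (max a (Suc U)))
       + (\<Sum>a\<in>{1..U}. \<Sum>b\<in>{1..U}. 1 / real (max a b))"
    unfolding s by (simp add: sum.distrib)
  also have "(\<Sum>b\<in>{1..U}. 1 / real (max (Suc U) b)) = (\<Sum>b\<in>{1..U}. 1 / real (Suc U))"
    by (intro sum.cong) (auto simp: max_def)
  also have "(\<Sum>a\<in>{1..U}. 1 / real (max a (Suc U))) = (\<Sum>b\<in>{1..U}. 1 / real (Suc U))"
    by (intro sum.cong) (auto simp: max_def)
  also have "(\<Sum>b\<in>{1..U}. 1 / real (Suc U)) + 1 / real (Suc U) + (\<Sum>b\<in>{1..U}. 1 / real (Suc U)) \<le> 2"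
    by (simp add: divide_simps)
  finally show ?case using Suc by simp
qed simp

definition harmonic :: "nat \<Rightarrow> real" where "harmonic n = (\<Sum>d=1..n. 1 / real d)"

lemma harmonic_le: "n > 0 \<Longrightarrow> harmonic n \<le> 1 + ln (real n)"
proof (induction n rule: nat_induct_non_zero)
  case (Suc n)
  have "ln (real n / real (Suc n)) \<le> real n / real (Suc n) - 1" using Suc by (intro ln_le_minus_one) auto
  also have "\<dots> = - (1 / real (Suc n))" by (simp add: divide_simps)
  finally have "1 / real (Suc n) \<le> ln (real (Suc n)) - ln (real n)" using Suc by (simp add: ln_div)
  moreover have "harmonic (Suc n) = harmonic n + 1 / real (Suc n)" by (simp add: harmonic_def)
  ultimately show ?case using Suc by linarith
qed (simp add: harmonic_def)

lemma harmonic_ge_1: "n > 0 \<Longrightarrow> harmonic n \<ge> 1"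
  unfolding harmonic_def by (rule order.trans[OF _ member_le_sum[of 1]]) auto

text \<open>Sort the pairs by their gcd \<open>d\<close>. The reduced pair lies in a square of side
  \<open>H div d\<close>; forgetting that it is coprime only enlarges the sum, and
  \<open>sum_inverse_max\<close> gives at most \<open>2 * H / d\<close>.\<close>

lemma sum_gcd_ratio: "(\<Sum>(r, m)\<in>{1..int H} \<times> {1..int H}. gcd_ratio r m) \<le> 2 * real H * harmonic H"
proof -
  define V where "V = (SIGMA d:{1..H}. {1..H div d} \<times> {1..H div d})"
  define \<phi> where "\<phi> = (\<lambda>(r, m). (nat (gcd r m), nat (r div gcd r m), nat (m div gcd r m)))"
  define w where "w = (\<lambda>(d :: nat, a :: nat, b :: nat). 1 / real (max a b))"
  have key: "int (nat (r div gcd r m)) * gcd r m = r" "int (nat (m div gcd r m)) * gcd r m = m"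
    if "r > 0" "m > 0" for r m :: int
  proof -
    have "gcd r m > 0" using that by simp
    hence "r div gcd r m \<ge> 0" "m div gcd r m \<ge> 0" using that by (simp_all add: pos_imp_zdiv_nonneg_iff)
    thus "int (nat (r div gcd r m)) * gcd r m = r" "int (nat (m div gcd r m)) * gcd r m = m" by simp_all
  qed
  have "inj_on \<phi> ({1..int H} \<times> {1..int H})"
  proof (rule inj_onI)
    fix z z' assume z: "z \<in> {1..int H} \<times> {1..int H}" "z' \<in> {1..int H} \<times> {1..int H}" "\<phi> z = \<phi> z'"
    obtain r m r' m' where zz: "z = (r, m)" "z' = (r', m')" by (metis surj_pair)
    have h: "r \<in> {1..int H}" "m \<in> {1..int H}" "r' \<in> {1..int H}" "m' \<in> {1..int H}" "\<phi> (r, m) = \<phi> (r', m')"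
      using z by (auto simp: zz)
    have "nat (gcd r m) = nat (gcd r' m')" and q: "nat (r div gcd r m) = nat (r' div gcd r' m')" "nat (m div gcd r m) = nat (m' div gcd r' m')"
      using h(5) by (auto simp: \<phi>_def)
    hence g: "gcd r m = gcd r' m'" by (metis gcd_ge_0_int int_nat_eq)
    have pos: "r > 0" "m > 0" "r' > 0" "m' > 0" using h by auto
    have "r = r'" using key(1)[OF pos(1,2)] key(1)[OF pos(3,4)] unfolding g unfolding q(1)[unfolded g] by (rule trans[OF sym])
    moreover have "m = m'" using key(2)[OF pos(1,2)] key(2)[OF pos(3,4)] unfolding g unfolding q(2)[unfolded g] by (rule trans[OF sym])
    ultimately show "z = z'" by (simp add: zz)
  qed
  hence "(\<Sum>rm\<in>{1..int H} \<times> {1..int H}. w (\<phi> rm)) = (\<Sum>v\<in>\<phi> ` ({1..int H} \<times> {1..int H}). w v)"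
    by (simp add: sum.reindex)
  also have "\<dots> \<le> (\<Sum>v\<in>V. w v)"
  proof (rule sum_mono2)
    show "\<phi> ` ({1..int H} \<times> {1..int H}) \<subseteq> V"
    proof (rule image_subsetI)
      fix z assume z: "z \<in> {1..int H} \<times> {1..int H}"
      obtain r m where zz: "z = (r, m)" by (metis surj_pair)
      have h: "r \<in> {1..int H}" "m \<in> {1..int H}" using z by (auto simp: zz)
      define d a b where "d = nat (gcd r m)" and "a = nat (r div gcd r m)" and "b = nat (m div gcd r m)"
      have d: "int d = gcd r m" by (simp add: d_def)
      have ra: "int (a * d) = r" "int (b * d) = m" using key[of r m] h by (simp_all add: d a_def b_def)
      hence "a * d \<le> H" "b * d \<le> H" "a * d > 0" "b * d > 0" using h by (auto simp flip: of_nat_mult)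
      moreover from this have "d \<le> H" by (metis dual_order.trans mult_le_mono1 mult_1 Suc_leI nat_0_less_mult_iff One_nat_def)
      ultimately show "\<phi> z \<in> V"
        by (auto simp: zz V_def \<phi>_def d_def[symmetric] a_def[symmetric] b_def[symmetric] less_eq_div_iff_mult_less_eq)
    qed
  qed (auto simp: V_def w_def)
  also have "(\<Sum>v\<in>V. w v) = (\<Sum>d=1..H. \<Sum>a=1..H div d. \<Sum>b=1..H div d. 1 / real (max a b))"
    unfolding V_def w_def by (subst sum.Sigma[symmetric]) (auto simp: sum.cartesian_product)
  also have "\<dots> \<le> (\<Sum>d=1..H. 2 * real H * (1 / real d))"
  proof (intro sum_mono)
    fix d assume "d \<in> {1..H}"
    have "(\<Sum>a=1..H div d. \<Sum>b=1..H div d. 1 / real (max a b)) \<le> 2 * real (H div d)" by (rule sum_inverse_max)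
    also have "real (H div d) \<le> real H / real d" by (rule of_nat_div_le_of_nat)
    finally show "(\<Sum>a=1..H div d. \<Sum>b=1..H div d. 1 / real (max a b)) \<le> 2 * real H * (1 / real d)" by simp
  qed
  also have "\<dots> = 2 * real H * harmonic H" by (simp add: harmonic_def sum_distrib_left)
  also have "(\<Sum>rm\<in>{1..int H} \<times> {1..int H}. w (\<phi> rm)) = (\<Sum>(r, m)\<in>{1..int H} \<times> {1..int H}. gcd_ratio r m)"
  proof (intro sum.cong refl, clarify)
    fix r m assume h: "r \<in> {1..int H}" "m \<in> {1..int H}"
    define d a b where "d = gcd r m" and "a = nat (r div gcd r m)" and "b = nat (m div gcd r m)"
    have d0: "d > 0" using h by (simp add: d_def)
    have "r = int a * d" "m = int b * d" using key[of r m] h by (simp_all add: d_def a_def b_def)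
    hence "max r m = int (max a b) * d" using d0 by (auto simp: max_def)
    hence "gcd_ratio r m = 1 / real (max a b)" using d0 by (simp add: gcd_ratio_def flip: d_def)
    thus "w (\<phi> (r, m)) = gcd_ratio r m" by (simp add: w_def \<phi>_def a_def b_def)
  qed
  finally show ?thesis .
qed

text \<open>The three congruences say that \<open>(x - y X) (s' - t' X) = (x' - y' X) (s - t X)\<close> over the prime field.
  By unique factorisation, either corresponding factors are proportional, which gives \<open>s t' = s' t\<close>,
  or the two factors of each product are proportional.\<close>

lemma energy_bound:
  fixes I J :: "int set" and p :: nat
  assumes p: "prime p" and I: "I \<subseteq> {m1..<m1 + int N}" and J: "J \<subseteq> {m2..<m2 + int N}"
    and H: "0 < H" "H \<le> N" and NH: "2 * N * H \<le> p"
  defines "B \<equiv> (I \<times> J) \<times> ({1..int H} \<times> {1..int H})"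
  shows "real (card {(((x, y), (s, t)), ((x', y'), (s', t'))) \<in> B \<times> B.
      int p dvd x * s' - x' * s \<and> int p dvd y * t' - y' * t \<and>
      int p dvd x * t' + y * s' - x' * t - y' * s}) \<le> 9 * real N ^ 2 * real H ^ 2 * harmonic H"
proof -
  define S where "S = {1..int H}"
  define E where "E = {(((x, y), (s, t)), ((x', y'), (s', t'))) \<in> B \<times> B.
      int p dvd x * s' - x' * s \<and> int p dvd y * t' - y' * t \<and>
      int p dvd x * t' + y * s' - x' * t - y' * s}"
  define E1 where "E1 = {(((x, y), (s, t)), ((x', y'), (s', t'))) \<in> B \<times> B.
      int p dvd x * s' - x' * s \<and> int p dvd y * s' - y' * s \<and> s * t' = s' * t}"
  define E2 where "E2 = {(((x, y), (s, t)), ((x', y'), (s', t'))) \<in> B \<times> B.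
      int p dvd x * s' - x' * s \<and> int p dvd y * t' - y' * t \<and> int p dvd x * t - y * s}"
  define PI where "PI s s' = {(x, x') \<in> I \<times> I. int p dvd x * s' - x' * s}" for s s'
  define PJ where "PJ s s' = {(x, x') \<in> J \<times> J. int p dvd x * s' - x' * s}" for s s'
  define PIJ where "PIJ s t = {(x, y) \<in> I \<times> J. int p dvd x * t - y * s}" for s t
  have finI: "finite I" "finite J" using finite_subset[OF I] finite_subset[OF J] by simp_all
  have finS: "finite S" and cardS: "card S = H" by (simp_all add: S_def)
  have finB: "finite B" unfolding B_def using finI by auto
  have NHp: "2 * int N * int H \<le> int p" 
  proof -
    have "int (2 * N * H) \<le> int p" using NH by (simp only: of_nat_le_iff)
    thus ?thesis by simp
  qed
  have HH: "int H * int H < int p"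
  proof -
    have "int H * int H \<le> int N * int H" "0 < int N * int H" using H by (auto intro: mult_right_mono)
    moreover have "2 * (int N * int H) \<le> int p" using NHp by (simp only: mult.assoc)
    ultimately show ?thesis by linarith
  qed
  have Np: "int N \<le> int p"
  proof -
    have "int N * 1 \<le> int N * int H" using H by (intro mult_left_mono) auto
    moreover have "2 * (int N * int H) \<le> int p" using NHp by (simp only: mult.assoc)
    ultimately show ?thesis by linarith
  qed
  have Hp: "int H < int p"
  proof -
    have "int H * 1 \<le> int H * int H" using H by (intro mult_left_mono) auto
    thus ?thesis using HH by linarith
  qed
  have pp: "prime (int p)" using p by simp
  have ndvd: "\<not> int p dvd s" if "s \<in> S" for s
    using that Hp zdvd_imp_le[of "int p" s] by (auto simp: S_def)
  have "E \<subseteq> E1 \<union> E2"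
  proof (rule subsetI)
    fix z assume z: "z \<in> E"
    obtain x y s t x' y' s' t' where zz: "z = (((x, y), (s, t)), ((x', y'), (s', t')))" by (metis surj_pair)
    note e = z[unfolded zz]
    show "z \<in> E1 \<union> E2"
    proof (cases "z \<in> E2")
      case False
      note n = False[unfolded zz]
    have st: "s \<in> S" "t \<in> S" "s' \<in> S" "t' \<in> S" using e by (auto simp: E_def B_def S_def)
    have c: "int p dvd x * s' - x' * s" "int p dvd y * t' - y' * t" "int p dvd x * t' + y * s' - x' * t - y' * s"
      using e by (auto simp: E_def)
    \<comment> \<open>The difference of the two polynomial products evaluated at the zero
      \<open>X = s / t\<close> of \<open>s - t X\<close>, with denominators cleared (up to
      sign).\<close>
    have "(x * t - y * s) * (s * t' - s' * t) =
       s * t * (x * t' + y * s' - x' * t - y' * s) - t * t * (x * s' - x' * s) - s * s * (y * t' - y' * t)"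
      by (simp add: algebra_simps)
    hence "int p dvd (x * t - y * s) * (s * t' - s' * t)" using c by (simp only: dvd_diff dvd_mult)
    moreover have "\<not> int p dvd x * t - y * s" using n e c by (auto simp: E_def E2_def)
    ultimately have d: "int p dvd s * t' - s' * t" using pp by (auto simp: prime_dvd_mult_iff)
    \<comment> \<open>Both products lie between 1 and \<open>H ^ 2\<close>, which is less than
      \<open>p\<close>, so the congruence is an equality.\<close>
    have "s * t' \<le> int H * int H" "s' * t \<le> int H * int H" "0 < s * t'" "0 < s' * t"
      using st by (auto simp: S_def intro!: mult_mono)
    hence "\<bar>s * t' - s' * t\<bar> < int p" using HH by linarith
    hence eq: "s * t' = s' * t" using d by (auto dest: small_multiple_eq_0)
    have "t * (y * s' - y' * s) = y * (s' * t) - s * t * y'" by (simp add: algebra_simps)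
    also have "\<dots> = s * (y * t' - y' * t)" unfolding eq[symmetric] by (simp add: algebra_simps)
    finally have "t * (y * s' - y' * s) = s * (y * t' - y' * t)" .
    hence "int p dvd t * (y * s' - y' * s)" using c by simp
    hence "int p dvd y * s' - y' * s" using pp ndvd[OF st(2)] by (auto simp: prime_dvd_mult_iff)
    thus ?thesis unfolding zz using e eq by (auto simp: E_def E1_def)
    qed simp
  qed
  moreover have "E1 \<subseteq> B \<times> B" "E2 \<subseteq> B \<times> B" by (auto simp: E1_def E2_def)
  hence "finite (E1 \<union> E2)" using finB by (auto intro: finite_subset[of _ "B \<times> B"])
  ultimately have "card E \<le> card (E1 \<union> E2)" by (intro card_mono)
  also have "\<dots> \<le> card E1 + card E2" by (rule card_Un_le)
  finally have cE: "real (card E) \<le> real (card E1) + real (card E2)" by linarith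
  have bI: "real (card (PI s s')) \<le> 1 + real N * gcd_ratio s s'" and bJ: "real (card (PJ s s')) \<le> 1 + real N * gcd_ratio s s'"
    and bIJ: "real (card (PIJ s s')) \<le> 1 + real N * gcd_ratio s s'"
    if "s \<in> S" "s' \<in> S" for s s'
  proof -
    have st: "0 < s" "s \<le> int H" "0 < s'" "s' \<le> int H" using that by (auto simp: S_def)
    show "real (card (PI s s')) \<le> 1 + real N * gcd_ratio s s'" unfolding PI_def
      by (rule card_proportional_pairs[OF I I st NHp])
    show "real (card (PJ s s')) \<le> 1 + real N * gcd_ratio s s'" unfolding PJ_def
      by (rule card_proportional_pairs[OF J J st NHp])
    show "real (card (PIJ s s')) \<le> 1 + real N * gcd_ratio s s'" unfolding PIJ_def
      by (rule card_proportional_pairs[OF I J st NHp])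
  qed
  have gr: "0 \<le> gcd_ratio s s'" "gcd_ratio s s' \<le> 1" if "s \<in> S" "s' \<in> S" for s s'
    using gcd_ratio[of s s'] that by (auto simp: S_def)
  have finP: "finite (PI s s')" "finite (PJ s s')" "finite (PIJ s s')" for s s'
    using finI by (auto simp: PI_def PJ_def PIJ_def intro: finite_subset[of _ "I \<times> I"] finite_subset[of _ "J \<times> J"] finite_subset[of _ "I \<times> J"])
  have G: "(\<Sum>ss\<in>S \<times> S. gcd_ratio (fst ss) (snd ss)) \<le> 2 * real H * harmonic H"
    using sum_gcd_ratio[of H] by (simp add: S_def case_prod_beta)

  \<comment> \<open>In \<open>E1\<close> the number \<open>t'\<close> is determined by
    \<open>s\<close>, \<open>t\<close> and \<open>s'\<close>, so a solution is encoded by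
    \<open>s\<close>, \<open>s'\<close>, a pair in \<open>PI\<close>, a pair in \<open>PJ\<close>
    and \<open>t\<close>.\<close>
  have "real (card E1) \<le> (\<Sum>ss\<in>S \<times> S. real (card (PI (fst ss) (snd ss))) * real (card (PJ (fst ss) (snd ss))) * real H)"
  proof -
    define \<phi> where "\<phi> = (\<lambda>(((x :: int, y :: int), (s :: int, t :: int)), ((x' :: int, y' :: int), (s' :: int, t' :: int))). ((s, s'), ((x, x'), (y, y')), t))"
    have "inj_on \<phi> E1"
    proof (rule inj_onI)
      fix z z2 assume z: "z \<in> E1" "z2 \<in> E1" "\<phi> z = \<phi> z2"
      obtain x y s t x' y' s' t' where zz: "z = (((x, y), (s, t)), ((x', y'), (s', t')))" by (metis surj_pair)
      obtain x2 y2 s2 t2 x2' y2' s2' t2' where zz2: "z2 = (((x2, y2), (s2, t2)), ((x2', y2'), (s2', t2')))" by (metis surj_pair)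
      note e = z(1,2)[unfolded zz zz2] and f = z(3)[unfolded zz zz2]
      have eqs: "x = x2" "y = y2" "s = s2" "t = t2" "x' = x2'" "y' = y2'" "s' = s2'" using f by (auto simp: \<phi>_def)
      have "s * t' = s' * t" "s2 * t2' = s2' * t2" "s > 0" using e by (auto simp: E1_def B_def)
      hence "s * t' = s * t2'" "s > 0" using eqs by simp_all
      hence "t' = t2'" by simp
      thus "z = z2" using eqs by (simp add: zz zz2)
    qed
    moreover have "\<phi> ` E1 \<subseteq> (SIGMA ss:S \<times> S. (PI (fst ss) (snd ss) \<times> PJ (fst ss) (snd ss)) \<times> S)"
      by (auto simp: \<phi>_def E1_def B_def S_def PI_def PJ_def)
    ultimately have "card E1 \<le> card (SIGMA ss:S \<times> S. (PI (fst ss) (snd ss) \<times> PJ (fst ss) (snd ss)) \<times> S)"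
      using finS finP by (intro card_inj_on_le[of \<phi>]) auto
    also have "\<dots> = (\<Sum>ss\<in>S \<times> S. card (PI (fst ss) (snd ss)) * card (PJ (fst ss) (snd ss)) * H)"
      using finS finP by (subst card_SigmaI) (auto simp: card_cartesian_product cardS)
    finally have "real (card E1) \<le> real (\<Sum>ss\<in>S \<times> S. card (PI (fst ss) (snd ss)) * card (PJ (fst ss) (snd ss)) * H)" by (rule of_nat_mono)
    thus ?thesis by simp
  qed
  also have "\<dots> \<le> (\<Sum>ss\<in>S \<times> S. (2 + 2 * real N ^ 2 * gcd_ratio (fst ss) (snd ss)) * real H)"
  proof (intro sum_mono mult_right_mono)
    fix ss assume ss: "ss \<in> S \<times> S"
    define u where "u = gcd_ratio (fst ss) (snd ss)"
    have u: "0 \<le> u" "u \<le> 1" using gr ss by (auto simp: u_def)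
    have "real (card (PI (fst ss) (snd ss))) * real (card (PJ (fst ss) (snd ss))) \<le> (1 + real N * u) * (1 + real N * u)"
      using bI bJ ss u unfolding u_def[symmetric] by (intro mult_mono) (auto simp: u_def)
    \<comment> \<open>Removing the mixed term and then using \<open>u ^ 2 \<le> u\<close> leaves a
      first moment of \<open>gcd_ratio\<close>.\<close>
    also have "\<dots> \<le> 2 + 2 * (real N * u) ^ 2"
      using zero_le_power2[of "1 - real N * u"] by (simp add: power2_eq_square algebra_simps)
    also have "(real N * u) ^ 2 \<le> real N ^ 2 * u"
    proof -
      have "u * u \<le> u * 1" using u by (intro mult_left_mono) auto
      hence "u ^ 2 \<le> u" by (simp add: power2_eq_square)
      thus ?thesis unfolding power_mult_distrib by (intro mult_left_mono) auto
    qed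
    finally show "real (card (PI (fst ss) (snd ss))) * real (card (PJ (fst ss) (snd ss))) \<le> 2 + 2 * real N ^ 2 * gcd_ratio (fst ss) (snd ss)"
      by (simp add: u_def)
  qed simp
  also have "\<dots> = real H * (2 * real H ^ 2 + 2 * real N ^ 2 * (\<Sum>ss\<in>S \<times> S. gcd_ratio (fst ss) (snd ss)))"
    by (simp add: sum_distrib_right[symmetric] sum.distrib sum_distrib_left[symmetric] card_cartesian_product cardS power2_eq_square)
  also have "\<dots> \<le> real H * (2 * real H ^ 2 + 2 * real N ^ 2 * (2 * real H * harmonic H))"
    using G by (intro mult_left_mono add_left_mono) auto
  finally have b1: "real (card E1) \<le> 2 * real H ^ 3 + 4 * real N ^ 2 * real H ^ 2 * harmonic H"
    by (simp add: power2_eq_square power3_eq_cube algebra_simps)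

  \<comment> \<open>In \<open>E2\<close> the integers \<open>x'\<close> and \<open>y'\<close> are
    determined modulo \<open>p\<close> by the other data, hence determined, since they lie in
    intervals of at most \<open>p\<close> integers.\<close>
  have "real (card E2) \<le> (\<Sum>ss\<in>S \<times> S. real (card (PIJ (fst ss) (snd ss))) * (real H * real H))"
  proof -
    define \<phi> where "\<phi> = (\<lambda>(((x :: int, y :: int), (s :: int, t :: int)), ((x' :: int, y' :: int), (s' :: int, t' :: int))). ((s, t), (x, y), (s', t')))"
    have uniq: "u = u2" if "int p dvd v - u * s" "int p dvd v - u2 * s" "s \<in> S"
       "u \<in> {m..<m + int N}" "u2 \<in> {m..<m + int N}" for u u2 v s m
    proof -
      have "int p dvd (v - u2 * s) - (v - u * s)" using that(1,2) by (rule dvd_diff[rotated])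
      hence "int p dvd (u - u2) * s" by (simp add: algebra_simps)
      hence "int p dvd u - u2" using ndvd[OF that(3)] pp by (auto simp: prime_dvd_mult_iff)
      moreover have "\<bar>u - u2\<bar> < int p" using that(4,5) Np by auto
      ultimately show ?thesis by (auto dest: small_multiple_eq_0)
    qed
    have "inj_on \<phi> E2"
    proof (rule inj_onI)
      fix z z2 assume z: "z \<in> E2" "z2 \<in> E2" "\<phi> z = \<phi> z2"
      obtain x y s t x' y' s' t' where zz: "z = (((x, y), (s, t)), ((x', y'), (s', t')))" by (metis surj_pair)
      obtain x2 y2 s2 t2 x2' y2' s2' t2' where zz2: "z2 = (((x2, y2), (s2, t2)), ((x2', y2'), (s2', t2')))" by (metis surj_pair)
      note e = z(1,2)[unfolded zz zz2] and f = z(3)[unfolded zz zz2]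
      have eqs: "x = x2" "y = y2" "s = s2" "t = t2" "s' = s2'" "t' = t2'" using f by (auto simp: \<phi>_def)
      have "x' = x2'" using e I unfolding eqs E2_def B_def S_def[symmetric] by (intro uniq[of "x2 * s2'" _ s2 _ m1]) auto
      moreover have "y' = y2'" using e J unfolding eqs E2_def B_def S_def[symmetric] by (intro uniq[of "y2 * t2'" _ t2 _ m2]) auto
      ultimately show "z = z2" using eqs by (simp add: zz zz2)
    qed
    moreover have "\<phi> ` E2 \<subseteq> (SIGMA ss:S \<times> S. PIJ (fst ss) (snd ss) \<times> (S \<times> S))"
      by (auto simp: \<phi>_def E2_def B_def S_def PIJ_def)
    ultimately have "card E2 \<le> card (SIGMA ss:S \<times> S. PIJ (fst ss) (snd ss) \<times> (S \<times> S))"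
      using finS finP by (intro card_inj_on_le[of \<phi>]) auto
    also have "\<dots> = (\<Sum>ss\<in>S \<times> S. card (PIJ (fst ss) (snd ss)) * (H * H))"
      using finS finP by (subst card_SigmaI) (auto simp: card_cartesian_product cardS)
    finally have "real (card E2) \<le> real (\<Sum>ss\<in>S \<times> S. card (PIJ (fst ss) (snd ss)) * (H * H))" by (rule of_nat_mono)
    thus ?thesis by simp
  qed
  also have "\<dots> \<le> (\<Sum>ss\<in>S \<times> S. (1 + real N * gcd_ratio (fst ss) (snd ss)) * (real H * real H))"
    using bIJ by (intro sum_mono mult_right_mono) auto
  also have "\<dots> = real H ^ 2 * (real H ^ 2 + real N * (\<Sum>ss\<in>S \<times> S. gcd_ratio (fst ss) (snd ss)))"
    by (simp add: sum_distrib_right[symmetric] sum.distrib sum_distrib_left[symmetric] card_cartesian_product cardS power2_eq_square)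
  also have "\<dots> \<le> real H ^ 2 * (real H ^ 2 + real N * (2 * real H * harmonic H))"
    using G by (intro mult_left_mono add_left_mono) auto
  finally have b2: "real (card E2) \<le> real H ^ 2 * (real H ^ 2 + real N * (2 * real H * harmonic H))" .

  define h n l where "h = real H" and "n = real N" and "l = harmonic H"
  have hn: "1 \<le> h" "h \<le> n" "1 \<le> l" using H harmonic_ge_1[of H] by (auto simp: h_def n_def l_def)
  have h2: "h ^ 2 \<le> n ^ 2" using hn by (intro power_mono) auto
  have hn2: "h \<le> n ^ 2" using hn self_le_power[of n 2] by linarith
  have "2 * h ^ 3 \<le> 2 * (n ^ 2 * h ^ 2) * l"
  proof -
    have "h ^ 3 = h * h ^ 2" by (simp add: power3_eq_cube power2_eq_square)
    also have "\<dots> \<le> n ^ 2 * h ^ 2" using hn2 by (intro mult_right_mono) auto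
    also have "\<dots> \<le> n ^ 2 * h ^ 2 * l" using mult_left_mono[of 1 l "n ^ 2 * h ^ 2"] hn by simp
    finally show ?thesis by simp
  qed
  moreover have "h ^ 2 * h ^ 2 \<le> n ^ 2 * h ^ 2 * l"
  proof -
    have "h ^ 2 * h ^ 2 \<le> n ^ 2 * h ^ 2" using h2 by (intro mult_right_mono) auto
    also have "\<dots> \<le> n ^ 2 * h ^ 2 * l" using mult_left_mono[of 1 l "n ^ 2 * h ^ 2"] hn by simp
    finally show ?thesis .
  qed
  moreover have "h ^ 2 * (n * (2 * h * l)) \<le> 2 * (n ^ 2 * h ^ 2) * l"
  proof -
    have "h * (n * h ^ 2 * l) \<le> n * (n * h ^ 2 * l)" using hn by (intro mult_right_mono) auto
    thus ?thesis by (simp add: power2_eq_square mult_ac)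
  qed
  moreover have "h ^ 2 * (h ^ 2 + n * (2 * h * l)) = h ^ 2 * h ^ 2 + h ^ 2 * (n * (2 * h * l))" by (rule distrib_left)
  moreover define Z where "Z = n ^ 2 * h ^ 2 * l"
  have "2 * (n ^ 2 * h ^ 2) * l = 2 * Z" "4 * n ^ 2 * h ^ 2 * l = 4 * Z" "9 * n ^ 2 * h ^ 2 * l = 9 * Z"
    by (simp_all add: Z_def)
  \<comment> \<open>The constant is 9 = 2 + 4 + 1 + 2, one summand for each term on the left after
    expansion.\<close>
  ultimately have "2 * h ^ 3 + 4 * n ^ 2 * h ^ 2 * l + h ^ 2 * (h ^ 2 + n * (2 * h * l)) \<le> 9 * n ^ 2 * h ^ 2 * l"
    unfolding Z_def[symmetric] by linarith
  thus ?thesis using cE b1 b2 unfolding E_def[symmetric] h_def n_def l_def by linarith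
qed

section \<open>Burgess' amplification\<close>

lemma cauchy_schwarz_sum:
  fixes a b :: "'i \<Rightarrow> real"
  shows "(\<Sum>i\<in>V. a i * b i) ^ 2 \<le> (\<Sum>i\<in>V. a i ^ 2) * (\<Sum>i\<in>V. b i ^ 2)"
proof -
  have "0 \<le> (\<Sum>i\<in>V. \<Sum>j\<in>V. (a i * b j - a j * b i) ^ 2)" by (intro sum_nonneg) auto
  also have "\<dots> = (\<Sum>i\<in>V. \<Sum>j\<in>V. a i ^ 2 * b j ^ 2 + b i ^ 2 * a j ^ 2 - 2 * ((a i * b i) * (a j * b j)))"
    by (intro sum.cong refl) (simp add: power2_eq_square algebra_simps)
  also have "\<dots> = (\<Sum>i\<in>V. \<Sum>j\<in>V. a i ^ 2 * b j ^ 2) + (\<Sum>i\<in>V. \<Sum>j\<in>V. b i ^ 2 * a j ^ 2)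
      - 2 * (\<Sum>i\<in>V. \<Sum>j\<in>V. (a i * b i) * (a j * b j))"
    by (simp add: sum_subtractf sum.distrib sum_distrib_left)
  also have "\<dots> = 2 * ((\<Sum>i\<in>V. a i ^ 2) * (\<Sum>i\<in>V. b i ^ 2)) - 2 * (\<Sum>i\<in>V. a i * b i) ^ 2"
    unfolding sum_product[symmetric] power2_eq_square by (simp add: mult.commute)
  finally show ?thesis by simp
qed

text \<open>One application of the Cauchy-Schwarz inequality doubles the exponent. Powers of two are
  enough, since the order of the moment only has to be large.\<close>

lemma weighted_power_mean:
  fixes w u :: "'i \<Rightarrow> real"
  assumes w: "\<And>i. i \<in> V \<Longrightarrow> w i \<ge> 0" and u: "\<And>i. i \<in> V \<Longrightarrow> u i \<ge> 0"
  shows "(\<Sum>i\<in>V. w i * u i) ^ (2 ^ r) \<le> (\<Sum>i\<in>V. w i) ^ (2 ^ r - 1) * (\<Sum>i\<in>V. w i * u i ^ (2 ^ r))"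
proof (induction r)
  case (Suc r)
  define k where "k = (2::nat) ^ r"
  have k: "k \<ge> 1" by (simp add: k_def)
  define W where "W = (\<Sum>i\<in>V. w i)"
  have W0: "W \<ge> 0" unfolding W_def using w by (intro sum_nonneg)
  have CS: "(\<Sum>i\<in>V. w i * u i ^ k) ^ 2 \<le> W * (\<Sum>i\<in>V. w i * u i ^ (2 * k))"
  proof -
    have "(\<Sum>i\<in>V. w i * u i ^ k) = (\<Sum>i\<in>V. sqrt (w i) * (sqrt (w i) * u i ^ k))"
      using w by (intro sum.cong refl) (simp flip: mult.assoc)
    also have "\<dots> ^ 2 \<le> (\<Sum>i\<in>V. sqrt (w i) ^ 2) * (\<Sum>i\<in>V. (sqrt (w i) * u i ^ k) ^ 2)"
      by (rule cauchy_schwarz_sum)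
    also have "(\<Sum>i\<in>V. sqrt (w i) ^ 2) = W" unfolding W_def using w by (intro sum.cong) auto
    also have "(\<Sum>i\<in>V. (sqrt (w i) * u i ^ k) ^ 2) = (\<Sum>i\<in>V. w i * u i ^ (2 * k))"
      using w by (intro sum.cong) (auto simp: power_mult_distrib mult.commute[of 2] simp flip: power_mult)
    finally show ?thesis .
  qed
  have "(\<Sum>i\<in>V. w i * u i) ^ (2 ^ Suc r) = ((\<Sum>i\<in>V. w i * u i) ^ k) ^ 2"
    by (simp add: k_def power_mult[symmetric] mult.commute)
  also have "\<dots> \<le> (W ^ (k - 1) * (\<Sum>i\<in>V. w i * u i ^ k)) ^ 2"
    using Suc w u unfolding k_def[symmetric] W_def[symmetric]
    by (intro power_mono zero_le_power sum_nonneg mult_nonneg_nonneg)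
  also have "\<dots> = (W ^ (k - 1)) ^ 2 * (\<Sum>i\<in>V. w i * u i ^ k) ^ 2" by (rule power_mult_distrib)
  also have "\<dots> \<le> (W ^ (k - 1)) ^ 2 * (W * (\<Sum>i\<in>V. w i * u i ^ (2 * k)))"
    by (intro mult_left_mono CS) simp
  also have "(W ^ (k - 1)) ^ 2 * (W * (\<Sum>i\<in>V. w i * u i ^ (2 * k))) = W ^ (2 * k - 1) * (\<Sum>i\<in>V. w i * u i ^ (2 * k))"
  proof -
    have "2 * k - 1 = (k - 1) * 2 + 1" using k by simp
    thus ?thesis by (simp only: power_add power_mult power_one_right mult.assoc)
  qed
  finally show ?case by (simp add: k_def W_def)
qed simp

text \<open>A last Cauchy-Schwarz step separates the second moment of the weights from the moment of
  \<open>u\<close>.\<close>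

lemma weighted_hoelder:
  fixes w u :: "'i \<Rightarrow> real"
  assumes w: "\<And>i. i \<in> V \<Longrightarrow> w i \<ge> 0" and u: "\<And>i. i \<in> V \<Longrightarrow> u i \<ge> 0" and k: "k = 2 ^ r"
  shows "(\<Sum>i\<in>V. w i * u i) ^ (2 * k) \<le>
    (\<Sum>i\<in>V. w i) ^ (2 * k - 2) * ((\<Sum>i\<in>V. w i ^ 2) * (\<Sum>i\<in>V. u i ^ (2 * k)))"
proof -
  define W where "W = (\<Sum>i\<in>V. w i)"
  have W0: "W \<ge> 0" unfolding W_def using w by (intro sum_nonneg)
  have "(\<Sum>i\<in>V. w i * u i) ^ (2 * k) = ((\<Sum>i\<in>V. w i * u i) ^ k) ^ 2"
    by (simp add: power_mult[symmetric] mult.commute)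
  also have "\<dots> \<le> (W ^ (k - 1) * (\<Sum>i\<in>V. w i * u i ^ k)) ^ 2"
    using weighted_power_mean[of V w u r] w u unfolding k[symmetric] W_def[symmetric]
    by (intro power_mono zero_le_power sum_nonneg mult_nonneg_nonneg) auto
  also have "\<dots> = (W ^ (k - 1)) ^ 2 * (\<Sum>i\<in>V. w i * u i ^ k) ^ 2" by (rule power_mult_distrib)
  also have "\<dots> \<le> (W ^ (k - 1)) ^ 2 * ((\<Sum>i\<in>V. w i ^ 2) * (\<Sum>i\<in>V. (u i ^ k) ^ 2))"
    by (intro mult_left_mono cauchy_schwarz_sum) simp
  also have "(W ^ (k - 1)) ^ 2 = W ^ (2 * k - 2)"
    unfolding power_mult[symmetric] by (rule arg_cong[of _ _ "power W"]) simp
  also have "(\<Sum>i\<in>V. (u i ^ k) ^ 2) = (\<Sum>i\<in>V. u i ^ (2 * k))"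
    by (intro sum.cong refl) (simp add: power_mult[symmetric] mult.commute)
  finally show ?thesis by (simp add: W_def)
qed

text \<open>Each shift by one exchanges one end term for another.\<close>

lemma interval_shift_bound:
  fixes f :: "int \<Rightarrow> complex"
  assumes f: "\<And>x. cmod (f x) \<le> 1"
  shows "cmod ((\<Sum>x\<in>{m..<m + int n}. f x) - (\<Sum>x\<in>{m..<m + int n}. f (x + int h))) \<le> 2 * real h"
proof (induction h)
  case (Suc h)
  define F where "F h = (\<Sum>x\<in>{m..<m + int n}. f (x + int h))" for h
  have "F (Suc h) - F h = (\<Sum>i<n. f (m + int (Suc i) + int h) - f (m + int i + int h))"
  proof -
    have r: "(\<Sum>x\<in>{m..<m + int n}. g x) = (\<Sum>i<n. g (m + int i))" for g :: "int \<Rightarrow> complex"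
      by (rule sum.reindex_bij_witness[of _ "\<lambda>i. m + int i" "\<lambda>x. nat (x - m)"]) auto
    show ?thesis unfolding F_def r sum_subtractf by (simp add: algebra_simps)
  qed
  also have "\<dots> = f (m + int n + int h) - f (m + int 0 + int h)"
    by (rule sum_lessThan_telescope)
  finally have "cmod (F (Suc h) - F h) \<le> 1 + 1"
    using norm_triangle_le_diff[of "f (m + int n + int h)" "f (m + int 0 + int h)" "1 + 1"] f add_mono[OF f f] by simp
  hence 1: "cmod (F h - F (Suc h)) \<le> 2" by (simp add: norm_minus_commute)
  have "cmod ((\<Sum>x\<in>{m..<m + int n}. f x) - F (Suc h)) \<le>
      cmod ((\<Sum>x\<in>{m..<m + int n}. f x) - F h) + cmod (F h - F (Suc h))"
    using norm_triangle_ineq[of "(\<Sum>x\<in>{m..<m + int n}. f x) - F h" "F h - F (Suc h)"] by simp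
  also have "\<dots> \<le> 2 * real h + 2" using Suc 1 unfolding F_def[symmetric] by linarith
  finally show ?case by (simp add: F_def)
qed simp

lemma box_shift_bound:
  fixes W :: "int \<Rightarrow> int \<Rightarrow> complex"
  assumes W: "\<And>x y. cmod (W x y) \<le> 1"
    and N: "N1 \<le> N" "N2 \<le> N" and h: "h \<le> Q" "l \<le> Q"
  shows "cmod ((\<Sum>x\<in>{m1..<m1 + int N1}. \<Sum>y\<in>{m2..<m2 + int N2}. W x y) -
     (\<Sum>x\<in>{m1..<m1 + int N1}. \<Sum>y\<in>{m2..<m2 + int N2}. W (x + int h) (y + int l))) \<le> 4 * real N * real Q"
proof -
  let ?I = "{m1..<m1 + int N1}" and ?J = "{m2..<m2 + int N2}"
  have "cmod ((\<Sum>x\<in>?I. \<Sum>y\<in>?J. W x y) - (\<Sum>x\<in>?I. \<Sum>y\<in>?J. W (x + int h) y)) \<le> real N * (2 * real Q)"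
  proof -
    have "(\<Sum>x\<in>?I. \<Sum>y\<in>?J. W x y) - (\<Sum>x\<in>?I. \<Sum>y\<in>?J. W (x + int h) y) =
      (\<Sum>y\<in>?J. (\<Sum>x\<in>?I. W x y) - (\<Sum>x\<in>?I. W (x + int h) y))"
      unfolding sum_subtractf by (intro arg_cong2[of _ _ _ _ "(-)"] sum.swap)
    also have "cmod \<dots> \<le> (\<Sum>y\<in>?J. 2 * real h)"
      by (intro sum_norm_le interval_shift_bound W)
    also have "\<dots> = real N2 * (2 * real h)" by simp
    also have "\<dots> \<le> real N * (2 * real Q)" using N h by (intro mult_mono) auto
    finally show ?thesis .
  qed
  moreover have "cmod ((\<Sum>x\<in>?I. \<Sum>y\<in>?J. W (x + int h) y) - (\<Sum>x\<in>?I. \<Sum>y\<in>?J. W (x + int h) (y + int l))) \<le> real N * (2 * real Q)"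
  proof -
    have "cmod ((\<Sum>x\<in>?I. \<Sum>y\<in>?J. W (x + int h) y) - (\<Sum>x\<in>?I. \<Sum>y\<in>?J. W (x + int h) (y + int l))) \<le> (\<Sum>x\<in>?I. 2 * real l)"
      unfolding sum_subtractf[symmetric]
      by (rule sum_norm_le) (unfold sum_subtractf, rule interval_shift_bound, rule W)
    also have "\<dots> = real N1 * (2 * real l)" by simp
    also have "\<dots> \<le> real N * (2 * real Q)" using N h by (intro mult_mono) auto
    finally show ?thesis .
  qed
  ultimately show ?thesis
    using norm_triangle_ineq[of "(\<Sum>x\<in>?I. \<Sum>y\<in>?J. W x y) - (\<Sum>x\<in>?I. \<Sum>y\<in>?J. W (x + int h) y)"
      "(\<Sum>x\<in>?I. \<Sum>y\<in>?J. W (x + int h) y) - (\<Sum>x\<in>?I. \<Sum>y\<in>?J. W (x + int h) (y + int l))"]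
    by simp
qed

text \<open>A polynomial of degree less than 3 with three distinct zeros vanishes. It lifts an
  identity in the cubic algebra to one between coefficients.\<close>

lemma quadratic_three_zeros:
  fixes c0 c1 c2 \<theta>1 \<theta>2 \<theta>3 :: "'b::field"
  assumes "c0 - \<theta>1 * c1 + \<theta>1 * \<theta>1 * c2 = 0" "c0 - \<theta>2 * c1 + \<theta>2 * \<theta>2 * c2 = 0" "c0 - \<theta>3 * c1 + \<theta>3 * \<theta>3 * c2 = 0"
    and "\<theta>1 \<noteq> \<theta>2" "\<theta>1 \<noteq> \<theta>3" "\<theta>2 \<noteq> \<theta>3"
  shows "c0 = 0 \<and> c1 = 0 \<and> c2 = 0"
proof -
  have "(\<theta>1 - \<theta>2) * ((\<theta>1 + \<theta>2) * c2 - c1) =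
      (c0 - \<theta>1 * c1 + \<theta>1 * \<theta>1 * c2) - (c0 - \<theta>2 * c1 + \<theta>2 * \<theta>2 * c2)" by (simp add: algebra_simps)
  hence 1: "(\<theta>1 + \<theta>2) * c2 = c1" using assms by simp
  have "(\<theta>1 - \<theta>3) * ((\<theta>1 + \<theta>3) * c2 - c1) =
      (c0 - \<theta>1 * c1 + \<theta>1 * \<theta>1 * c2) - (c0 - \<theta>3 * c1 + \<theta>3 * \<theta>3 * c2)" by (simp add: algebra_simps)
  hence 2: "(\<theta>1 + \<theta>3) * c2 = c1" using assms by simp
  have "(\<theta>2 - \<theta>3) * c2 = (\<theta>1 + \<theta>2) * c2 - (\<theta>1 + \<theta>3) * c2" by (simp add: algebra_simps)
  hence "c2 = 0" using 1 2 assms(6) by simp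
  thus ?thesis using 1 assms(1) by simp
qed

context prime_field_character
begin

text \<open>The point \<open>(x, y)\<close> is shifted by \<open>\<tau> (s, t)\<close> with \<open>\<tau> \<le> T\<close> and \<open>s, t \<le> H\<close>; dividing by the image of
  \<open>(s, t)\<close> in the cubic algebra turns this into a shift by the integer \<open>\<tau>\<close>.\<close>

theorem burgess_inequality:
  fixes \<theta>1 \<theta>2 \<theta>3 :: 'a
  assumes \<theta>: "\<theta>1 \<noteq> \<theta>2" "\<theta>1 \<noteq> \<theta>3" "\<theta>2 \<noteq> \<theta>3"
    and A: "A \<in> tri_types"
    and norm_Fq: "\<And>x y. x \<in> Fq 1 \<Longrightarrow> y \<in> Fq 1 \<Longrightarrow> (x - \<theta>1 * y) * (x - \<theta>2 * y) * (x - \<theta>3 * y) \<in> Fq 1"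
    and quot_A: "\<And>x y s t. x \<in> Fq 1 \<Longrightarrow> y \<in> Fq 1 \<Longrightarrow> s \<in> Fq 1 \<Longrightarrow> t \<in> Fq 1 \<Longrightarrow>
       s - \<theta>1 * t \<noteq> 0 \<Longrightarrow> s - \<theta>2 * t \<noteq> 0 \<Longrightarrow> s - \<theta>3 * t \<noteq> 0 \<Longrightarrow>
       ((x - \<theta>1 * y) / (s - \<theta>1 * t), (x - \<theta>2 * y) / (s - \<theta>2 * t), (x - \<theta>3 * y) / (s - \<theta>3 * t)) \<in> A"
    and N: "N1 \<le> N" "N2 \<le> N" and H: "6 \<le> H" "H \<le> N" and NH: "2 * N * H \<le> p"
    and T: "0 < T" "T < p" and k: "k = 2 ^ r"
  defines "W \<equiv> \<lambda>x y. \<chi> ((of_int x - \<theta>1 * of_int y) * (of_int x - \<theta>2 * of_int y) * (of_int x - \<theta>3 * of_int y))"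
  shows "\<exists>Z\<ge>0. cmod (\<Sum>x\<in>{m1..<m1 + int N1}. \<Sum>y\<in>{m2..<m2 + int N2}. W x y) \<le> 4 * real N * real (T * H) + Z \<and>
    (real T * real H ^ 2 / 2 * Z) ^ (2 * k) \<le>
      (real N ^ 2 * real H ^ 2) ^ (2 * k - 2) * ((9 * real N ^ 2 * real H ^ 2 * harmonic H) *
       (real T ^ k * real k ^ (2 * k) * real p ^ 3 + real T ^ (2 * k) * (real (2 * k) ^ 3 * sqrt (real p) ^ 3)))"
proof -
  define I where "I = {m1..<m1 + int N1}"
  define J where "J = {m2..<m2 + int N2}"
  define z1 where "z1 x y = of_int x - \<theta>1 * of_int y" for x y
  define z2 where "z2 x y = of_int x - \<theta>2 * of_int y" for x y
  define z3 where "z3 x y = of_int x - \<theta>3 * of_int y" for x y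
  note z_defs = z1_def z2_def z3_def
  have W_eq: "W x y = \<chi> (z1 x y * z2 x y * z3 x y)" for x y by (simp add: W_def z_defs)
  have nrm: "z1 x y * z2 x y * z3 x y \<in> Fq 1" for x y unfolding z_defs by (rule norm_Fq) auto
  have W1: "cmod (W x y) \<le> 1" for x y unfolding W_eq by (rule norm_chi_le[OF nrm])
  define S where "S = {1..int H}"
  \<comment> \<open>The short vectors whose image in the algebra is invertible.\<close>
  define S' where "S' = {st \<in> S \<times> S. z1 (fst st) (snd st) \<noteq> 0 \<and> z2 (fst st) (snd st) \<noteq> 0 \<and> z3 (fst st) (snd st) \<noteq> 0}"
  define P where "P = (I \<times> J) \<times> S'"
  define quo where "quo b = (case b of ((x, y), (s, t)) \<Rightarrow> (z1 x y / z1 s t, z2 x y / z2 s t, z3 x y / z3 s t))" for b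
  define \<nu> where "\<nu> v = real (card {b \<in> P. quo b = v})" for v
  define u where "u v = cmod (\<Sum>\<tau>=1..T. tchi v (of_nat \<tau>))" for v
  define Q where "Q = T * H"
  have fin: "finite I" "finite J" "finite S" "finite S'" "finite P" and cardIJ: "card I = N1" "card J = N2" and cardS: "card S = H"
    by (auto simp: I_def J_def S_def S'_def P_def)
  have finA: "finite A" by (rule tri_types_card(1)[OF A])
  have quoA: "quo b \<in> A" if "b \<in> P" for b
    using that quot_A unfolding P_def S'_def quo_def z_defs by (auto split: prod.splits)

  have Hp: "int H < int p"
  proof -
    have "2 * H \<le> 2 * N * H" using H by simp
    hence "2 * H \<le> p" using NH by linarith
    thus ?thesis using H by simp
  qed
  \<comment> \<open>For each root and each \<open>t\<close> at most one \<open>s\<close> gives a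
    zero factor, as \<open>H < p\<close>. So at most \<open>3 * H\<close> pairs are lost, and
    \<open>H \<ge> 6\<close> makes this at most half of all pairs.\<close>
  have cardS': "real H ^ 2 / 2 \<le> real (card S')"
  proof -
    define bad where "bad z = {st \<in> S \<times> S. z (fst st) (snd st) = (0::'a)}" for z
    have "card (bad (\<lambda>x y. of_int x - \<theta> * of_int y)) \<le> H" for \<theta>
    proof -
      have "inj_on snd (bad (\<lambda>x y. of_int x - \<theta> * of_int y))"
      proof (rule inj_onI)
        fix a b assume ab: "a \<in> bad (\<lambda>x y. of_int x - \<theta> * of_int y)" "b \<in> bad (\<lambda>x y. of_int x - \<theta> * of_int y)" "snd a = snd b"
        have "(of_int (fst a - fst b) :: 'a) = 0" using ab by (simp add: bad_def)
        hence "int p dvd fst a - fst b" by (simp only: of_int_eq_0_iff)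
        moreover have "\<bar>fst a - fst b\<bar> < int p" using ab(1,2) Hp by (auto simp: bad_def S_def)
        ultimately have "fst a - fst b = 0" by (rule small_multiple_eq_0[rotated])
        thus "a = b" using ab(3) by (simp add: prod_eq_iff)
      qed
      hence "card (bad (\<lambda>x y. of_int x - \<theta> * of_int y)) \<le> card S"
        by (rule card_inj_on_le) (use fin in \<open>auto simp: bad_def\<close>)
      thus ?thesis by (simp add: cardS)
    qed
    from this[of \<theta>1] this[of \<theta>2] this[of \<theta>3]
    have b: "card (bad z1) \<le> H" "card (bad z2) \<le> H" "card (bad z3) \<le> H" by (simp_all add: z_defs[abs_def])
    have "S \<times> S \<subseteq> S' \<union> (bad z1 \<union> (bad z2 \<union> bad z3))" by (auto simp: S'_def bad_def)
    hence "card (S \<times> S) \<le> card (S' \<union> (bad z1 \<union> (bad z2 \<union> bad z3)))"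
      using fin by (intro card_mono) (auto simp: bad_def)
    also have "\<dots> \<le> card S' + (card (bad z1) + (card (bad z2) + card (bad z3)))"
      by (intro order.trans[OF card_Un_le] add_mono order.refl)
    also have "\<dots> \<le> card S' + 3 * H" using b by linarith
    finally have "real (H * H) \<le> real (card S' + 3 * H)" by (simp only: card_cartesian_product cardS of_nat_le_iff)
    moreover have "6 * real H \<le> real H * real H" using H by (intro mult_right_mono) auto
    ultimately show ?thesis by (simp add: power2_eq_square)
  qed
  have S'_pos: "real (card S') > 0" using cardS' H by (intro less_le_trans[OF _ cardS']) auto

  have shift: "W (x + int \<tau> * s) (y + int \<tau> * t) = \<chi> (z1 s t * z2 s t * z3 s t) * tchi (quo ((x, y), (s, t))) (of_nat \<tau>)"
    if "(x, y) \<in> I \<times> J" "(s, t) \<in> S'" for x y s t \<tau>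
  proof -
    have nz: "z1 s t \<noteq> 0" "z2 s t \<noteq> 0" "z3 s t \<noteq> 0" using that(2) by (auto simp: S'_def)
    have lin: "z (x + int \<tau> * s) (y + int \<tau> * t) = z s t * (z x y / z s t + of_nat \<tau>)"
      if "z s t \<noteq> 0" "\<And>x y. z x y = of_int x - \<theta> * of_int y"
      for z :: "int \<Rightarrow> int \<Rightarrow> 'a" and \<theta>
    proof -
      have "z s t * (z x y / z s t + of_nat \<tau>) = z x y + z s t * of_nat \<tau>" using that(1) by (simp add: distrib_left)
      also have "\<dots> = z (x + int \<tau> * s) (y + int \<tau> * t)" unfolding that(2) by (simp add: algebra_simps)
      finally show ?thesis ..
    qed
    have "z1 (x + int \<tau> * s) (y + int \<tau> * t) * z2 (x + int \<tau> * s) (y + int \<tau> * t) * z3 (x + int \<tau> * s) (y + int \<tau> * t) =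
      (z1 s t * z2 s t * z3 s t) * ((z1 x y / z1 s t + of_nat \<tau>) * (z2 x y / z2 s t + of_nat \<tau>) * (z3 x y / z3 s t + of_nat \<tau>))"
      unfolding lin[of z1, OF nz(1) z1_def] lin[of z2, OF nz(2) z2_def] lin[of z3, OF nz(3) z3_def]
      by (simp only: mult_ac)
    moreover have "(z1 x y / z1 s t, z2 x y / z2 s t, z3 x y / z3 s t) \<in> A"
      using quoA[of "((x, y), (s, t))"] that by (simp add: P_def quo_def)
    hence "(z1 x y / z1 s t + of_nat \<tau>) * (z2 x y / z2 s t + of_nat \<tau>) * (z3 x y / z3 s t + of_nat \<tau>) \<in> Fq 1"
      by (rule tri_prod_Fq[OF A _ Fq_of_nat])
    ultimately show ?thesis unfolding W_eq quo_def tchi_def prod.case by (simp only: chi_mult[OF nrm])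
  qed

  define M where "M = (\<Sum>x\<in>I. \<Sum>y\<in>J. W x y)"
  define Xs where "Xs = (\<Sum>v\<in>A. \<nu> v * u v)"
  define Y where "Y st \<tau> = (\<Sum>x\<in>I. \<Sum>y\<in>J. W (x + int \<tau> * fst st) (y + int \<tau> * snd st))" for st and \<tau> :: nat
  have Y_close: "cmod (M - Y st \<tau>) \<le> 4 * real N * real Q" if st: "st \<in> S'" and \<tau>: "\<tau> \<in> {1..T}" for st \<tau>
  proof -
    obtain s t where stt: "st = (int s, int t)" "s \<le> H" "t \<le> H"
    proof
      show "st = (int (nat (fst st)), int (nat (snd st)))" using st by (auto simp: S'_def S_def)
      show "nat (fst st) \<le> H" "nat (snd st) \<le> H" using st by (auto simp: S'_def S_def)
    qed
    have "\<tau> * s \<le> Q" "\<tau> * t \<le> Q" unfolding Q_def using \<tau> stt by (auto intro: mult_le_mono)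
    from box_shift_bound[of W, OF W1 N this, of m2 m1] show ?thesis
      by (simp add: M_def Y_def I_def J_def stt)
  qed
  have "cmod (\<Sum>st\<in>S'. \<Sum>\<tau>=1..T. Y st \<tau>) \<le> Xs"
  proof -
    have "(\<Sum>st\<in>S'. \<Sum>\<tau>=1..T. Y st \<tau>) = (\<Sum>st\<in>S'. \<Sum>xy\<in>I \<times> J. \<Sum>\<tau>=1..T. W (fst xy + int \<tau> * fst st) (snd xy + int \<tau> * snd st))"
    proof (rule sum.cong[OF refl])
      fix st
      have "Y st \<tau> = (\<Sum>xy\<in>I \<times> J. W (fst xy + int \<tau> * fst st) (snd xy + int \<tau> * snd st))" for \<tau>
        by (simp add: Y_def sum.cartesian_product case_prod_beta)
      thus "(\<Sum>\<tau>=1..T. Y st \<tau>) = (\<Sum>xy\<in>I \<times> J. \<Sum>\<tau>=1..T. W (fst xy + int \<tau> * fst st) (snd xy + int \<tau> * snd st))"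
        by (simp only:) (rule sum.swap)
    qed
    also have "\<dots> = (\<Sum>st\<in>S'. \<Sum>xy\<in>I \<times> J. \<chi> (z1 (fst st) (snd st) * z2 (fst st) (snd st) * z3 (fst st) (snd st)) *
        (\<Sum>\<tau>=1..T. tchi (quo (xy, st)) (of_nat \<tau>)))"
      unfolding sum_distrib_left
    proof (intro sum.cong refl)
      fix st xy \<tau> assume "st \<in> S'" "xy \<in> I \<times> J"
      thus "W (fst xy + int \<tau> * fst st) (snd xy + int \<tau> * snd st) =
         \<chi> (z1 (fst st) (snd st) * z2 (fst st) (snd st) * z3 (fst st) (snd st)) * tchi (quo (xy, st)) (of_nat \<tau>)"
        using shift[of "fst xy" "snd xy" "fst st" "snd st" \<tau>] by simp
    qed
    also have "cmod \<dots> \<le> (\<Sum>st\<in>S'. \<Sum>xy\<in>I \<times> J. u (quo (xy, st)))"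
    proof (intro sum_norm_le)
      fix st xy
      have "cmod (\<chi> (z1 (fst st) (snd st) * z2 (fst st) (snd st) * z3 (fst st) (snd st))) \<le> 1"
        by (rule norm_chi_le[OF nrm])
      from mult_right_mono[OF this, of "u (quo (xy, st))"]
      show "cmod (\<chi> (z1 (fst st) (snd st) * z2 (fst st) (snd st) * z3 (fst st) (snd st)) *
        (\<Sum>\<tau>=1..T. tchi (quo (xy, st)) (of_nat \<tau>))) \<le> u (quo (xy, st))"
        by (simp add: norm_mult u_def)
    qed
    also have "\<dots> = (\<Sum>b\<in>P. u (quo b))"
      unfolding P_def by (subst sum.swap) (simp add: sum.cartesian_product case_prod_beta)
    also have "\<dots> = (\<Sum>v\<in>A. \<Sum>b\<in>{b \<in> P. quo b = v}. u (quo b))"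
      by (rule sum.group[symmetric]) (use fin finA quoA in auto)
    also have "\<dots> = Xs" unfolding Xs_def \<nu>_def by (intro sum.cong refl) simp
    finally show ?thesis .
  qed
  hence main: "real (card S') * real T * cmod M \<le> real (card S') * real T * (4 * real N * real Q) + Xs"
  proof -
    have "of_nat (card S') * of_nat T * M = (\<Sum>st\<in>S'. \<Sum>\<tau>=1..T. M - Y st \<tau>) + (\<Sum>st\<in>S'. \<Sum>\<tau>=1..T. Y st \<tau>)"
      by (simp add: sum_subtractf mult.assoc)
    hence "cmod (of_nat (card S') * of_nat T * M) \<le> cmod (\<Sum>st\<in>S'. \<Sum>\<tau>=1..T. M - Y st \<tau>) + cmod (\<Sum>st\<in>S'. \<Sum>\<tau>=1..T. Y st \<tau>)"
      by (simp only: norm_triangle_ineq)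
    also have "cmod (\<Sum>st\<in>S'. \<Sum>\<tau>=1..T. M - Y st \<tau>) \<le> (\<Sum>st\<in>S'. \<Sum>\<tau>=1..T. 4 * real N * real Q)"
      by (intro sum_norm_le Y_close)
    also have "(\<Sum>st\<in>S'. \<Sum>\<tau>=1..T. 4 * real N * real Q) = real (card S') * real T * (4 * real N * real Q)"
      by (simp add: mult.assoc)
    finally show ?thesis using \<open>cmod (\<Sum>st\<in>S'. \<Sum>\<tau>=1..T. Y st \<tau>) \<le> Xs\<close> by (simp add: norm_mult)
  qed
  have sum_\<nu>: "(\<Sum>v\<in>A. \<nu> v) \<le> real N ^ 2 * real H ^ 2"
  proof -
    have "(\<Sum>v\<in>A. \<nu> v) = real (\<Sum>v\<in>A. \<Sum>b\<in>{b \<in> P. quo b = v}. 1)" by (simp add: \<nu>_def)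
    also have "(\<Sum>v\<in>A. \<Sum>b\<in>{b \<in> P. quo b = v}. 1) = (\<Sum>b\<in>P. 1::nat)"
      by (rule sum.group) (use fin finA quoA in auto)
    also have "\<dots> = N1 * N2 * card S'" by (simp add: P_def card_cartesian_product cardIJ)
    also have "\<dots> \<le> N * N * (H * H)"
    proof (intro mult_le_mono N)
      have "card S' \<le> card (S \<times> S)" using fin by (intro card_mono) (auto simp: S'_def)
      thus "card S' \<le> H * H" by (simp add: card_cartesian_product cardS)
    qed
    finally show ?thesis by (simp add: power2_eq_square)
  qed
  have sum_\<nu>2: "(\<Sum>v\<in>A. \<nu> v ^ 2) \<le> 9 * real N ^ 2 * real H ^ 2 * harmonic H"
  proof -
    define B where "B = (I \<times> J) \<times> (S \<times> S)"
    define E where "E = {(((x, y), (s, t)), ((x', y'), (s', t'))) \<in> B \<times> B.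
      int p dvd x * s' - x' * s \<and> int p dvd y * t' - y' * t \<and>
      int p dvd x * t' + y * s' - x' * t - y' * s}"
    have "(\<Sum>v\<in>A. \<nu> v ^ 2) = (\<Sum>v\<in>A. \<Sum>b\<in>{b \<in> P. quo b = v}. \<nu> (quo b))"
      by (intro sum.cong refl) (simp add: \<nu>_def power2_eq_square)
    also have "\<dots> = (\<Sum>b\<in>P. \<nu> (quo b))"
      by (rule sum.group) (use fin finA quoA in auto)
    also have "\<dots> = real (card (SIGMA b:P. {b' \<in> P. quo b' = quo b}))"
      using fin by (subst card_SigmaI) (auto simp: \<nu>_def)
    also have "card (SIGMA b:P. {b' \<in> P. quo b' = quo b}) \<le> card E"
    proof (rule card_mono)
      have "finite (B \<times> B)" using fin by (auto simp: B_def)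
      thus "finite E" by (rule finite_subset[rotated]) (auto simp: E_def)
      show "(SIGMA b:P. {b' \<in> P. quo b' = quo b}) \<subseteq> E"
      proof (rule subsetI)
        fix c assume c: "c \<in> (SIGMA b:P. {b' \<in> P. quo b' = quo b})"
        obtain x y s t x' y' s' t' where cc: "c = (((x, y), (s, t)), ((x', y'), (s', t')))" by (metis surj_pair)
        have mem: "(x, y) \<in> I \<times> J" "(x', y') \<in> I \<times> J" "(s, t) \<in> S'" "(s', t') \<in> S'"
          and q: "quo ((x', y'), (s', t')) = quo ((x, y), (s, t))"
          using c unfolding cc P_def by auto
        have nz: "z1 s t \<noteq> 0" "z2 s t \<noteq> 0" "z3 s t \<noteq> 0" "z1 s' t' \<noteq> 0" "z2 s' t' \<noteq> 0" "z3 s' t' \<noteq> 0"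
          using mem(3,4) by (auto simp: S'_def)
        \<comment> \<open>Up to the sign of \<open>c1\<close>, the coefficients of
          \<open>(x - y X) * (s' - t' X) - (x' - y' X) * (s - t X)\<close>. Equality of two
          quotients in the algebra means that this polynomial vanishes at all three roots.\<close>
        define c0 c1 c2 where "c0 = (of_int (x * s' - x' * s) :: 'a)" and
          "c1 = (of_int (x * t' + y * s' - x' * t - y' * s) :: 'a)" and "c2 = (of_int (y * t' - y' * t) :: 'a)"
        have ex: "c0 - \<theta> * c1 + \<theta> * \<theta> * c2 = (of_int x - \<theta> * of_int y) * (of_int s' - \<theta> * of_int t') -
           (of_int x' - \<theta> * of_int y') * (of_int s - \<theta> * of_int t)" for \<theta>
          by (simp add: c0_def c1_def c2_def algebra_simps)
        have "z1 x' y' / z1 s' t' = z1 x y / z1 s t" "z2 x' y' / z2 s' t' = z2 x y / z2 s t" "z3 x' y' / z3 s' t' = z3 x y / z3 s t"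
          using q by (simp_all add: quo_def)
        hence "z1 x y * z1 s' t' = z1 x' y' * z1 s t" "z2 x y * z2 s' t' = z2 x' y' * z2 s t" "z3 x y * z3 s' t' = z3 x' y' * z3 s t"
          using nz by (simp_all add: frac_eq_eq)
        hence "c0 - \<theta>1 * c1 + \<theta>1 * \<theta>1 * c2 = 0" "c0 - \<theta>2 * c1 + \<theta>2 * \<theta>2 * c2 = 0" "c0 - \<theta>3 * c1 + \<theta>3 * \<theta>3 * c2 = 0"
          unfolding ex z_defs by simp_all
        from quadratic_three_zeros[OF this \<theta>] have "c0 = 0" "c1 = 0" "c2 = 0" by auto
        hence "int p dvd x * s' - x' * s" "int p dvd x * t' + y * s' - x' * t - y' * s" "int p dvd y * t' - y' * t"
          unfolding c0_def c1_def c2_def of_int_eq_0_iff .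
        thus "c \<in> E" using mem unfolding cc E_def B_def by (auto simp: S'_def)
      qed
    qed
    also have "real (card E) \<le> 9 * real N ^ 2 * real H ^ 2 * harmonic H"
      unfolding E_def B_def S_def
      by (rule energy_bound[OF prime_p, of I m1 N J m2 H]) (use N H NH in \<open>auto simp: I_def J_def\<close>)
    finally show ?thesis by simp
  qed
  have sum_u: "(\<Sum>v\<in>A. u v ^ (2 * k)) \<le> real T ^ k * real k ^ (2 * k) * real p ^ 3 + real T ^ (2 * k) * (real (2 * k) ^ 3 * sqrt (real p) ^ 3)"
    unfolding u_def by (rule moment_bound[OF A _ T(2)]) (simp add: k)
  have X0: "Xs \<ge> 0" unfolding Xs_def \<nu>_def u_def by (intro sum_nonneg mult_nonneg_nonneg) auto
  have \<nu>0: "\<nu> v \<ge> 0" and u0: "u v \<ge> 0" for v by (simp_all add: \<nu>_def u_def)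
  have "Xs ^ (2 * k) \<le> (\<Sum>v\<in>A. \<nu> v) ^ (2 * k - 2) * ((\<Sum>v\<in>A. \<nu> v ^ 2) * (\<Sum>v\<in>A. u v ^ (2 * k)))"
    unfolding Xs_def by (rule weighted_hoelder[OF \<nu>0 u0 k])
  also have "\<dots> \<le> (real N ^ 2 * real H ^ 2) ^ (2 * k - 2) * ((9 * real N ^ 2 * real H ^ 2 * harmonic H) *
       (real T ^ k * real k ^ (2 * k) * real p ^ 3 + real T ^ (2 * k) * (real (2 * k) ^ 3 * sqrt (real p) ^ 3)))"
    using harmonic_ge_1[of H] H
    by (intro mult_mono power_mono sum_\<nu> sum_\<nu>2 sum_u sum_nonneg mult_nonneg_nonneg zero_le_power add_nonneg_nonneg \<nu>0 u0) auto
  finally have X_le: "Xs ^ (2 * k) \<le> (real N ^ 2 * real H ^ 2) ^ (2 * k - 2) * ((9 * real N ^ 2 * real H ^ 2 * harmonic H) *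
       (real T ^ k * real k ^ (2 * k) * real p ^ 3 + real T ^ (2 * k) * (real (2 * k) ^ 3 * sqrt (real p) ^ 3)))" .
  define D where "D = real (card S') * real T"
  have D0: "D > 0" using S'_pos T by (simp add: D_def)
  \<comment> \<open>The average of the shifted sums is at most \<open>Z\<close>. The lower bound for
    \<open>card S'\<close> is used only when \<open>D\<close> is replaced by an explicit
    quantity.\<close>
  define Z where "Z = Xs / D"
  have "cmod M \<le> 4 * real N * real Q + Z"
  proof -
    have "D * cmod M \<le> D * (4 * real N * real Q + Z)"
      using main D0 unfolding D_def[symmetric] Z_def by (simp add: distrib_left)
    thus ?thesis using D0 by simp
  qed
  moreover have Z0: "Z \<ge> 0" using X0 D0 by (simp add: Z_def)
  moreover have "(real T * real H ^ 2 / 2 * Z) ^ (2 * k) \<le> Xs ^ (2 * k)"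
  proof (rule power_mono)
    have "real T * real H ^ 2 / 2 * Z \<le> D * Z"
      using mult_left_mono[OF cardS', of "real T"] Z0 by (intro mult_right_mono) (auto simp: D_def mult.commute)
    thus "real T * real H ^ 2 / 2 * Z \<le> Xs" using D0 by (simp add: Z_def)
  qed (use Z0 in auto)
  ultimately show ?thesis using X_le unfolding M_def I_def J_def Q_def by (intro exI[of _ Z]) auto
qed

end

section \<open>Cubic forms over arbitrary prime fields\<close>

definition int_character :: "nat \<Rightarrow> (int \<Rightarrow> complex) \<Rightarrow> bool" where
  "int_character p \<chi> \<longleftrightarrow> \<chi> 0 = 0 \<and> (\<forall>x\<in>{1..<int p}. \<chi> x \<noteq> 0) \<and>
     (\<forall>x\<in>{1..<int p}. \<forall>y\<in>{1..<int p}. \<chi> (x * y mod int p) = \<chi> x * \<chi> y) \<and>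
     (\<exists>x\<in>{1..<int p}. \<chi> x \<noteq> 1)"

text \<open>The congruences say that the cubic is \<open>(X - r) ^ 2 * (X - s)\<close> modulo
  \<open>p\<close>. Being a statement about integers, this links two different algebraic closures:
  the one in the definition of nondegeneracy and the type in which the character sums are
  estimated.\<close>

definition no_double_root :: "nat \<Rightarrow> int \<Rightarrow> int \<Rightarrow> int \<Rightarrow> bool" where
  "no_double_root p a b c \<longleftrightarrow> \<not> (\<exists>r s. [a = - (2 * r + s)] (mod int p) \<and>
     [b = r * r + 2 * r * s] (mod int p) \<and> [c = - (r * r * s)] (mod int p))"

text \<open>Only integers, reals and complex numbers occur, so the property depends on the number
  \<open>p\<close> and not on a type of characteristic \<open>p\<close>.\<close>

definition cubic_bound_holds :: "nat \<Rightarrow> bool" where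
  "cubic_bound_holds p \<longleftrightarrow> (\<forall>\<chi> a b c m1 m2 N1 N2 N H T k r.
     int_character p \<chi> \<longrightarrow> no_double_root p a b c \<longrightarrow> N1 \<le> N \<longrightarrow> N2 \<le> N \<longrightarrow> 6 \<le> H \<longrightarrow> H \<le> N \<longrightarrow>
     2 * N * H \<le> p \<longrightarrow> 0 < T \<longrightarrow> T < p \<longrightarrow> k = 2 ^ r \<longrightarrow>
     (\<exists>Z\<ge>0. cmod (\<Sum>x\<in>{m1..<m1 + int N1}. \<Sum>y\<in>{m2..<m2 + int N2}.
          \<chi> ((x ^ 3 + a * x ^ 2 * y + b * x * y ^ 2 + c * y ^ 3) mod int p)) \<le> 4 * real N * real (T * H) + Z \<and>
      (real T * real H ^ 2 / 2 * Z) ^ (2 * k) \<le>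
      (real N ^ 2 * real H ^ 2) ^ (2 * k - 2) * ((9 * real N ^ 2 * real H ^ 2 * harmonic H) *
       (real T ^ k * real k ^ (2 * k) * real p ^ 3 + real T ^ (2 * k) * (real (2 * k) ^ 3 * sqrt (real p) ^ 3)))))"

context closed_char_p
begin

lemma of_int_eq_iff_cong: "(of_int a :: 'a) = of_int b \<longleftrightarrow> [a = b] (mod int p)"
  using of_int_eq_0_iff_char_dvd[where ?'a = 'a, of "a - b"] CHAR_eq by (simp add: cong_iff_dvd_diff)

lemma Fq_1_of_int: "z \<in> Fq 1 \<Longrightarrow> \<exists>r. z = of_int r"
  unfolding Fq_1_eq by (auto intro: exI[of _ "int _"])

definition lift_residue :: "'a \<Rightarrow> int" where "lift_residue z = (THE x. x \<in> {0..<int p} \<and> of_int x = z)"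

lemma lift_residue_of_int: "lift_residue (of_int x) = x mod int p"
  unfolding lift_residue_def
proof (rule the_equality)
  show "x mod int p \<in> {0..<int p} \<and> (of_int (x mod int p) :: 'a) = of_int x"
    using p_pos by (auto simp: of_int_eq_iff_cong cong_def)
  fix y assume "y \<in> {0..<int p} \<and> (of_int y :: 'a) = of_int x"
  thus "y = x mod int p" by (auto simp: of_int_eq_iff_cong cong_def)
qed

lemma int_character_lift:
  assumes "int_character p \<chi>"
  shows "prime_field_character p (\<lambda>z. \<chi> (lift_residue z))"
proof -
  have 0: "x mod int p = 0 \<longleftrightarrow> (of_int x :: 'a) = 0" for x
    using of_int_eq_iff_cong[of x 0] by (simp add: cong_def)
  have range: "x mod int p \<in> {1..<int p}" if "(of_int x :: 'a) \<noteq> 0" for x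
  proof -
    have "x mod int p \<noteq> 0" using that 0 by simp
    moreover have "0 \<le> x mod int p" "x mod int p < int p" using p_pos by auto
    ultimately show ?thesis by auto
  qed
  show ?thesis
  proof unfold_locales
    show "\<chi> (lift_residue 0) = 0" using lift_residue_of_int[of 0] assms by (simp add: int_character_def)
  next
    fix z assume z: "z \<in> Fq 1" "z \<noteq> 0"
    obtain x where "z = of_int x" using Fq_1_of_int[OF z(1)] by blast
    thus "\<chi> (lift_residue z) \<noteq> 0" using assms range[of x] z by (simp add: lift_residue_of_int int_character_def)
  next
    fix z w assume z: "z \<in> Fq 1" "w \<in> Fq 1"
    obtain x y where xy: "z = of_int x" "w = of_int y" using Fq_1_of_int[OF z(1)] Fq_1_of_int[OF z(2)] by blast
    have zw: "lift_residue (z * w) = (x mod int p) * (y mod int p) mod int p"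
      using lift_residue_of_int[of "x * y"] by (simp add: xy mod_mult_eq)
    show "\<chi> (lift_residue (z * w)) = \<chi> (lift_residue z) * \<chi> (lift_residue w)"
    proof (cases "z = 0 \<or> w = 0")
      case True
      moreover have "\<chi> (lift_residue 0) = 0"
        using lift_residue_of_int[of 0] assms by (simp add: int_character_def)
      ultimately show ?thesis by (elim disjE) simp_all
    next
      case False
      thus ?thesis unfolding zw using assms range[of x] range[of y]
        by (simp add: xy lift_residue_of_int int_character_def)
    qed
  next
    obtain x where x: "x \<in> {1..<int p}" "\<chi> x \<noteq> 1" using assms by (auto simp: int_character_def)
    have "x mod int p = x" using x by simp
    moreover from this have "(of_int x :: 'a) \<noteq> 0" using x 0[of x] by auto
    ultimately show "\<exists>b\<in>Fq 1. b \<noteq> 0 \<and> \<chi> (lift_residue b) \<noteq> 1"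
      using x by (intro bexI[of _ "of_int x"]) (auto simp: lift_residue_of_int)
  qed
qed

definition cubic_of :: "int \<Rightarrow> int \<Rightarrow> int \<Rightarrow> 'a poly" where
  "cubic_of a b c = [:of_int c, of_int b, of_int a, 1:]"

text \<open>Frobenius maps \<theta> to a common root of the cubic and its derivative
  \<open>G\<close>. If it were not \<theta> it would be \<theta>', and the formula for
  \<open>G\<close> then forces \<theta>' = \<theta>, a contradiction. So \<theta> lies in the prime
  field; the argument also covers characteristics 2 and 3.\<close>

lemma double_root_rational:
  fixes \<theta> \<theta>' :: 'a
  assumes F: "cubic_of a b c = [:-\<theta>, 1:] * ([:-\<theta>, 1:] * [:-\<theta>', 1:])"
  shows "\<not> no_double_root p a b c"
proof -
  have coeffs: "of_int a = - (2 * \<theta> + \<theta>')" "of_int b = \<theta> * \<theta> + 2 * \<theta> * \<theta>'" "of_int c = - (\<theta> * \<theta> * \<theta>')"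
  proof -
    have "[:-\<theta>, 1:] * ([:-\<theta>, 1:] * [:-\<theta>', 1:]) =
        [:- (\<theta> * \<theta> * \<theta>'), \<theta> * \<theta> + 2 * \<theta> * \<theta>', - (2 * \<theta> + \<theta>'), 1:]"
      by (simp add: algebra_simps)
    from F[unfolded this cubic_of_def] show "of_int a = - (2 * \<theta> + \<theta>')"
      "of_int b = \<theta> * \<theta> + 2 * \<theta> * \<theta>'" "of_int c = - (\<theta> * \<theta> * \<theta>')"
      unfolding pCons_eq_iff by blast+
  qed
  define G where "G = [:of_int b, 2 * of_int a, 3 :: 'a:]"
  have Pol: "cubic_of a b c \<in> Pol" "G \<in> Pol"
  proof -
    have "(2 :: 'a) * of_int a \<in> Fq 1" "(3 :: 'a) \<in> Fq 1"
      using Fq_of_int[of "2 * a" 1] Fq_of_int[of 3 1] by simp_all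
    thus "cubic_of a b c \<in> Pol" "G \<in> Pol" unfolding cubic_of_def G_def Pol_def
      by (auto simp: coeff_pCons split: nat.splits)
  qed
  have Gx: "poly G x = (x - \<theta>) * (2 * (x - \<theta>') + (x - \<theta>))" for x
    by (simp add: G_def coeffs algebra_simps)
  have Fx: "poly (cubic_of a b c) x = (x - \<theta>) * ((x - \<theta>) * (x - \<theta>'))" for x
    unfolding F poly_mult by simp
  have "poly G (\<theta> ^ p) = 0" "poly (cubic_of a b c) (\<theta> ^ p) = 0"
    using poly_frob[OF Pol(1), of \<theta> 1] poly_frob[OF Pol(2), of \<theta> 1] p_pos by (auto simp: Gx Fx power_0_left)
  hence "\<theta> ^ p = \<theta>" unfolding Gx Fx by auto
  hence \<theta>: "\<theta> \<in> Fq 1" by (simp add: Fq_def)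
  have "\<theta>' = - of_int a - of_int 2 * \<theta>" using coeffs(1) by simp
  hence \<theta>': "\<theta>' \<in> Fq 1" using \<theta> by (auto simp del: of_int_numeral)
  obtain r s where rs: "\<theta> = of_int r" "\<theta>' = of_int s" using Fq_1_of_int[OF \<theta>] Fq_1_of_int[OF \<theta>'] by blast
  have "(of_int a :: 'a) = of_int (- (2 * r + s))" "(of_int b :: 'a) = of_int (r * r + 2 * r * s)" "(of_int c :: 'a) = of_int (- (r * r * s))"
    using coeffs by (simp_all add: rs)
  thus ?thesis unfolding no_double_root_def of_int_eq_iff_cong by blast
qed

text \<open>A permutation of three elements is the identity, a transposition or a 3-cycle, and
  relabelling gives each type a normal form.\<close>

lemma frobenius_orbit_types:
  fixes x1 x2 x3 :: 'a
  assumes d: "x1 \<noteq> x2" "x1 \<noteq> x3" "x2 \<noteq> x3"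
    and f: "x1 ^ p \<in> {x1, x2, x3}" "x2 ^ p \<in> {x1, x2, x3}" "x3 ^ p \<in> {x1, x2, x3}"
  shows "\<exists>y1 y2 y3. {y1, y2, y3} = {x1, x2, x3} \<and> y1 \<noteq> y2 \<and> y1 \<noteq> y3 \<and> y2 \<noteq> y3 \<and>
    (y1 ^ p = y1 \<and> y2 ^ p = y2 \<and> y3 ^ p = y3 \<or> y1 ^ p = y2 \<and> y2 ^ p = y1 \<and> y3 ^ p = y3 \<or>
     y1 ^ p = y2 \<and> y2 ^ p = y3 \<and> y3 ^ p = y1)" (is "\<exists>y1 y2 y3. ?P y1 y2 y3")
proof -
  have inj: "x1 ^ p \<noteq> x2 ^ p" "x1 ^ p \<noteq> x3 ^ p" "x2 ^ p \<noteq> x3 ^ p"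
    using d frob_inj[of _ 1] by simp_all
  consider "x1 ^ p = x1" "x2 ^ p = x2" "x3 ^ p = x3" | "x1 ^ p = x1" "x2 ^ p = x3" "x3 ^ p = x2"
    | "x1 ^ p = x2" "x2 ^ p = x1" "x3 ^ p = x3" | "x1 ^ p = x3" "x2 ^ p = x2" "x3 ^ p = x1"
    | "x1 ^ p = x2" "x2 ^ p = x3" "x3 ^ p = x1" | "x1 ^ p = x3" "x3 ^ p = x2" "x2 ^ p = x1"
    using f inj unfolding insert_iff empty_iff by (smt (verit))
  thus ?thesis
  proof cases
    case 1 hence "?P x1 x2 x3" using d by auto thus ?thesis by blast
  next
    case 2 hence "?P x2 x3 x1" using d by auto thus ?thesis by blast
  next
    case 3 hence "?P x1 x2 x3" using d by auto thus ?thesis by blast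
  next
    case 4 hence "?P x1 x3 x2" using d by auto thus ?thesis by blast
  next
    case 5 hence "?P x1 x2 x3" using d by auto thus ?thesis by blast
  next
    case 6 hence "?P x1 x3 x2" using d by auto thus ?thesis by blast
  qed
qed

lemma cubic_roots:
  assumes nd: "no_double_root p a b c"
  shows "\<exists>\<theta>1 \<theta>2 \<theta>3. \<theta>1 \<noteq> \<theta>2 \<and> \<theta>1 \<noteq> \<theta>3 \<and> \<theta>2 \<noteq> \<theta>3 \<and>
    cubic_of a b c = [:-\<theta>1, 1:] * ([:-\<theta>2, 1:] * [:-\<theta>3, 1:]) \<and>
    (\<theta>1 ^ p = \<theta>1 \<and> \<theta>2 ^ p = \<theta>2 \<and> \<theta>3 ^ p = \<theta>3 \<or> \<theta>1 ^ p = \<theta>2 \<and> \<theta>2 ^ p = \<theta>1 \<and> \<theta>3 ^ p = \<theta>3 \<or>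
     \<theta>1 ^ p = \<theta>2 \<and> \<theta>2 ^ p = \<theta>3 \<and> \<theta>3 ^ p = \<theta>1)"
proof -
  have deg: "degree (cubic_of a b c) = 3" and nz: "cubic_of a b c \<noteq> 0" and lc: "lead_coeff (cubic_of a b c) = 1"
    by (simp_all add: cubic_of_def)
  obtain A where A: "size A = 3" "cubic_of a b c = (\<Prod>x\<in>#A. [:-x, 1:])"
    using alg_closed_imp_factorization[OF nz] deg lc by auto
  obtain x1 A1 where 1: "A = add_mset x1 A1" "size A1 = 2" using A(1) size_eq_Suc_imp_eq_union[of A 2] by auto
  obtain x2 A2 where 2: "A1 = add_mset x2 A2" "size A2 = 1" using 1(2) size_eq_Suc_imp_eq_union[of A1 1] by auto
  obtain x3 where 3: "A2 = {#x3#}" using 2(2) size_1_singleton_mset by blast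
  have F: "cubic_of a b c = [:-x1, 1:] * ([:-x2, 1:] * [:-x3, 1:])"
    unfolding A(2) 1(1) 2(1) 3 by (simp only: image_mset_add_mset prod_mset.add_mset image_mset_empty prod_mset_empty mult_1_right)
  have perm: "[:-x1, 1:] * ([:-x2, 1:] * [:-x3, 1:]) = [:-x1, 1:] * ([:-x3, 1:] * [:-x2, 1:])"
    "[:-x1, 1:] * ([:-x2, 1:] * [:-x3, 1:]) = [:-x2, 1:] * ([:-x3, 1:] * [:-x1, 1:])"
    by (simp_all only: mult_ac)
  have d: "x1 \<noteq> x2" "x1 \<noteq> x3" "x2 \<noteq> x3"
  proof -
    show "x1 \<noteq> x2" using double_root_rational[of a b c x1 x3] F nd by blast
    show "x1 \<noteq> x3" using double_root_rational[of a b c x1 x2] F[unfolded perm(1)] nd by blast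
    show "x2 \<noteq> x3" using double_root_rational[of a b c x2 x1] F[unfolded perm(2)] nd by blast
  qed
  have Pol: "cubic_of a b c \<in> Pol" unfolding cubic_of_def Pol_def
    by (auto simp: coeff_pCons split: nat.splits)
  have rts: "poly (cubic_of a b c) x = 0 \<longleftrightarrow> x \<in> {x1, x2, x3}" for x
    unfolding F poly_mult by auto
  have f: "x ^ p \<in> {x1, x2, x3}" if "x \<in> {x1, x2, x3}" for x
    using that p_pos unfolding rts[symmetric] using poly_frob[OF Pol, of x 1] by (auto simp: power_0_left)
  \<comment> \<open>As a product over the set of roots the cubic does not depend on their
    labelling.\<close>
  have Fs: "cubic_of a b c = (\<Prod>t\<in>{x1, x2, x3}. [:-t, 1:])" unfolding F using d by (simp del: mult_pCons_left mult_pCons_right)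
  obtain y1 y2 y3 where y: "{y1, y2, y3} = {x1, x2, x3}" "y1 \<noteq> y2" "y1 \<noteq> y3" "y2 \<noteq> y3"
    "y1 ^ p = y1 \<and> y2 ^ p = y2 \<and> y3 ^ p = y3 \<or> y1 ^ p = y2 \<and> y2 ^ p = y1 \<and> y3 ^ p = y3 \<or>
     y1 ^ p = y2 \<and> y2 ^ p = y3 \<and> y3 ^ p = y1"
    using frobenius_orbit_types[OF d f f f] by auto
  have "cubic_of a b c = [:-y1, 1:] * ([:-y2, 1:] * [:-y3, 1:])"
    unfolding Fs y(1)[symmetric] using y(2-4) by (simp del: mult_pCons_left mult_pCons_right)
  thus ?thesis using y(2-5) by blast
qed

theorem cubic_bound: "cubic_bound_holds p"
  unfolding cubic_bound_holds_def
proof (intro allI impI)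
  fix \<chi> a b c m1 m2 and N1 N2 N H T k r :: nat
  assume \<chi>: "int_character p \<chi>" and nd: "no_double_root p a b c"
    and N: "N1 \<le> N" "N2 \<le> N" and H: "6 \<le> H" "H \<le> N" and NH: "2 * N * H \<le> p" and T: "0 < T" "T < p" and k: "k = 2 ^ r"
  interpret C: prime_field_character p K "\<lambda>z. \<chi> (lift_residue z)" by (rule int_character_lift[OF \<chi>])
  obtain \<theta>1 \<theta>2 \<theta>3 where \<theta>: "\<theta>1 \<noteq> \<theta>2" "\<theta>1 \<noteq> \<theta>3" "\<theta>2 \<noteq> \<theta>3"
    and F: "cubic_of a b c = [:-\<theta>1, 1:] * ([:-\<theta>2, 1:] * [:-\<theta>3, 1:])"
    and ty: "\<theta>1 ^ p = \<theta>1 \<and> \<theta>2 ^ p = \<theta>2 \<and> \<theta>3 ^ p = \<theta>3 \<or> \<theta>1 ^ p = \<theta>2 \<and> \<theta>2 ^ p = \<theta>1 \<and> \<theta>3 ^ p = \<theta>3 \<or>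
     \<theta>1 ^ p = \<theta>2 \<and> \<theta>2 ^ p = \<theta>3 \<and> \<theta>3 ^ p = \<theta>1"
    using cubic_roots[OF nd] by blast
  have coeffs: "of_int a = - (\<theta>1 + \<theta>2 + \<theta>3)" "of_int b = \<theta>1 * \<theta>2 + \<theta>1 * \<theta>3 + \<theta>2 * \<theta>3" "of_int c = - (\<theta>1 * \<theta>2 * \<theta>3)"
  proof -
    have "[:-\<theta>1, 1:] * ([:-\<theta>2, 1:] * [:-\<theta>3, 1:]) =
        [:- (\<theta>1 * \<theta>2 * \<theta>3), \<theta>1 * \<theta>2 + \<theta>1 * \<theta>3 + \<theta>2 * \<theta>3, - (\<theta>1 + \<theta>2 + \<theta>3), 1:]"
      by (simp add: algebra_simps)
    from F[unfolded this cubic_of_def] show "of_int a = - (\<theta>1 + \<theta>2 + \<theta>3)"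
      "of_int b = \<theta>1 * \<theta>2 + \<theta>1 * \<theta>3 + \<theta>2 * \<theta>3" "of_int c = - (\<theta>1 * \<theta>2 * \<theta>3)"
      unfolding pCons_eq_iff by blast+
  qed
  have form: "(of_int x - \<theta>1 * of_int y) * (of_int x - \<theta>2 * of_int y) * (of_int x - \<theta>3 * of_int y) =
      of_int (x ^ 3 + a * x ^ 2 * y + b * x * y ^ 2 + c * y ^ 3)" for x y
    by (simp add: coeffs power2_eq_square power3_eq_cube algebra_simps)
  have fr: "(x - \<theta> * y) ^ p = x - \<theta> ^ p * y" if "x \<in> Fq 1" "y \<in> Fq 1" for x y \<theta>
    using that frob_diff[of x "\<theta> * y" 1] by (simp add: Fq_def power_mult_distrib)
  have norm_Fq: "(x - \<theta>1 * y) * (x - \<theta>2 * y) * (x - \<theta>3 * y) \<in> Fq 1" if "x \<in> Fq 1" "y \<in> Fq 1" for x y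
  proof -
    have "((x - \<theta>1 * y) * (x - \<theta>2 * y) * (x - \<theta>3 * y)) ^ p = (x - \<theta>1 ^ p * y) * (x - \<theta>2 ^ p * y) * (x - \<theta>3 ^ p * y)"
      by (simp only: power_mult_distrib fr[OF that])
    also have "\<dots> = (x - \<theta>1 * y) * (x - \<theta>2 * y) * (x - \<theta>3 * y)"
      using ty by (elim disjE conjE) (simp_all only: mult_ac)
    finally show ?thesis by (simp add: Fq_def)
  qed
  have quot_frob: "((x - \<theta> * y) / (s - \<theta> * t)) ^ p = (x - \<theta> ^ p * y) / (s - \<theta> ^ p * t)"
    if "x \<in> Fq 1" "y \<in> Fq 1" "s \<in> Fq 1" "t \<in> Fq 1" for x y s t \<theta>
    using that by (simp only: power_divide fr)
  have "\<exists>A\<in>tri_types. \<forall>x\<in>Fq 1. \<forall>y\<in>Fq 1. \<forall>s\<in>Fq 1. \<forall>t\<in>Fq 1.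
       ((x - \<theta>1 * y) / (s - \<theta>1 * t), (x - \<theta>2 * y) / (s - \<theta>2 * t), (x - \<theta>3 * y) / (s - \<theta>3 * t)) \<in> A"
    using ty
  proof (elim disjE conjE)
    assume t: "\<theta>1 ^ p = \<theta>1" "\<theta>2 ^ p = \<theta>2" "\<theta>3 ^ p = \<theta>3"
    hence "\<theta>1 \<in> Fq 1" "\<theta>2 \<in> Fq 1" "\<theta>3 \<in> Fq 1" by (simp_all add: Fq_def)
    hence "\<forall>x\<in>Fq 1. \<forall>y\<in>Fq 1. \<forall>s\<in>Fq 1. \<forall>t\<in>Fq 1.
       ((x - \<theta>1 * y) / (s - \<theta>1 * t), (x - \<theta>2 * y) / (s - \<theta>2 * t), (x - \<theta>3 * y) / (s - \<theta>3 * t)) \<in> tri_split"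
      unfolding tri_split_def by (intro ballI SigmaI Fq_intros)
    thus ?thesis by (intro bexI[of _ tri_split]) (auto simp: tri_types_def)
  next
    assume t: "\<theta>1 ^ p = \<theta>2" "\<theta>2 ^ p = \<theta>1" "\<theta>3 ^ p = \<theta>3"
    have "((x - \<theta>1 * y) / (s - \<theta>1 * t), (x - \<theta>2 * y) / (s - \<theta>2 * t), (x - \<theta>3 * y) / (s - \<theta>3 * t)) \<in> tri_mixed"
      if m: "x \<in> Fq 1" "y \<in> Fq 1" "s \<in> Fq 1" "t \<in> Fq 1" for x y s t
    proof -
      define v u where "v = (x - \<theta>1 * y) / (s - \<theta>1 * t)" and "u = (x - \<theta>3 * y) / (s - \<theta>3 * t)"
      have v: "v ^ p = (x - \<theta>2 * y) / (s - \<theta>2 * t)" unfolding v_def quot_frob[OF m] t ..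
      have "(v ^ p) ^ p = v" unfolding v quot_frob[OF m] t by (simp add: v_def)
      hence "v \<in> Fq 2" by (simp add: Fq_def power2_eq_square power_mult)
      moreover have "u ^ p = u" unfolding u_def quot_frob[OF m] t ..
      hence "u \<in> Fq 1" by (simp add: Fq_def)
      ultimately show ?thesis unfolding tri_mixed_def v_def[symmetric] u_def[symmetric] v[symmetric]
        by (intro image_eqI[of _ _ "(v, u)"]) auto
    qed
    thus ?thesis by (intro bexI[of _ tri_mixed]) (auto simp: tri_types_def)
  next
    assume t: "\<theta>1 ^ p = \<theta>2" "\<theta>2 ^ p = \<theta>3" "\<theta>3 ^ p = \<theta>1"
    have "((x - \<theta>1 * y) / (s - \<theta>1 * t), (x - \<theta>2 * y) / (s - \<theta>2 * t), (x - \<theta>3 * y) / (s - \<theta>3 * t)) \<in> tri_cubic"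
      if m: "x \<in> Fq 1" "y \<in> Fq 1" "s \<in> Fq 1" "t \<in> Fq 1" for x y s t
    proof -
      define v where "v = (x - \<theta>1 * y) / (s - \<theta>1 * t)"
      have v: "v ^ p = (x - \<theta>2 * y) / (s - \<theta>2 * t)" unfolding v_def quot_frob[OF m] t ..
      have v2: "(v ^ p) ^ p = (x - \<theta>3 * y) / (s - \<theta>3 * t)" unfolding v quot_frob[OF m] t ..
      have "((v ^ p) ^ p) ^ p = v" unfolding v2 quot_frob[OF m] t by (simp add: v_def)
      hence "v \<in> Fq 3" by (simp add: Fq_def power3_eq_cube power_mult)
      thus ?thesis unfolding tri_cubic_def v_def[symmetric] v2[symmetric] v[symmetric] by blast
    qed
    thus ?thesis by (intro bexI[of _ tri_cubic]) (auto simp: tri_types_def)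
  qed
  then obtain A where A: "A \<in> tri_types" "\<And>x y s t. x \<in> Fq 1 \<Longrightarrow> y \<in> Fq 1 \<Longrightarrow> s \<in> Fq 1 \<Longrightarrow> t \<in> Fq 1 \<Longrightarrow>
       ((x - \<theta>1 * y) / (s - \<theta>1 * t), (x - \<theta>2 * y) / (s - \<theta>2 * t), (x - \<theta>3 * y) / (s - \<theta>3 * t)) \<in> A"
    by blast
  have quot_A: "((x - \<theta>1 * y) / (s - \<theta>1 * t), (x - \<theta>2 * y) / (s - \<theta>2 * t), (x - \<theta>3 * y) / (s - \<theta>3 * t)) \<in> A"
    if "x \<in> Fq 1" "y \<in> Fq 1" "s \<in> Fq 1" "t \<in> Fq 1" "s - \<theta>1 * t \<noteq> 0" "s - \<theta>2 * t \<noteq> 0" "s - \<theta>3 * t \<noteq> 0" for x y s t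
    by (rule A(2)[OF that(1-4)])
  show "\<exists>Z\<ge>0. cmod (\<Sum>x\<in>{m1..<m1 + int N1}. \<Sum>y\<in>{m2..<m2 + int N2}.
          \<chi> ((x ^ 3 + a * x ^ 2 * y + b * x * y ^ 2 + c * y ^ 3) mod int p)) \<le> 4 * real N * real (T * H) + Z \<and>
      (real T * real H ^ 2 / 2 * Z) ^ (2 * k) \<le>
      (real N ^ 2 * real H ^ 2) ^ (2 * k - 2) * ((9 * real N ^ 2 * real H ^ 2 * harmonic H) *
       (real T ^ k * real k ^ (2 * k) * real p ^ 3 + real T ^ (2 * k) * (real (2 * k) ^ 3 * sqrt (real p) ^ 3)))"
    using C.burgess_inequality[OF \<theta> A(1) norm_Fq quot_A N H NH T k, of m2 m1] unfolding form lift_residue_of_int .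
qed

end

text \<open>The argument above lives in a type of characteristic \<open>p\<close>, whereas \<open>p\<close> is a bound variable of
  the theorem.  Let \<open>bad_field\<close> have \<open>bad_prime\<close> elements, where \<open>bad_prime\<close> violates the bound if
  any prime does; the bound holds in the algebraic closure of \<open>bad_field\<close>, hence for all primes.\<close>

definition bad_prime :: nat where
  "bad_prime = (SOME p. prime p \<and> ((\<exists>q. prime q \<and> \<not> cubic_bound_holds q) \<longrightarrow> \<not> cubic_bound_holds p))"
lemma bad_prime: "prime bad_prime" "prime q \<Longrightarrow> \<not> cubic_bound_holds q \<Longrightarrow> \<not> cubic_bound_holds bad_prime"
proof -
  have "\<exists>p::nat. prime p \<and> ((\<exists>q. prime q \<and> \<not> cubic_bound_holds q) \<longrightarrow> \<not> cubic_bound_holds p)"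
    \<comment> \<open>If no prime violates the bound, any prime qualifies, for example 2.\<close>
    using two_is_prime_nat by blast
  from someI_ex[OF this] show "prime bad_prime" "prime q \<Longrightarrow> \<not> cubic_bound_holds q \<Longrightarrow> \<not> cubic_bound_holds bad_prime"
    unfolding bad_prime_def[symmetric] by blast+
qed

typedef bad_field = "{0..<int bad_prime}"
  using bad_prime(1) by (intro exI[of _ 0]) (auto simp: prime_gt_0_nat)
setup_lifting type_definition_bad_field

instantiation bad_field :: comm_ring_1
begin
lift_definition zero_bad_field :: bad_field is 0 using prime_gt_0_nat[OF bad_prime(1)] by simp
lift_definition one_bad_field :: bad_field is 1 using prime_gt_1_nat[OF bad_prime(1)] by simp
lift_definition plus_bad_field :: "bad_field \<Rightarrow> bad_field \<Rightarrow> bad_field"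
  is "\<lambda>x y. (x + y) mod int bad_prime" using prime_gt_0_nat[OF bad_prime(1)] by simp
lift_definition minus_bad_field :: "bad_field \<Rightarrow> bad_field \<Rightarrow> bad_field"
  is "\<lambda>x y. (x - y) mod int bad_prime" using prime_gt_0_nat[OF bad_prime(1)] by simp
lift_definition times_bad_field :: "bad_field \<Rightarrow> bad_field \<Rightarrow> bad_field"
  is "\<lambda>x y. (x * y) mod int bad_prime" using prime_gt_0_nat[OF bad_prime(1)] by simp
lift_definition uminus_bad_field :: "bad_field \<Rightarrow> bad_field"
  is "\<lambda>x. (- x) mod int bad_prime" using prime_gt_0_nat[OF bad_prime(1)] by simp
instance
  by standard (transfer; simp add: mod_simps algebra_simps)+
end

instantiation bad_field :: field
begin
definition inverse_bad_field :: "bad_field \<Rightarrow> bad_field"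
  where "inverse_bad_field x = (if x = 0 then 0 else THE y. x * y = 1)"
definition divide_bad_field :: "bad_field \<Rightarrow> bad_field \<Rightarrow> bad_field"
  where "divide_bad_field x y = x * inverse y"
instance
proof
  fix a b :: bad_field
  show "a div b = a * inverse b" by (simp add: divide_bad_field_def)
  show "inverse (0::bad_field) = 0" by (simp add: inverse_bad_field_def)
  assume a: "a \<noteq> 0"
  have "coprime (Rep_bad_field a) (int bad_prime)"
  proof -
    have "Rep_bad_field a \<in> {0..<int bad_prime}" "Rep_bad_field a \<noteq> 0"
      using a Rep_bad_field[of a] Rep_bad_field_inject[of a 0] by (simp_all add: zero_bad_field.rep_eq)
    hence "\<not> int bad_prime dvd Rep_bad_field a" by (auto dest: zdvd_imp_le)
    thus ?thesis using bad_prime(1) by (metis coprime_commute prime_imp_coprime prime_nat_int_transfer)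
  qed
  then obtain b where b: "[Rep_bad_field a * b = 1] (mod int bad_prime)" using cong_solve_coprime_int by blast
  define y where "y = Abs_bad_field (b mod int bad_prime)"
  have "Rep_bad_field y = b mod int bad_prime"
    unfolding y_def using prime_gt_0_nat[OF bad_prime(1)] by (intro Abs_bad_field_inverse) auto
  hence "Rep_bad_field (a * y) = Rep_bad_field 1"
    using b prime_gt_1_nat[OF bad_prime(1)]
    by (simp add: times_bad_field.rep_eq one_bad_field.rep_eq cong_def mod_simps)
  hence "\<exists>y. a * y = 1" by (auto simp: Rep_bad_field_inject)
  then obtain y where y: "a * y = 1" by blast
  have "(THE y. a * y = 1) = y"
    using y by (intro the_equality) (auto, metis mult.assoc mult.commute mult.right_neutral)
  thus "inverse a * a = 1" using a y by (simp add: inverse_bad_field_def mult.commute)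
qed
end
lemma of_nat_bad_field: "Rep_bad_field (of_nat n) = int n mod int bad_prime"
  by (induction n) (use prime_gt_1_nat[OF bad_prime(1)] in \<open>auto simp: zero_bad_field.rep_eq plus_bad_field.rep_eq one_bad_field.rep_eq mod_simps\<close>)
lemma CHAR_bad_field: "CHAR(bad_field) = bad_prime"
proof (rule CHAR_eqI)
  show "of_nat bad_prime = (0::bad_field)"
    by (metis Rep_bad_field_inverse mod_self of_nat_bad_field zero_bad_field.abs_eq)
  show "bad_prime dvd x" if "of_nat x = (0::bad_field)" for x
    using that of_nat_bad_field[of x] by (simp add: zero_bad_field.rep_eq) presburger
qed

theorem cubic_bound_all: assumes "prime p" shows "cubic_bound_holds p"
proof -
  interpret closed_char_p bad_prime "TYPE(bad_field alg_closure)"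
    by unfold_locales (simp_all add: CHAR_bad_field bad_prime(1))
  show ?thesis using cubic_bound bad_prime(2)[OF assms] by blast
qed

section \<open>Choice of parameters\<close>

lemma (in domain) mult_linear_factors:
  assumes x: "x \<in> carrier R" and y: "y \<in> carrier R" and z: "z \<in> carrier R"
  shows "poly_mult [\<one>, \<ominus> x] (poly_mult [\<one>, \<ominus> y] [\<one>, \<ominus> z]) =
    [\<one>, \<ominus> (x \<oplus> y \<oplus> z), x \<otimes> y \<oplus> x \<otimes> z \<oplus> y \<otimes> z, \<ominus> (x \<otimes> y \<otimes> z)]"
proof -
  have 1: "poly_mult [\<one>, \<ominus> y] [\<one>, \<ominus> z] = [\<one>, \<ominus> (y \<oplus> z), y \<otimes> z]"
  \<comment> \<open>Products of coefficient lists are normalised by stripping leading zeros, so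
    intermediate lists have different lengths according to whether the constant term
    vanishes.\<close>
  proof (cases "y = \<zero>")
    case True
    thus ?thesis using z by simp
  next
    case False
    thus ?thesis using y z by (simp, algebra)
  qed
  show ?thesis unfolding 1
  proof (cases "x = \<zero>")
    case True
    thus "poly_mult [\<one>, \<ominus> x] [\<one>, \<ominus> (y \<oplus> z), y \<otimes> z] =
      [\<one>, \<ominus> (x \<oplus> y \<oplus> z), x \<otimes> y \<oplus> x \<otimes> z \<oplus> y \<otimes> z, \<ominus> (x \<otimes> y \<otimes> z)]" using y z by simp
  next
    case False
    thus "poly_mult [\<one>, \<ominus> x] [\<one>, \<ominus> (y \<oplus> z), y \<otimes> z] =
      [\<one>, \<ominus> (x \<oplus> y \<oplus> z), x \<otimes> y \<oplus> x \<otimes> z \<oplus> y \<otimes> z, \<ominus> (x \<otimes> y \<otimes> z)]" using x y z by (simp, algebra)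
  qed
qed

lemma (in domain) alg_mult_double_root:
  assumes x: "x \<in> carrier R" and z: "z \<in> carrier R"
  shows "alg_mult [\<one>, \<ominus> (x \<oplus> x \<oplus> z), x \<otimes> x \<oplus> x \<otimes> z \<oplus> x \<otimes> z, \<ominus> (x \<otimes> x \<otimes> z)] x > 1"
proof -
  interpret UP: domain "poly_ring R" using univ_poly_is_domain[OF carrier_is_subring] .
  define q where "q = [\<one>, \<ominus> (x \<oplus> x \<oplus> z), x \<otimes> x \<oplus> x \<otimes> z \<oplus> x \<otimes> z, \<ominus> (x \<otimes> x \<otimes> z)]"
  have carr: "[\<one>, \<ominus> x] \<in> carrier (poly_ring R)" "[\<one>, \<ominus> z] \<in> carrier (poly_ring R)" "q \<in> carrier (poly_ring R)"
    using x z unfolding sym[OF univ_poly_carrier] polynomial_def q_def by auto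
  have "q = [\<one>, \<ominus> x] \<otimes>\<^bsub>poly_ring R\<^esub> ([\<one>, \<ominus> x] \<otimes>\<^bsub>poly_ring R\<^esub> [\<one>, \<ominus> z])"
    unfolding univ_poly_mult q_def using mult_linear_factors[OF x x z] by simp
  also have "\<dots> = ([\<one>, \<ominus> x] [^]\<^bsub>poly_ring R\<^esub> (2::nat)) \<otimes>\<^bsub>poly_ring R\<^esub> [\<one>, \<ominus> z]"
    using carr by (simp add: numeral_2_eq_2 UP.m_assoc)
  finally have "([\<one>, \<ominus> x] [^]\<^bsub>poly_ring R\<^esub> (2::nat)) pdivides q"
    unfolding pdivides_def factor_def using carr by blast
  hence "2 \<le> alg_mult q x" using carr x by (intro alg_multE(2)) (auto simp: q_def)
  thus ?thesis by (simp add: q_def)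
qed

lemma cubic_form_residue_ring:
  assumes "m > 1"
  shows "cubic_form (residue_ring m) a b c x y = (x ^ 3 + a * x ^ 2 * y + b * x * y ^ 2 + c * y ^ 3) mod m"
proof -
  have p2: "u [^]\<^bsub>residue_ring m\<^esub> (2::nat) = u ^ 2 mod m" and p3: "u [^]\<^bsub>residue_ring m\<^esub> (3::nat) = u ^ 3 mod m" for u
    by (simp_all add: residue_ring_def nat_pow_def numeral_2_eq_2 numeral_3_eq_3 mod_simps mult_ac)
  show ?thesis unfolding cubic_form_def p2 p3
    by (simp add: residue_ring_def mod_simps)
qed

text \<open>A factorisation with integers \<open>r\<close> and \<open>s\<close> is carried by the
  embedding \<iota> into the algebraic closure, where it contradicts nondegeneracy. Double roots
  outside the prime field need not be transported, by \<open>double_root_rational\<close>.\<close>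

lemma nondegenerate_no_double_root:
  assumes p: "prime p" and mem: "a \<in> carrier (residue_ring (int p))" "b \<in> carrier (residue_ring (int p))" "c \<in> carrier (residue_ring (int p))"
    and nd: "nondegenerate_cubic (residue_ring (int p)) a b c"
  shows "no_double_root p a b c"
  unfolding no_double_root_def
proof
  assume "\<exists>r s. [a = - (2 * r + s)] (mod int p) \<and> [b = r * r + 2 * r * s] (mod int p) \<and> [c = - (r * r * s)] (mod int p)"
  then obtain r s where rs: "[a = - (2 * r + s)] (mod int p)" "[b = r * r + 2 * r * s] (mod int p)" "[c = - (r * r * s)] (mod int p)"
    by blast
  define R where "R = residue_ring (int p)"
  interpret residues_prime p R by unfold_locales (simp_all add: p R_def)
  have fR: "field R" by (rule is_field)
  define \<iota> :: "int \<Rightarrow> (int list \<times> nat) multiset \<Rightarrow> int" where "\<iota> = ring.indexed_const R"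
  define L where "L = field.alg_closure R"
  interpret L: algebraic_closure L "\<iota> ` carrier R" unfolding L_def \<iota>_def by (rule field.alg_closureE(1)[OF fR])
  have hom: "\<iota> \<in> ring_hom R L" unfolding L_def \<iota>_def by (rule field.alg_closureE(2)[OF fR])
  interpret h: ring_hom_ring R L \<iota>
    using hom by (intro ring_hom_ringI2 ring_axioms L.ring_axioms)
  define x z where "x = r mod int p" and "z = s mod int p"
  have pp: "int p > 0" using p prime_gt_0_nat by simp
  have xz: "x \<in> carrier R" "z \<in> carrier R" using pp by (auto simp: x_def z_def R_def residue_ring_def)
  have red: "a mod int p = a" "b mod int p = b" "c mod int p = c"
    using mem by (auto simp: residue_ring_def)
  have "a = \<ominus>\<^bsub>R\<^esub> (x \<oplus>\<^bsub>R\<^esub> x \<oplus>\<^bsub>R\<^esub> z)" "b = x \<otimes>\<^bsub>R\<^esub> x \<oplus>\<^bsub>R\<^esub> x \<otimes>\<^bsub>R\<^esub> z \<oplus>\<^bsub>R\<^esub> x \<otimes>\<^bsub>R\<^esub> z" "c = \<ominus>\<^bsub>R\<^esub> (x \<otimes>\<^bsub>R\<^esub> x \<otimes>\<^bsub>R\<^esub> z)"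
  proof -
    have "\<ominus>\<^bsub>R\<^esub> (x \<oplus>\<^bsub>R\<^esub> x \<oplus>\<^bsub>R\<^esub> z) = (- (r + r + s)) mod int p"
      "x \<otimes>\<^bsub>R\<^esub> x \<oplus>\<^bsub>R\<^esub> x \<otimes>\<^bsub>R\<^esub> z \<oplus>\<^bsub>R\<^esub> x \<otimes>\<^bsub>R\<^esub> z = (r * r + r * s + r * s) mod int p"
      "\<ominus>\<^bsub>R\<^esub> (x \<otimes>\<^bsub>R\<^esub> x \<otimes>\<^bsub>R\<^esub> z) = (- (r * r * s)) mod int p"
      unfolding res_add_eq res_mult_eq res_neg_eq x_def z_def by (simp_all only: mod_simps)
    moreover have eqs: "- (2 * r + s) = - (r + r + s)" "r * r + 2 * r * s = r * r + r * s + r * s" by simp_all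
    ultimately show "a = \<ominus>\<^bsub>R\<^esub> (x \<oplus>\<^bsub>R\<^esub> x \<oplus>\<^bsub>R\<^esub> z)"
      "b = x \<otimes>\<^bsub>R\<^esub> x \<oplus>\<^bsub>R\<^esub> x \<otimes>\<^bsub>R\<^esub> z \<oplus>\<^bsub>R\<^esub> x \<otimes>\<^bsub>R\<^esub> z"
      "c = \<ominus>\<^bsub>R\<^esub> (x \<otimes>\<^bsub>R\<^esub> x \<otimes>\<^bsub>R\<^esub> z)"
      using rs[unfolded eqs cong_def red] by (simp_all only:)
  qed
  hence "map \<iota> (dehomogenized_cubic R a b c) =
     [\<one>\<^bsub>L\<^esub>, \<ominus>\<^bsub>L\<^esub> (\<iota> x \<oplus>\<^bsub>L\<^esub> \<iota> x \<oplus>\<^bsub>L\<^esub> \<iota> z),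
      \<iota> x \<otimes>\<^bsub>L\<^esub> \<iota> x \<oplus>\<^bsub>L\<^esub> \<iota> x \<otimes>\<^bsub>L\<^esub> \<iota> z \<oplus>\<^bsub>L\<^esub> \<iota> x \<otimes>\<^bsub>L\<^esub> \<iota> z,
      \<ominus>\<^bsub>L\<^esub> (\<iota> x \<otimes>\<^bsub>L\<^esub> \<iota> x \<otimes>\<^bsub>L\<^esub> \<iota> z)]"
    unfolding dehomogenized_cubic_def using xz by simp
  hence "L.alg_mult (map \<iota> (dehomogenized_cubic R a b c)) (\<iota> x) > 1"
    using L.alg_mult_double_root[of "\<iota> x" "\<iota> z"] xz h.hom_closed by (simp only:)
  moreover have "\<iota> x \<in> carrier L" using xz by simp
  moreover have "\<forall>x\<in>carrier L. \<not> L.alg_mult (map \<iota> (dehomogenized_cubic R a b c)) x > 1"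
    using nd unfolding nondegenerate_cubic_def R_def[symmetric] L_def[symmetric] \<iota>_def[symmetric] .
  ultimately show False by blast
qed

lemma int_character_residue_ring:
  assumes "mult_character (residue_ring (int p)) \<chi>" "\<not> principal_character (residue_ring (int p)) \<chi>"
  shows "int_character p \<chi>"
proof -
  have *: "carrier (residue_ring (int p)) - {0} = {1..<int p}"
    "\<zero>\<^bsub>residue_ring (int p)\<^esub> = 0" "x \<otimes>\<^bsub>residue_ring (int p)\<^esub> y = x * y mod int p" for x y
    by (auto simp: residue_ring_def)
  show ?thesis using assms unfolding mult_character_def principal_character_def int_character_def * by blast
qed

text \<open>The estimate for boxes needs \<open>2 * N * H \<le> p\<close> and thus limits their
  sides. Longer intervals are cut into pieces of length \<open>N\<close> and a shorter
  remainder.\<close>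

lemma subdivide_interval:
  fixes g :: "int \<Rightarrow> complex"
  assumes B: "\<And>m n. n \<le> N \<Longrightarrow> cmod (\<Sum>x\<in>{m..<m + int n}. g x) \<le> B" and N: "N > 0"
  shows "cmod (\<Sum>x\<in>{m..<m + int n}. g x) \<le> real (n div N + 1) * B"
proof (induction n arbitrary: m rule: less_induct)
  case (less n)
  have B0: "B \<ge> 0" using B[of 0 0] by simp
  show ?case
  proof (cases "n < N")
    case True
    thus ?thesis using B[of n m] by simp
  next
    case False
    have "{m..<m + int n} = {m..<m + int N} \<union> {m + int N..<(m + int N) + int (n - N)}" using False by auto
    hence "(\<Sum>x\<in>{m..<m + int n}. g x) = (\<Sum>x\<in>{m..<m + int N}. g x) + (\<Sum>x\<in>{m + int N..<(m + int N) + int (n - N)}. g x)"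
      by (simp only:) (rule sum.union_disjoint, auto)
    also have "cmod \<dots> \<le> B + real ((n - N) div N + 1) * B"
      using False N by (intro order.trans[OF norm_triangle_ineq] add_mono B less) auto
    also have "(n - N) div N + 1 = n div N" using False N by (simp add: le_div_geq)
    finally show ?thesis by (simp add: algebra_simps)
  qed
qed

lemma subdivide_box:
  fixes f :: "int \<Rightarrow> int \<Rightarrow> complex"
  assumes B: "\<And>m1 n1 m2 n2. n1 \<le> N \<Longrightarrow> n2 \<le> N \<Longrightarrow>
      cmod (\<Sum>x\<in>{m1..<m1 + int n1}. \<Sum>y\<in>{m2..<m2 + int n2}. f x y) \<le> B" and N: "N > 0"
  shows "cmod (\<Sum>x\<in>{m1..<m1 + int n1}. \<Sum>y\<in>{m2..<m2 + int n2}. f x y) \<le>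
    real (n2 div N + 1) * (real (n1 div N + 1) * B)"
proof -
  have "cmod (\<Sum>y\<in>{m2..<m2 + int n2}. \<Sum>x\<in>{m1..<m1 + int n1}. f x y) \<le> real (n1 div N + 1) * B" if "n2 \<le> N" for m2 n2
    by (subst sum.swap, rule subdivide_interval[OF _ N]) (rule B[OF _ that])
  from subdivide_interval[OF this N] show ?thesis by (subst sum.swap)
qed

lemma powr_pow: "q > 0 \<Longrightarrow> (q powr u) ^ n = q powr (real n * u)" for q :: real
  by (induction n) (auto simp: powr_add algebra_simps)

lemma power_le_imp_le_base_pos: "x ^ n \<le> y ^ n \<Longrightarrow> 0 < n \<Longrightarrow> 0 \<le> y \<Longrightarrow> x \<le> y" for x y :: real
  by (metis not_le power_strict_mono)

lemma floor_bounds: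
  assumes "u \<ge> 2"
  shows "u / 2 \<le> real (nat \<lfloor>u\<rfloor>)" "real (nat \<lfloor>u\<rfloor>) \<le> u"
  using assms by linarith+

text \<open>Here \<open>H\<close> and \<open>T\<close> are about \<open>q powr (3 / 8 + e / 2)\<close> and \<open>q powr (e / 4)\<close>; the exponent \<open>k\<close> is so large
  that \<open>T ^ k \<ge> q powr (3 / 2)\<close>.\<close>

lemma box_estimate:
  fixes e q :: real and p k r :: nat
  defines "q \<equiv> real p"
  assumes e: "0 < e" "e \<le> 1 / 16" and p: "prime p" and k: "k = 2 ^ r" "12 / e \<le> real k"
    and C: "C \<le> q powr (e / (2 * real k))" "41 \<le> C" "144 * (real k ^ (2 * k) + 8 * real k ^ 3) * (1 + 2 / e) \<le> C"
    and chi: "int_character p \<chi>" and nd: "no_double_root p a b c"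
  defines "N \<equiv> nat \<lfloor>q powr (3 / 8 + e)\<rfloor>"
  assumes N12: "N1 \<le> N" "N2 \<le> N"
  shows "cmod (\<Sum>x\<in>{m1..<m1 + int N1}. \<Sum>y\<in>{m2..<m2 + int N2}.
       \<chi> ((x ^ 3 + a * x ^ 2 * y + b * x * y ^ 2 + c * y ^ 3) mod int p)) \<le> 10 * real N ^ 2 * q powr (- (e / real k))"
proof -
  have q1: "q > 1" using p prime_gt_1_nat by (simp add: q_def)
  have k4: "real k \<ge> 192"
  proof -
    have "12 / (1/16) \<le> 12 / e" using e by (intro divide_left_mono) auto
    thus ?thesis using k(2) by simp
  qed
  have ke: "real k * e \<ge> 12" using k(2) e by (simp add: field_simps)
  have mono: "q powr s \<le> q powr t" if "s \<le> t" for s t using q1 that by (intro powr_mono) auto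
  have big: "C \<le> q powr s" if "e / (2 * real k) \<le> s" for s using C(1) mono[OF that] by linarith
  have ek: "e / (2 * real k) \<le> e / 8" "e / real k \<le> e / 4" "e / (2 * real k) \<le> e"
    using e k4 by (auto intro!: divide_left_mono simp: divide_le_eq)
  define u v w where "u = q powr (3 / 8 + e)" and "v = q powr (3 / 8 + e / 2)" and "w = q powr (e / 4)"
  have ge: "u \<ge> 41" "v \<ge> 41" "w \<ge> 41"
    using big[of "3 / 8 + e"] big[of "3 / 8 + e / 2"] big[of "e / 4"] ek e C(2) by (auto simp: u_def v_def w_def)
  define H T where "H = nat \<lfloor>v\<rfloor>" and "T = nat \<lfloor>w\<rfloor>"
  have Nb: "u / 2 \<le> real N" "real N \<le> u" using floor_bounds[of u] ge by (auto simp: N_def u_def)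
  have Hb: "v / 2 \<le> real H" "real H \<le> v" using floor_bounds[of v] ge by (auto simp: H_def)
  have Tb: "w / 2 \<le> real T" "real T \<le> w" using floor_bounds[of w] ge by (auto simp: T_def)
  have HN: "H \<le> N" unfolding H_def N_def u_def[symmetric] 
    using mono[of "3 / 8 + e / 2" "3 / 8 + e"] e by (intro nat_mono floor_mono) (auto simp: u_def v_def)
  have H6: "6 \<le> H" using Hb ge by linarith
  have T0: "0 < T" using Tb ge by linarith
  have Tp: "T < p"
  proof -
    have "w < q powr 1" unfolding w_def using q1 e by (intro powr_less_mono) auto
    hence "real T < real p" using Tb q1 by (simp add: q_def)
    thus ?thesis by simp
  qed
  \<comment> \<open>The factor 2 costs at most \<open>q powr e\<close>, and the exponent
    \<open>3 / 4 + 5 / 2 * e\<close> is below 1 because \<open>e \<le> 1 / 16\<close>.\<close>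
  have NH: "2 * N * H \<le> p"
  proof -
    have "real N * real H \<le> u * v" using Nb Hb ge by (intro mult_mono) auto
    also have "u * v = q powr (3 / 4 + 3 / 2 * e)" by (simp add: u_def v_def flip: powr_add)
    finally have "2 * (real N * real H) \<le> q powr e * q powr (3 / 4 + 3 / 2 * e)"
      using big[OF ek(3)] C(2) by (intro mult_mono) auto
    also have "\<dots> = q powr (3 / 4 + 5 / 2 * e)" by (simp add: add.commute flip: powr_add)
    also have "\<dots> \<le> q powr 1" using e by (intro mono) simp
    finally have "real (2 * N * H) \<le> real p" using q1 by (simp add: q_def)
    thus ?thesis by (simp only: of_nat_le_iff)
  qed
  obtain Z where Z: "Z \<ge> 0" "cmod (\<Sum>x\<in>{m1..<m1 + int N1}. \<Sum>y\<in>{m2..<m2 + int N2}.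
       \<chi> ((x ^ 3 + a * x ^ 2 * y + b * x * y ^ 2 + c * y ^ 3) mod int p)) \<le> 4 * real N * real (T * H) + Z"
    "(real T * real H ^ 2 / 2 * Z) ^ (2 * k) \<le>
      (real N ^ 2 * real H ^ 2) ^ (2 * k - 2) * ((9 * real N ^ 2 * real H ^ 2 * harmonic H) *
       (real T ^ k * real k ^ (2 * k) * real p ^ 3 + real T ^ (2 * k) * (real (2 * k) ^ 3 * sqrt (real p) ^ 3)))"
    using cubic_bound_all[OF p, unfolded cubic_bound_holds_def, rule_format, OF chi nd N12 H6 HN NH T0 Tp k(1), of m2 m1] by blast
  define n h t l s D where "n = real N" and "h = real H" and "t = real T" and "l = harmonic H"
    and "s = q powr (3 / 2)" and "D = real k ^ (2 * k) + 8 * real k ^ 3"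
  have pos: "n > 0" "h > 0" "t > 0" "s > 0" "D \<ge> 0" using Nb Hb Tb ge q1 by (auto simp: n_def h_def t_def s_def D_def)
  have s3: "sqrt (real p) ^ 3 = s" using q1 unfolding s_def q_def[symmetric]
    by (simp add: powr_half_sqrt[symmetric] powr_pow)
  have p3: "real p ^ 3 = s * s" using q1 unfolding s_def q_def[symmetric]
    by (simp flip: powr_add)
  have l1: "l \<ge> 0" "l \<le> (1 + 2 / e) * q powr (e / 2)"
  proof -
    show "l \<ge> 0" using harmonic_ge_1[of H] H6 by (simp add: l_def)
    have "l \<le> 1 + ln (real H)" unfolding l_def using H6 by (intro harmonic_le) simp
    also have "ln (real H) \<le> ln q"
    proof -
      have "1 * H \<le> 2 * N * H" using HN H6 by (intro mult_le_mono) auto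
      hence "H \<le> p" using NH by linarith
      thus ?thesis using H6 by (simp add: q_def)
    qed
    also have "ln q \<le> q powr (e / 2) / (e / 2)" using q1 e by (intro ln_powr_bound) auto
    also have "1 + q powr (e / 2) / (e / 2) \<le> q powr (e / 2) + q powr (e / 2) / (e / 2)"
      using q1 e by (intro add_right_mono ge_one_powr_ge_zero) auto
    finally show "l \<le> (1 + 2 / e) * q powr (e / 2)" by (simp add: algebra_simps)
  qed
  \<comment> \<open>Rounding \<open>w\<close> down costs at most a factor 2, hence at most
    \<open>q powr (e / 8)\<close>; then \<open>k * e \<ge> 12\<close> gives
    \<open>k * e / 8 \<ge> 3 / 2\<close>. This lets the Weil term dominate the contribution of the
    repeated shifts.\<close>
  have Tk: "s \<le> t ^ k"
  proof -
    have "q powr (e / 8) * 2 \<le> q powr (e / 8) * q powr (e / 8)"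
      using big[OF ek(1)] C(2) by (intro mult_left_mono) auto
    also have "\<dots> = w" by (simp add: w_def flip: powr_add)
    finally have "q powr (e / 8) \<le> t" using Tb by (simp add: t_def)
    hence "(q powr (e / 8)) ^ k \<le> t ^ k" by (intro power_mono) auto
    moreover have "(q powr (e / 8)) ^ k = q powr (real k * e / 8)"
      using q1 by (simp add: powr_pow)
    moreover have "s \<le> q powr (real k * e / 8)" unfolding s_def using ke by (intro mono) simp
    ultimately show ?thesis by linarith
  qed
  have M: "t ^ k * real k ^ (2 * k) * (s * s) + t ^ (2 * k) * (real (2 * k) ^ 3 * s) \<le> t ^ (2 * k) * s * D"
  proof -
    have "t ^ k * (s * s) \<le> t ^ k * (t ^ k * s)" using Tk pos by (intro mult_left_mono mult_right_mono) auto
    also have "\<dots> = t ^ (2 * k) * s" by (simp add: mult_2 power_add)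
    finally have "real k ^ (2 * k) * (t ^ k * (s * s)) \<le> real k ^ (2 * k) * (t ^ (2 * k) * s)"
      by (intro mult_left_mono) auto
    thus ?thesis by (simp add: D_def algebra_simps power_mult_distrib)
  qed
  define Y where "Y = t * h ^ 2 / 2 * Z"
  define U where "U = n ^ 2 * h ^ 2"
  have U0: "U > 0" using pos by (simp add: U_def)
  \<comment> \<open>Here the exponent 3/8 is decisive: \<open>U\<close> is at least
    \<open>q powr (3 / 2 + 3 * e) / 16\<close> and so exceeds \<open>s\<close> by enough to absorb
    the logarithm, the constants and \<open>q powr (2 * e)\<close>. The 144 in the bound for
    \<open>C\<close> is 9 times 16.\<close>
  have key: "9 * l * (s * D) \<le> q powr (- (2 * e)) * U"
  proof -
    have "9 * l * (s * D) \<le> 9 * ((1 + 2 / e) * q powr (e / 2)) * (s * D)"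
      using l1 pos by (intro mult_right_mono mult_left_mono) auto
    also have "\<dots> = (144 * D * (1 + 2 / e)) * q powr (e / 2) * s / 16" by simp
    also have "\<dots> \<le> q powr (e / 2) * q powr (e / 2) * s / 16"
    proof -
      have "e / (2 * real k) \<le> e / 2" using ek(1) e by linarith
      hence "144 * D * (1 + 2 / e) \<le> q powr (e / 2)" using C(3) big[of "e / 2"] unfolding D_def by linarith
      thus ?thesis using pos by (intro divide_right_mono mult_right_mono) auto
    qed
    also have "q powr (e / 2) * q powr (e / 2) * s = q powr (3 / 2 + e)" by (simp add: s_def add.commute flip: powr_add)
    also have "q powr (3 / 2 + e) / 16 = q powr (- (2 * e)) * ((u / 2) ^ 2 * (v / 2) ^ 2)"
    proof -
      have 1: "(u / 2) ^ 2 = q powr (3 / 4 + 2 * e) / 4" and 2: "(v / 2) ^ 2 = q powr (3 / 4 + e) / 4"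
        using q1 by (simp_all add: u_def v_def power_divide powr_pow distrib_left)
      show ?thesis unfolding 1 2 by (simp add: add.commute flip: powr_add)
    qed
    also have "\<dots> \<le> q powr (- (2 * e)) * U"
      unfolding U_def n_def h_def using Nb Hb ge by (intro mult_left_mono mult_mono power_mono) auto
    finally show ?thesis .
  qed
  have "Y ^ (2 * k) \<le> U ^ (2 * k - 2) * ((9 * n ^ 2 * h ^ 2 * l) * (t ^ k * real k ^ (2 * k) * (s * s) + t ^ (2 * k) * (real (2 * k) ^ 3 * s)))"
    using Z(3) unfolding Y_def U_def n_def h_def t_def l_def s3 p3 .
  also have "\<dots> \<le> U ^ (2 * k - 2) * ((9 * n ^ 2 * h ^ 2 * l) * (t ^ (2 * k) * s * D))"
    using pos l1 U0 by (intro mult_left_mono M) auto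
  also have "\<dots> = U ^ (2 * k - 2) * U * t ^ (2 * k) * (9 * l * (s * D))" by (simp add: U_def)
  also have "\<dots> \<le> U ^ (2 * k - 2) * U * t ^ (2 * k) * (q powr (- (2 * e)) * U)"
    using U0 pos by (intro mult_left_mono key) auto
  also have "\<dots> = U ^ (2 * k) * t ^ (2 * k) * q powr (- (2 * e))"
  proof -
    have "2 * k = (2 * k - 2) + 1 + 1" using k4 by simp
    hence "U ^ (2 * k) = U ^ (2 * k - 2) * U * U" by (metis power_add power_one_right)
    thus ?thesis by simp
  qed
  also have "q powr (- (2 * e)) = (q powr (- (e / real k))) ^ (2 * k)"
    using q1 k4 by (simp add: powr_pow)
  also have "U ^ (2 * k) * t ^ (2 * k) * (q powr (- (e / real k))) ^ (2 * k) = (U * t * q powr (- (e / real k))) ^ (2 * k)"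
    by (simp only: power_mult_distrib)
  finally have "Y ^ (2 * k) \<le> (U * t * q powr (- (e / real k))) ^ (2 * k)" .
  hence "Y \<le> U * t * q powr (- (e / real k))"
    by (rule power_le_imp_le_base_pos) (use U0 pos k4 in auto)
  hence "(t * h ^ 2 / 2) * Z \<le> (t * h ^ 2 / 2) * (2 * n ^ 2 * q powr (- (e / real k)))"
    by (simp add: Y_def U_def mult_ac)
  hence Zle: "Z \<le> 2 * n ^ 2 * q powr (- (e / real k))"
    using pos by (subst (asm) mult_le_cancel_left_pos) auto
  \<comment> \<open>The cost of shifting: \<open>T * H\<close> has exponent
    \<open>3 / 8 + 3 / 4 * e\<close>, smaller by \<open>e / 4\<close> than that of
    \<open>N\<close>.\<close>
  have "4 * real N * real (T * H) \<le> 8 * n ^ 2 * q powr (- (e / real k))"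
  proof -
    have "real (T * H) \<le> w * v" using Tb Hb ge by (simp, intro mult_mono) auto
    also have "w * v = u * q powr (- (e / 4))" by (simp add: u_def v_def w_def flip: powr_add)
    also have "\<dots> \<le> (2 * n) * q powr (- (e / real k))"
      using Nb ek ge by (intro mult_mono mono) (auto simp: n_def)
    finally have "4 * n * real (T * H) \<le> 4 * n * (2 * n * q powr (- (e / real k)))"
      using pos by (intro mult_left_mono) auto
    thus ?thesis by (simp add: n_def power2_eq_square)
  qed
  thus ?thesis using Z(2) Zle unfolding n_def by linarith
qed

theorem theorem3:
  fixes \<epsilon> :: real
  assumes "\<epsilon> > 0"
  shows "\<exists>\<delta>::real. \<delta> > 0 \<and> (\<exists>p0::nat. \<forall>p::nat. Factorial_Ring.prime p \<and> p \<ge> p0 \<longrightarrow>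
    (\<forall>(\<chi> :: int \<Rightarrow> complex) (a::int) (b::int) (c::int) (I :: int set) (J :: int set).
       mult_character (residue_ring (int p)) \<chi> \<and>
       \<not> principal_character (residue_ring (int p)) \<chi> \<and>
       a \<in> carrier (residue_ring (int p)) \<and>
       b \<in> carrier (residue_ring (int p)) \<and>
       c \<in> carrier (residue_ring (int p)) \<and>
       nondegenerate_cubic (residue_ring (int p)) a b c \<and>
       int_interval I \<and> I \<subseteq> {1..int p - 1} \<and> size_up_to_rounding I (real p powr (3/8 + \<epsilon>)) \<and>
       int_interval J \<and> J \<subseteq> {1..int p - 1} \<and> size_up_to_rounding J (real p powr (3/8 + \<epsilon>))
       \<longrightarrow>
       cmod (\<Sum>x\<in>I. \<Sum>y\<in>J. \<chi> (cubic_form (residue_ring (int p)) a b c x y))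
         < real p powr (-\<delta>) * real (card I) * real (card J)))"
proof -
  \<comment> \<open>The cap 1/16 keeps \<open>2 * N * H\<close> below \<open>p\<close>; for larger
    \<epsilon> the intervals are subdivided.\<close>
  define e where "e = min \<epsilon> (1 / 16)"
  have e: "0 < e" "e \<le> 1 / 16" "e \<le> \<epsilon>" using assms by (auto simp: e_def)
  obtain r where r: "12 / e < 2 ^ r" using real_arch_pow[of 2 "12 / e"] by auto
  define k where "k = (2::nat) ^ r"
  have k: "12 / e \<le> real k" using r by (simp add: k_def)
  have k0: "real k > 0" by (simp add: k_def)
  define C where "C = max 41 (144 * (real k ^ (2 * k) + 8 * real k ^ 3) * (1 + 2 / e))"
  \<comment> \<open>Half of the saving \<open>e / k\<close> obtained for one box. The other half
    absorbs the constant 40 = 2 * 2 * 10 from the subdivision in both directions, which is why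
    \<open>C\<close> is at least 41.\<close>
  define \<gamma> where "\<gamma> = e / (2 * real k)"
  have \<gamma>: "\<gamma> > 0" using e k0 by (simp add: \<gamma>_def)
  \<comment> \<open>Chosen so that \<open>C \<le> p powr \<gamma>\<close> for all
    \<open>p \<ge> p0\<close>; it depends on \<epsilon> only.\<close>
  define p0 where "p0 = nat \<lceil>C powr (1 / \<gamma>)\<rceil>"
  show ?thesis
  proof (intro exI[of _ \<gamma>] conjI \<gamma> exI[of _ p0] allI impI)
    fix p :: nat and \<chi> a b c I J
    assume pp: "prime p \<and> p0 \<le> p"
    assume h: "mult_character (residue_ring (int p)) \<chi> \<and>
       \<not> principal_character (residue_ring (int p)) \<chi> \<and>
       a \<in> carrier (residue_ring (int p)) \<and>
       b \<in> carrier (residue_ring (int p)) \<and>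
       c \<in> carrier (residue_ring (int p)) \<and>
       nondegenerate_cubic (residue_ring (int p)) a b c \<and>
       int_interval I \<and> I \<subseteq> {1..int p - 1} \<and> size_up_to_rounding I (real p powr (3/8 + \<epsilon>)) \<and>
       int_interval J \<and> J \<subseteq> {1..int p - 1} \<and> size_up_to_rounding J (real p powr (3/8 + \<epsilon>))"
    have p: "prime p" using pp by blast
    define q where "q = real p"
    have q1: "q > 1" using p prime_gt_1_nat by (simp add: q_def)
    have C41: "C \<ge> 41" by (simp add: C_def)
    have Cq: "C \<le> q powr \<gamma>"
    proof -
      have "C powr (1 / \<gamma>) \<le> q" using pp unfolding p0_def q_def by linarith
      hence "(C powr (1 / \<gamma>)) powr \<gamma> \<le> q powr \<gamma>" using \<gamma> by (intro powr_mono2) auto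
      thus ?thesis using \<gamma> C41 by (simp add: powr_powr)
    qed
    define N where "N = nat \<lfloor>q powr (3 / 8 + e)\<rfloor>"
    have N0: "N > 0"
    proof -
      have "1 \<le> q powr (3 / 8 + e)" using q1 e by (intro ge_one_powr_ge_zero) auto
      thus ?thesis by (simp add: N_def)
    qed
    define f where "f x y = \<chi> ((x ^ 3 + a * x ^ 2 * y + b * x * y ^ 2 + c * y ^ 3) mod int p)" for x y
    have box: "cmod (\<Sum>x\<in>{m1..<m1 + int n1}. \<Sum>y\<in>{m2..<m2 + int n2}. f x y) \<le> 10 * real N ^ 2 * q powr (- (e / real k))"
      if "n1 \<le> N" "n2 \<le> N" for m1 n1 m2 n2
      unfolding f_def N_def q_def
    proof (rule box_estimate[OF e(1,2) p k_def k])
      show "C \<le> real p powr (e / (2 * real k))" using Cq by (simp add: \<gamma>_def q_def)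
      show "int_character p \<chi>" using h int_character_residue_ring by blast
      show "no_double_root p a b c" using h nondegenerate_no_double_root[OF p] by blast
    qed (use that in \<open>auto simp: C_def N_def q_def\<close>)
    have interval: "\<exists>m n. S = {m..<m + int n} \<and> card S = n \<and> N \<le> n" 
      if S: "int_interval S" "size_up_to_rounding S (real p powr (3/8 + \<epsilon>))" for S
    proof -
      obtain m m' where S_eq: "S = {m..m'}" using S(1) by (auto simp: int_interval_def)
      have "real N \<le> q powr (3 / 8 + e)" unfolding N_def by simp
      also have "\<dots> \<le> q powr (3 / 8 + \<epsilon>)" using q1 e by (intro powr_mono) auto
      \<comment> \<open>The size is known up to an error less than 1, which still leaves room for
        the integer part \<open>N\<close>.\<close>
      also have "\<dots> < real (card S) + 1" using S(2) unfolding size_up_to_rounding_def q_def by linarith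
      finally have "N \<le> card S" by linarith
      moreover have "S = {m..<m + int (card S)}"
        using calculation N0 unfolding S_eq by (auto simp: card_atLeastAtMost_int)
      ultimately show ?thesis by blast
    qed
    obtain m1 n1 where I: "I = {m1..<m1 + int n1}" "card I = n1" "N \<le> n1" using interval h by blast
    obtain m2 n2 where J: "J = {m2..<m2 + int n2}" "card J = n2" "N \<le> n2" using interval h by blast
    have pieces: "real (n div N + 1) \<le> 2 * real n / real N" if "N \<le> n" for n
    proof -
      have "real (n div N) \<le> real n / real N" by (rule of_nat_div_le_of_nat)
      moreover have "1 \<le> real n / real N" using that N0 by simp
      ultimately show ?thesis by simp
    qed
    have "(\<Sum>x\<in>I. \<Sum>y\<in>J. \<chi> (cubic_form (residue_ring (int p)) a b c x y)) = (\<Sum>x\<in>I. \<Sum>y\<in>J. f x y)"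
      using cubic_form_residue_ring[of "int p" a b c] prime_gt_1_nat[OF p] by (simp add: f_def)
    also have "cmod \<dots> \<le> real (n2 div N + 1) * (real (n1 div N + 1) * (10 * real N ^ 2 * q powr (- (e / real k))))"
      unfolding I(1) J(1) by (rule subdivide_box[OF box N0])
    also have "\<dots> \<le> (2 * real n2 / real N) * ((2 * real n1 / real N) * (10 * real N ^ 2 * q powr (- (e / real k))))"
      using pieces[OF I(3)] pieces[OF J(3)] by (intro mult_mono mult_nonneg_nonneg) auto
    also have "\<dots> = 40 * q powr (- (e / real k)) * (real n1 * real n2)"
      using N0 by (simp add: power2_eq_square field_simps)
    also have "\<dots> < q powr (- \<gamma>) * (real n1 * real n2)"
    proof (rule mult_strict_right_mono)
      have "40 < q powr \<gamma>" using Cq C41 by linarith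
      hence "40 * q powr (- (e / real k)) < q powr \<gamma> * q powr (- (e / real k))"
        using q1 by (intro mult_strict_right_mono) auto
      also have "\<dots> = q powr (- \<gamma>)"
        using k0 by (simp add: \<gamma>_def field_simps flip: powr_add)
      finally show "40 * q powr (- (e / real k)) < q powr (- \<gamma>)" .
      show "0 < real n1 * real n2" using I(3) J(3) N0 by simp
    qed
    finally show "cmod (\<Sum>x\<in>I. \<Sum>y\<in>J. \<chi> (cubic_form (residue_ring (int p)) a b c x y))
         < real p powr (-\<gamma>) * real (card I) * real (card J)"
      by (simp add: I(2) J(2) q_def mult.assoc)
  qed
qed

end
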